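(* Let $p\geq 2$ and let $h\in C^2(\mathbb{R}^n)$ be nonnegative, positively homogeneous of degree $p$, with $\lambda|v|^2\leq\langle D^2h(x)v,v\rangle\leq\Lambda|v|^2$ for all $x\in S^{n-1}$, $v\in\mathbb{R}^n$, for some constants $0<\lambda\le\Lambda$. Let $T$ be an $h$-monotone map with $T\in L^{p-1}_{\mathrm{loc}}(\mathbb{R}^n)$. Then the map $x\mapsto Dh(x-Tx)$ is of bounded deformation and belongs to $t^{1,1}(x_0)$ for almost every $x_0\in\mathbb{R}^n$.
   Context: A multivalued map $T:\mathbb{R}^n\to\mathcal P(\mathbb{R}^n)$ is $h$-monotone if $h(x-\xi)+h(y-\zeta)\leq h(x-\zeta)+h(y-\xi)$ for all $x,y$ with $T(x),T(y)\neq\emptyset$ and all $\xi\in T(x)$, $\zeta\in T(y)$; such maps are single-valued a.e. and are regarded as a.e. defined functions $\mathbb{R}^n\to\mathbb{R}^n$. A map $u:\mathbb{R}^n\to\mathbb{R}^n$ is of bounded deformation if $u\in L^1_{\mathrm{loc}}(\mathbb{R}^n)$ and its symmetrized distributional gradient $\frac12\left(\frac{\partial u}{\partial x}+\left(\frac{\partial u}{\partial x}\right)^t\right)$ can be represented by a matrix-valued signed Radon measure. For $f\in L^1$ near $x_0$, $f\in t^{1,1}(x_0)$ means there is a polynomial $P_{x_0}$ of degree $\le1$ with $\fint_{B_r(x_0)}|f-P_{x_0}|\,dx=o(r)$ as $r\to0$ (componentwise for vector-valued $f$). *)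

theory Defs
  imports "HOL-Analysis.Analysis"
begin

fun Ck :: "nat \<Rightarrow> ('a::euclidean_space \<Rightarrow> real) \<Rightarrow> bool" where
  "Ck 0 f = continuous_on UNIV f"
| "Ck (Suc k) f = ((\<forall>x. f differentiable (at x)) \<and>
      (\<forall>v. Ck k (\<lambda>x. frechet_derivative f (at x) v)))"

definition smooth_fn :: "('a::euclidean_space \<Rightarrow> real) \<Rightarrow> bool" where
  "smooth_fn f \<longleftrightarrow> (\<forall>k. Ck k f)"

definition test_fn :: "('a::euclidean_space \<Rightarrow> real) \<Rightarrow> bool" where
  "test_fn \<phi> \<longleftrightarrow> smooth_fn \<phi> \<and> compact (closure {x. \<phi> x \<noteq> 0})"

definition grad :: "('a::euclidean_space \<Rightarrow> real) \<Rightarrow> 'a \<Rightarrow> 'a" where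
  "grad h x = (\<Sum>b\<in>Basis. frechet_derivative h (at x) b *\<^sub>R b)"

definition hess_form :: "('a::euclidean_space \<Rightarrow> real) \<Rightarrow> 'a \<Rightarrow> 'a \<Rightarrow> real" where
  "hess_form h x v = frechet_derivative (\<lambda>y. frechet_derivative h (at y) v) (at x) v"

definition h_monotone :: "('a::euclidean_space \<Rightarrow> real) \<Rightarrow> ('a \<Rightarrow> 'a set) \<Rightarrow> bool" where
  "h_monotone h T \<longleftrightarrow> (\<forall>x y \<xi> \<zeta>. \<xi> \<in> T x \<longrightarrow> \<zeta> \<in> T y \<longrightarrow>
      h (x - \<xi>) + h (y - \<zeta>) \<le> h (x - \<zeta>) + h (y - \<xi>))"

definition L1_loc :: "('a::euclidean_space \<Rightarrow> 'b::euclidean_space) \<Rightarrow> bool" where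
  "L1_loc u \<longleftrightarrow> u \<in> borel_measurable lebesgue \<and>
     (\<forall>K. compact K \<longrightarrow> set_integrable lebesgue K u)"

definition Lq_loc :: "real \<Rightarrow> ('a::euclidean_space \<Rightarrow> 'b::euclidean_space) \<Rightarrow> bool" where
  "Lq_loc q u \<longleftrightarrow> u \<in> borel_measurable lebesgue \<and>
     (\<forall>K. compact K \<longrightarrow> set_integrable lebesgue K (\<lambda>x. norm (u x) powr q))"

text \<open>A (real) signed Radon measure on R^n, given by its Jordan decomposition into two
  Borel measures that are finite on compact sets; it represents the distribution D if
  D phi = integral of phi against it, for every test function phi.\<close>
definition represented_by_signed_radon ::
    "(('a::euclidean_space \<Rightarrow> real) \<Rightarrow> real) \<Rightarrow> bool" where
  "represented_by_signed_radon D \<longleftrightarrow>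
     (\<exists>\<mu>p \<mu>m :: 'a measure.
        sets \<mu>p = sets borel \<and> sets \<mu>m = sets borel \<and>
        (\<forall>K. compact K \<longrightarrow> emeasure \<mu>p K < \<infinity> \<and> emeasure \<mu>m K < \<infinity>) \<and>
        (\<forall>\<phi>. test_fn \<phi> \<longrightarrow>
            integrable \<mu>p \<phi> \<and> integrable \<mu>m \<phi> \<and>
            D \<phi> = integral\<^sup>L \<mu>p \<phi> - integral\<^sup>L \<mu>m \<phi>))"

text \<open>Bounded deformation: u in L^1_loc and each entry (i,j) of the symmetrized
  distributional gradient (1/2)(d_j u_i + d_i u_j) is a signed Radon measure.
  The distributional derivative d_j u_i acts on phi by  - integral u_i * d_j phi.\<close>
definition bounded_deformation :: "('a::euclidean_space \<Rightarrow> 'a) \<Rightarrow> bool" where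
  "bounded_deformation u \<longleftrightarrow> L1_loc u \<and>
     (\<forall>i\<in>Basis. \<forall>j\<in>Basis. represented_by_signed_radon
        (\<lambda>\<phi>. - (1/2) * (\<integral>x. (u x \<bullet> i) * frechet_derivative \<phi> (at x) j
                              + (u x \<bullet> j) * frechet_derivative \<phi> (at x) i \<partial>lebesgue)))"

definition t11_real :: "('a::euclidean_space \<Rightarrow> real) \<Rightarrow> 'a \<Rightarrow> bool" where
  "t11_real f x0 \<longleftrightarrow>
     (\<exists>\<epsilon>>0. set_integrable lebesgue (ball x0 \<epsilon>) f) \<and>
     (\<exists>c::real. \<exists>a::'a.
        ((\<lambda>r. ((LINT x:ball x0 r|lebesgue. \<bar>f x - (c + a \<bullet> x)\<bar>)
                  / measure lebesgue (ball x0 r)) / r) \<longlongrightarrow> 0) (at_right 0))"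

definition t11 :: "('a::euclidean_space \<Rightarrow> 'b::euclidean_space) \<Rightarrow> 'a \<Rightarrow> bool" where
  "t11 f x0 \<longleftrightarrow> (\<forall>i\<in>Basis. t11_real (\<lambda>x. f x \<bullet> i) x0)"

end

theory Submission
  imports Defs
begin

text \<open>Testing \<open>h\<close>-monotonicity on suitable pairs of points shows that \<open>T\<close> is locally bounded. As \<open>h\<close> is
  \<open>C\<^sup>2\<close>, a second order expansion of \<open>h\<close> in the \<open>h\<close>-monotonicity inequality then makes \<open>u x = Dh (x - T x)\<close> one-sided
  Lipschitz on every ball: \<open>(u y - u x) \<bullet> (y - x) \<le> K |y - x|\<^sup>2\<close>. Hence the symmetrized gradient of \<open>u\<close>
  is bounded above by a locally bounded function, and by polarization and the Riesz representation of
  positive functionals it is a signed Radon measure. Moreover \<open>M x = K x - u x\<close> is monotone, so its resolvent is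
  Lipschitz; Rademacher's theorem for the resolvent and the negligibility of its critical values make
  \<open>M\<close>, and therefore \<open>u\<close>, differentiable almost everywhere relative to a set of full measure, which
  implies the \<open>t\<^sup>1\<^sup>,\<^sup>1\<close> property.\<close>

section \<open>Continuously differentiable functions with compact support\<close>

text \<open>Test functions are taken of class \<open>C1\<close> with compact support: explicit
  piecewise polynomial bumps are then available, and every functional in play involves only one
  derivative of the test function. The Riesz representation serves twice: for the entries of the
  symmetrized gradient and, sharpened by a domination by the Lebesgue integral, for bounded weak
  partial derivatives of Lipschitz functions, on which Rademacher's theorem rests. Passing to the
  resolvent has a price: its first order expansion must be inverted. This fails where the derivative
  is singular, hence the interest in the images of such points, and it needs continuity of the
  monotone map at the point, which comes from approximate continuity. The inequalities are known
  only where \<open>t\<close> selects from \<open>T\<close>, so one-sided bounds and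
  differentiability are stated relative to a set \<open>D\<close> of full measure rather than on
  neighbourhoods.\<close>

lemma grad_unique:
  fixes f :: "'a::euclidean_space \<Rightarrow> real"
  assumes "(f has_derivative (\<lambda>v. g \<bullet> v)) (at x)"
  shows "grad f x = g"
proof -
  have "frechet_derivative f (at x) = (\<lambda>v. g \<bullet> v)"
    using frechet_derivative_at[OF assms] by simp
  then show ?thesis
    by (simp add: grad_def euclidean_representation)
qed

lemma has_derivative_grad:
  fixes f :: "'a::euclidean_space \<Rightarrow> real"
  assumes "f differentiable (at x)"
  shows "(f has_derivative (\<lambda>v. grad f x \<bullet> v)) (at x)"
proof -
  have D: "(f has_derivative frechet_derivative f (at x)) (at x)"
    using assms frechet_derivative_works by blast
  then interpret bounded_linear "frechet_derivative f (at x)"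
    by (rule has_derivative_bounded_linear)
  have "frechet_derivative f (at x) v = grad f x \<bullet> v" for v
  proof -
    have "frechet_derivative f (at x) v = frechet_derivative f (at x) (\<Sum>b\<in>Basis. (v \<bullet> b) *\<^sub>R b)"
      by (simp add: euclidean_representation)
    also have "\<dots> = (\<Sum>b\<in>Basis. (v \<bullet> b) * frechet_derivative f (at x) b)"
      by (simp add: sum scale)
    also have "\<dots> = grad f x \<bullet> v"
      by (simp add: grad_def inner_sum_left inner_commute[of v] mult.commute)
    finally show ?thesis .
  qed
  then have "frechet_derivative f (at x) = (\<lambda>v. grad f x \<bullet> v)" by auto
  then show ?thesis using D by simp
qed

lemma frechet_derivative_grad:
  fixes f :: "'a::euclidean_space \<Rightarrow> real"
  assumes "f differentiable (at x)"
  shows "frechet_derivative f (at x) v = grad f x \<bullet> v"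
  using frechet_derivative_at[OF has_derivative_grad[OF assms]] by metis

definition C1 :: "('a::euclidean_space \<Rightarrow> real) \<Rightarrow> bool" where
  "C1 f \<longleftrightarrow> (\<forall>x. (f has_derivative (\<lambda>v. grad f x \<bullet> v)) (at x)) \<and> continuous_on UNIV (grad f)"

text \<open>One continuous derivative is enough for all functionals below and admits quadratic
  splines as test functions; \<open>test_fn_C1c\<close> brings the smooth ones into this
  class.\<close>

definition C1c :: "('a::euclidean_space \<Rightarrow> real) \<Rightarrow> bool" where
  "C1c f \<longleftrightarrow> C1 f \<and> bounded {x. f x \<noteq> 0}"

lemma C1_I:
  assumes "\<And>x. (f has_derivative (\<lambda>v. g x \<bullet> v)) (at x)" "continuous_on UNIV g"
  shows "C1 f"
proof -
  have "grad f = g" using grad_unique[OF assms(1)] by auto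
  then show ?thesis using assms by (simp add: C1_def)
qed

lemma C1_has_derivative: "C1 f \<Longrightarrow> (f has_derivative (\<lambda>v. grad f x \<bullet> v)) (at x)"
  by (simp add: C1_def)

lemma C1_differentiable: "C1 f \<Longrightarrow> f differentiable (at x)"
  using C1_has_derivative differentiable_def by blast

lemma C1_continuous_grad: "C1 f \<Longrightarrow> continuous_on S (grad f)"
  using C1_def continuous_on_subset by blast

lemma C1_continuous: "C1 f \<Longrightarrow> continuous_on S f"
  using C1_has_derivative has_derivative_continuous_on has_derivative_at_withinI by meson

lemma grad_add:
  assumes "C1 f" "C1 g" shows "grad (\<lambda>x. f x + g x) x = grad f x + grad g x"
  by (rule grad_unique) (auto simp: inner_add_left intro!: derivative_eq_intros C1_has_derivative assms)

lemma C1_add: "C1 f \<Longrightarrow> C1 g \<Longrightarrow> C1 (\<lambda>x. f x + g x)"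
  by (rule C1_I[where g="\<lambda>x. grad f x + grad g x"])
     (auto simp: inner_add_left intro!: derivative_eq_intros C1_has_derivative continuous_intros C1_continuous_grad)

lemma grad_cmult:
  assumes "C1 f" shows "grad (\<lambda>x. c * f x) x = c *\<^sub>R grad f x"
  by (rule grad_unique) (auto intro!: derivative_eq_intros C1_has_derivative assms)

lemma C1_mult: "C1 f \<Longrightarrow> C1 g \<Longrightarrow> C1 (\<lambda>x. f x * g x)"
  by (rule C1_I[where g="\<lambda>x. f x *\<^sub>R grad g x + g x *\<^sub>R grad f x"])
     (auto simp: inner_add_left
       intro!: derivative_eq_intros C1_has_derivative continuous_intros C1_continuous_grad C1_continuous)

lemma C1_const: "C1 (\<lambda>x. c)"
  by (rule C1_I[where g="\<lambda>x. 0"]) auto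

lemma C1c_C1: "C1c f \<Longrightarrow> C1 f"
  by (simp add: C1c_def)

lemma C1c_add: "C1c f \<Longrightarrow> C1c g \<Longrightarrow> C1c (\<lambda>x. f x + g x)"
  unfolding C1c_def
  by (auto intro: C1_add bounded_subset[of "{x. f x \<noteq> 0} \<union> {x. g x \<noteq> 0}"])

lemma C1c_mult: "C1c f \<Longrightarrow> C1 g \<Longrightarrow> C1c (\<lambda>x. f x * g x)"
  unfolding C1c_def
  by (auto intro: C1_mult bounded_subset[of "{x. f x \<noteq> 0}"])

lemma C1c_cmult: "C1c f \<Longrightarrow> C1c (\<lambda>x. c * f x)"
  using C1c_mult[OF _ C1_const, of f c] by (simp add: mult.commute)

lemma C1c_zero: "C1c (\<lambda>x. 0)"
  by (simp add: C1c_def C1_const)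

lemma C1c_diff: "C1c f \<Longrightarrow> C1c g \<Longrightarrow> C1c (\<lambda>x. f x - g x)"
  using C1c_add[OF _ C1c_cmult[of g "-1"]] by simp

lemma C1c_sum: "(\<And>i. i \<in> I \<Longrightarrow> C1c (f i)) \<Longrightarrow> C1c (\<lambda>x. \<Sum>i\<in>I. f i x)"
  by (induction I rule: infinite_finite_induct) (auto intro: C1c_zero C1c_add)

lemma test_fn_C1c:
  assumes "test_fn \<phi>" shows "C1c \<phi>"
proof -
  have "Ck (Suc 0) \<phi>"
    using assms by (simp add: test_fn_def smooth_fn_def)
  then have d: "\<And>x. \<phi> differentiable (at x)" and c: "\<And>v. continuous_on UNIV (\<lambda>x. frechet_derivative \<phi> (at x) v)"
    by auto
  have "continuous_on UNIV (grad \<phi>)"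
    unfolding grad_def by (intro continuous_intros c)
  moreover have "bounded {x. \<phi> x \<noteq> 0}"
    using assms unfolding test_fn_def by (meson bounded_subset closure_subset compact_imp_bounded)
  ultimately show ?thesis
    by (simp add: C1c_def C1_def has_derivative_grad d)
qed

lemma C1c_support:
  assumes "C1c f" obtains R where "R > 0" "\<forall>x. norm x > R \<longrightarrow> f x = 0"
  using assms unfolding C1c_def bounded_pos by force

lemma C1c_grad_support:
  assumes "C1c f" "\<forall>x. norm x > R \<longrightarrow> f x = 0" "norm x > R"
  shows "grad f x = 0"
proof (rule grad_unique)
  have "open {x::'a. norm x > R}"
    by (intro open_Collect_less continuous_intros)
  moreover have "((\<lambda>x. 0) has_derivative (\<lambda>v. 0 \<bullet> v)) (at x)"
    by simp
  ultimately show "(f has_derivative (\<lambda>v. 0 \<bullet> v)) (at x)"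
    using has_derivative_transform_within_open[of "\<lambda>x. 0" "\<lambda>v. 0 \<bullet> v" x UNIV "{x. norm x > R}" f] assms(2,3)
    by auto
qed

lemma C1c_bounded:
  assumes "C1c f" obtains B where "B > 0" "\<And>x. \<bar>f x\<bar> \<le> B"
proof -
  obtain R where R: "R > 0" "\<forall>x. norm x > R \<longrightarrow> f x = 0" by (rule C1c_support[OF assms])
  have "compact (f ` cball 0 R)"
    by (intro compact_continuous_image C1_continuous C1c_C1 assms) auto
  then have "bounded (f ` cball 0 R)"
    by (rule compact_imp_bounded)
  then obtain B where B: "B > 0" "\<forall>y\<in>f ` cball 0 R. norm y \<le> B"
    unfolding bounded_pos by blast
  have "\<bar>f x\<bar> \<le> B" for x
    using B R(2) by (cases "norm x > R") (auto simp: not_less)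
  then show ?thesis by (rule that[OF B(1)])
qed

section \<open>Explicit bumps and half-space cutoffs\<close>

lemma DERIV_pos_part_square: "((\<lambda>t. (max 0 t)\<^sup>2) has_real_derivative 2 * max 0 t) (at t)"
proof -
  consider "t < 0" | "t = 0" | "t > 0" by linarith
  then show ?thesis
  proof cases
    case 1
    have "((\<lambda>t. 0) has_real_derivative 0) (at t)" by simp
    then have "((\<lambda>t. (max 0 t)\<^sup>2) has_real_derivative 0) (at t)"
      by (rule has_field_derivative_transform_within_open[where S="{..<0}"]) (use 1 in auto)
    then show ?thesis using 1 by simp
  next
    case 2
    have "(\<lambda>h::real. (max 0 h)\<^sup>2 / h) \<midarrow>0\<rightarrow> 0"
    proof (rule Lim_null_comparison[where g="\<lambda>h. \<bar>h\<bar>"])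
      show "\<forall>\<^sub>F h::real in at 0. norm ((max 0 h)\<^sup>2 / h) \<le> \<bar>h\<bar>"
        by (rule always_eventually) (auto simp: max_def power2_eq_square)
    qed (auto intro!: tendsto_eq_intros)
    then show ?thesis using 2 by (simp add: DERIV_def)
  next
    case 3
    have "((\<lambda>t. t\<^sup>2) has_real_derivative 2 * t) (at t)"
      by (auto intro!: derivative_eq_intros)
    then have "((\<lambda>t. (max 0 t)\<^sup>2) has_real_derivative 2 * t) (at t)"
      by (rule has_field_derivative_transform_within_open[where S="{0<..}"]) (use 3 in auto)
    then show ?thesis using 3 by simp
  qed
qed

text \<open>The norm is squared inside to be differentiable at the centre, and the positive part is
  squared outside to be differentiable across the sphere.\<close>

definition bump :: "'a::euclidean_space \<Rightarrow> real \<Rightarrow> 'a \<Rightarrow> real" where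
  "bump a r x = (max 0 (r\<^sup>2 - (norm (x - a))\<^sup>2))\<^sup>2"

lemma bump_nonneg: "0 \<le> bump a r x"
  by (simp add: bump_def)

lemma bump_outside: "r \<ge> 0 \<Longrightarrow> norm (x - a) \<ge> r \<Longrightarrow> bump a r x = 0"
  by (simp add: bump_def max_def power2_eq_iff_nonneg power_mono)

lemma bump_le: "bump a r x \<le> r ^ 4"
proof -
  have "(max 0 (r\<^sup>2 - (norm (x - a))\<^sup>2))\<^sup>2 \<le> (r\<^sup>2)\<^sup>2"
    by (intro power_mono) auto
  then show ?thesis by (simp add: bump_def)
qed

lemma bump_ge:
  assumes "norm (x - a) \<le> s" "s \<le> r" "0 \<le> s"
  shows "(r\<^sup>2 - s\<^sup>2)\<^sup>2 \<le> bump a r x"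
proof -
  have "(norm (x - a))\<^sup>2 \<le> s\<^sup>2" "s\<^sup>2 \<le> r\<^sup>2" using assms by (auto intro: power_mono)
  then show ?thesis unfolding bump_def by (intro power_mono) auto
qed

lemma bump_translate: "bump (a + c) r x = bump a r (x - c)"
  by (simp add: bump_def algebra_simps)

lemma C1_bump: "C1 (bump a r)"
proof (rule C1_I[where g="\<lambda>x. (- 4 * max 0 (r\<^sup>2 - (norm (x - a))\<^sup>2)) *\<^sub>R (x - a)"])
  fix x
  have "((\<lambda>x. r\<^sup>2 - (x - a) \<bullet> (x - a)) has_derivative (\<lambda>v. - 2 * ((x - a) \<bullet> v))) (at x)"
    by (auto intro!: derivative_eq_intros simp: inner_commute)
  then have "((\<lambda>x. (max 0 (r\<^sup>2 - (x - a) \<bullet> (x - a)))\<^sup>2) has_derivative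
      (\<lambda>v. (- 2 * ((x - a) \<bullet> v)) * (2 * max 0 (r\<^sup>2 - (x - a) \<bullet> (x - a))))) (at x)"
    by (rule DERIV_compose_FDERIV[OF DERIV_pos_part_square])
  then show "(bump a r has_derivative (\<lambda>v. ((- 4 * max 0 (r\<^sup>2 - (norm (x - a))\<^sup>2)) *\<^sub>R (x - a)) \<bullet> v)) (at x)"
    unfolding bump_def by (simp add: power2_norm_eq_inner mult_ac)
qed (intro continuous_intros)

lemma C1c_bump: "C1c (bump a r)"
proof -
  have "{x. bump a r x \<noteq> 0} \<subseteq> cball a \<bar>r\<bar>"
  proof clarsimp
    fix x assume "bump a r x \<noteq> 0"
    then have "(norm (x - a))\<^sup>2 < \<bar>r\<bar>\<^sup>2" by (auto simp: bump_def max_def split: if_splits)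
    then show "dist a x \<le> \<bar>r\<bar>"
      using power_less_imp_less_base[of "norm (x - a)" 2 "\<bar>r\<bar>"] by (simp add: dist_norm norm_minus_commute)
  qed
  then show ?thesis
    using C1_bump bounded_subset bounded_cball unfolding C1c_def by blast
qed

text \<open>A quadratic spline with knots 0, 1/2 and 1: it is 1 - 2 t^2 on the first interval and 2
  (1 - t)^2 on the second, with constant values 1 to the left and 0 to the right.\<close>

definition cutoff :: "real \<Rightarrow> real" where
  "cutoff t = 1 - 2 * (max 0 t)\<^sup>2 + 4 * (max 0 (t - 1/2))\<^sup>2 - 2 * (max 0 (t - 1))\<^sup>2"

definition dcutoff :: "real \<Rightarrow> real" where
  "dcutoff t = - 4 * max 0 t + 8 * max 0 (t - 1/2) - 4 * max 0 (t - 1)"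

lemma DERIV_cutoff: "(cutoff has_real_derivative dcutoff t) (at t)"
proof -
  have *: "((\<lambda>t. (max 0 (t - c))\<^sup>2) has_real_derivative 2 * max 0 (t - c)) (at t)" for c t :: real
    using DERIV_chain2[OF DERIV_pos_part_square DERIV_diff[OF DERIV_ident DERIV_const[of c]], of t UNIV]
    by simp
  show ?thesis
    unfolding cutoff_def[abs_def] dcutoff_def
    using DERIV_diff[OF DERIV_add[OF DERIV_diff[OF DERIV_const[of 1] DERIV_cmult[OF *[of 0 t], of 2]]
        DERIV_cmult[OF *[of "1/2" t], of 4]] DERIV_cmult[OF *[of 1 t], of 2]]
    by simp
qed

lemma cutoff_le0: "t \<le> 0 \<Longrightarrow> cutoff t = 1"
  by (simp add: cutoff_def)

lemma cutoff_ge1: "t \<ge> 1 \<Longrightarrow> cutoff t = 0"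
  by (simp add: cutoff_def max_def power2_eq_square algebra_simps)

lemma cutoff_antimono: "s \<le> t \<Longrightarrow> cutoff t \<le> cutoff s"
proof (rule DERIV_nonpos_imp_nonincreasing[of s t cutoff])
  show "\<exists>y. (cutoff has_real_derivative y) (at x) \<and> y \<le> 0" for x
    by (intro exI[of _ "dcutoff x"] conjI DERIV_cutoff) (auto simp: dcutoff_def max_def)
qed

lemma cutoff_bounds: "0 \<le> cutoff t" "cutoff t \<le> 1"
  using cutoff_antimono[of t "max t 1"] cutoff_antimono[of "min t 0" t] cutoff_le0[of "min t 0"] cutoff_ge1[of "max t 1"]
  by auto

text \<open>Decreases with \<open>n\<close> to the indicator of the half-space
  \<open>{x. x \<bullet> b \<le> c}\<close>. For \<open>n = 0\<close> it is constantly 1, which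
  starts the telescoping in \<open>upper_halfspace\<close>.\<close>

definition strip :: "'a::euclidean_space \<Rightarrow> real \<Rightarrow> nat \<Rightarrow> 'a \<Rightarrow> real" where
  "strip b c n x = cutoff (real n * (x \<bullet> b - c))"

lemma C1_strip: "C1 (strip b c n)"
proof (rule C1_I[where g="\<lambda>x. (real n * dcutoff (real n * (x \<bullet> b - c))) *\<^sub>R b"])
  fix x
  have "((\<lambda>x. real n * (x \<bullet> b - c)) has_derivative (\<lambda>v. real n * (b \<bullet> v))) (at x)"
    by (auto intro!: derivative_eq_intros simp: inner_commute)
  then have "((\<lambda>x. cutoff (real n * (x \<bullet> b - c))) has_derivative
      (\<lambda>v. (real n * (b \<bullet> v)) * dcutoff (real n * (x \<bullet> b - c)))) (at x)"
    by (rule DERIV_compose_FDERIV[OF DERIV_cutoff])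
  then show "(strip b c n has_derivative (\<lambda>v. ((real n * dcutoff (real n * (x \<bullet> b - c))) *\<^sub>R b) \<bullet> v)) (at x)"
    unfolding strip_def by (simp add: mult_ac)
qed (auto simp: dcutoff_def intro!: continuous_intros)

lemma strip_bounds: "0 \<le> strip b c n x" "strip b c n x \<le> 1"
  by (simp_all add: strip_def cutoff_bounds)

lemma strip_eq_1: "x \<bullet> b \<le> c \<Longrightarrow> strip b c n x = 1"
  unfolding strip_def by (intro cutoff_le0) (auto simp: mult_le_0_iff)

lemma strip_Suc_le: "strip b c (Suc n) x \<le> strip b c n x"
proof (cases "x \<bullet> b \<le> c")
  case True then show ?thesis by (simp add: strip_eq_1)
next
  case False then show ?thesis unfolding strip_def
    by (intro cutoff_antimono mult_right_mono) auto
qed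

lemma strip_tendsto_0:
  assumes "x \<bullet> b > c" shows "(\<lambda>n. strip b c n x) \<longlonglongrightarrow> 0"
proof -
  obtain N where N: "real N * (x \<bullet> b - c) \<ge> 1"
    by (metis assms diff_gt_0_iff_gt less_imp_le reals_Archimedean3)
  have "strip b c n x = 0" if "n \<ge> N" for n
  proof -
    have "real N * (x \<bullet> b - c) \<le> real n * (x \<bullet> b - c)"
      using that assms by (intro mult_right_mono) auto
    then show ?thesis unfolding strip_def using N by (intro cutoff_ge1) linarith
  qed
  then show ?thesis
    by (intro tendsto_eventually) (auto simp: eventually_sequentially)
qed

section \<open>The Riesz representation of positive functionals\<close>

lemma suminf_ennreal_halves:
  assumes "0 \<le> e"
  shows "(\<Sum>n. ennreal (e * (1/2) ^ Suc n)) = ennreal e"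
proof -
  have "(\<lambda>n. e * (1/2) ^ Suc n) sums (e * 1)"
    by (intro sums_mult power_half_series)
  then show ?thesis using assms by (subst suminf_ennreal_eq) auto
qed

text \<open>The laws are demanded on \<open>C1c\<close> alone, since the intended functionals are
  sums of integrals that behave linearly only for integrable integrands.\<close>

locale positive_functional =
  fixes \<Lambda> :: "('a::euclidean_space \<Rightarrow> real) \<Rightarrow> real"
  assumes add: "C1c \<phi> \<Longrightarrow> C1c \<psi> \<Longrightarrow> \<Lambda> (\<lambda>x. \<phi> x + \<psi> x) = \<Lambda> \<phi> + \<Lambda> \<psi>"
    and cmult: "C1c \<phi> \<Longrightarrow> \<Lambda> (\<lambda>x. c * \<phi> x) = c * \<Lambda> \<phi>"
    and nonneg: "C1c \<phi> \<Longrightarrow> (\<And>x. 0 \<le> \<phi> x) \<Longrightarrow> 0 \<le> \<Lambda> \<phi>"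
begin

lemma diff: "C1c \<phi> \<Longrightarrow> C1c \<psi> \<Longrightarrow> \<Lambda> (\<lambda>x. \<phi> x - \<psi> x) = \<Lambda> \<phi> - \<Lambda> \<psi>"
  using add[of \<phi> "\<lambda>x. -1 * \<psi> x"] cmult[of \<psi> "-1"] C1c_cmult[of \<psi> "-1"] by simp

lemma mono: "C1c \<phi> \<Longrightarrow> C1c \<psi> \<Longrightarrow> (\<And>x. \<phi> x \<le> \<psi> x) \<Longrightarrow> \<Lambda> \<phi> \<le> \<Lambda> \<psi>"
  using nonneg[of "\<lambda>x. \<psi> x - \<phi> x"] diff[of \<psi> \<phi>] C1c_diff[of \<psi> \<phi>] by simp

lemma zero: "\<Lambda> (\<lambda>x. 0) = 0"
  using cmult[OF C1c_zero, of 0] by simp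

lemma sum: "finite I \<Longrightarrow> (\<And>i. i \<in> I \<Longrightarrow> C1c (\<phi> i)) \<Longrightarrow> \<Lambda> (\<lambda>x. \<Sum>i\<in>I. \<phi> i x) = (\<Sum>i\<in>I. \<Lambda> (\<phi> i))"
  by (induction I rule: finite_induct) (auto simp: zero add C1c_sum)

text \<open>The class \<open>C1c\<close> is not closed under maxima, so the monotone limits of
  Daniell's construction are replaced by countable sums of nonnegative functions;
  \<open>upper\<close> is the resulting upper integral.\<close>

definition covers :: "('a \<Rightarrow> ennreal) \<Rightarrow> (nat \<Rightarrow> 'a \<Rightarrow> real) set" where
  "covers f = {\<phi>. (\<forall>i. C1c (\<phi> i) \<and> (\<forall>x. 0 \<le> \<phi> i x)) \<and> (\<forall>x. f x \<le> (\<Sum>i. ennreal (\<phi> i x)))}"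

definition upper :: "('a \<Rightarrow> ennreal) \<Rightarrow> ennreal" where
  "upper f = (INF \<phi>\<in>covers f. \<Sum>i. ennreal (\<Lambda> (\<phi> i)))"

lemma upper_le: "\<phi> \<in> covers f \<Longrightarrow> upper f \<le> (\<Sum>i. ennreal (\<Lambda> (\<phi> i)))"
  unfolding upper_def by (rule INF_lower)

lemma upper_mono: "(\<And>x. f x \<le> g x) \<Longrightarrow> upper f \<le> upper g"
  unfolding upper_def by (rule INF_superset_mono) (auto simp: covers_def, meson order_trans)

lemma upper_approx:
  assumes "upper f < top" "0 < e"
  obtains \<phi> where "\<phi> \<in> covers f" "(\<Sum>i. ennreal (\<Lambda> (\<phi> i))) \<le> upper f + ennreal e"
proof -
  have "\<exists>\<phi>\<in>covers f. (\<Sum>i. ennreal (\<Lambda> (\<phi> i))) < upper f + ennreal e"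
    using assms by (intro INF_approx_ennreal) (auto simp: upper_def INF_less_iff less_top)
  then show ?thesis using that by (auto intro: less_imp_le)
qed

lemma upper_zero: "upper (\<lambda>x. 0) = 0"
proof -
  have "upper (\<lambda>x. 0) \<le> (\<Sum>i::nat. ennreal (\<Lambda> (\<lambda>x. 0)))"
    by (intro upper_le) (auto simp: covers_def C1c_zero)
  then show ?thesis by (simp add: zero)
qed

text \<open>Near-optimal covers of the \<open>f n\<close>, with errors
  \<open>e / 2 ^ (n + 1)\<close> adding up to \<open>e\<close>, are merged into a single sequence
  through \<open>prod_decode\<close>.\<close>

lemma upper_suminf: "upper (\<lambda>x. \<Sum>n. f n x) \<le> (\<Sum>n. upper (f n))"
proof (rule ennreal_le_epsilon)
  fix e :: real assume e: "0 < e" and fin: "(\<Sum>n. upper (f n)) < top"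
  have "\<exists>\<phi>. \<phi> \<in> covers (f n) \<and> (\<Sum>i. ennreal (\<Lambda> (\<phi> i))) \<le> upper (f n) + ennreal (e * (1/2) ^ Suc n)" for n
  proof -
    have "upper (f n) < top" using ennreal_suminf_lessD[OF fin] .
    then show ?thesis using upper_approx[of "f n" "e * (1/2) ^ Suc n"] e by auto
  qed
  then obtain \<phi> where \<phi>: "\<And>n. \<phi> n \<in> covers (f n)"
    "\<And>n. (\<Sum>i. ennreal (\<Lambda> (\<phi> n i))) \<le> upper (f n) + ennreal (e * (1/2) ^ Suc n)" by metis
  define \<psi> where "\<psi> = (\<lambda>k. case_prod \<phi> (prod_decode k))"
  have S: "(\<Sum>k. F (\<psi> k)) = (\<Sum>n. \<Sum>i. F (\<phi> n i))" for F :: "('a \<Rightarrow> real) \<Rightarrow> ennreal"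
    using suminf_ennreal_2dimen[of "\<lambda>n. \<Sum>i. F (\<phi> n i)" "\<lambda>p. F (case_prod \<phi> p)"] by (simp add: \<psi>_def)
  have "\<psi> \<in> covers (\<lambda>x. \<Sum>n. f n x)"
  proof -
    have "C1c (\<psi> k) \<and> (\<forall>x. 0 \<le> \<psi> k x)" for k
      using \<phi>(1) by (auto simp: \<psi>_def covers_def split: prod.split)
    moreover have "(\<Sum>n. f n x) \<le> (\<Sum>k. ennreal (\<psi> k x))" for x
      unfolding S[of "\<lambda>g. ennreal (g x)"] using \<phi>(1) by (intro suminf_le) (auto simp: covers_def)
    ultimately show ?thesis by (auto simp: covers_def)
  qed
  then have "upper (\<lambda>x. \<Sum>n. f n x) \<le> (\<Sum>k. ennreal (\<Lambda> (\<psi> k)))" by (rule upper_le)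
  also have "\<dots> = (\<Sum>n. \<Sum>i. ennreal (\<Lambda> (\<phi> n i)))" by (rule S)
  also have "\<dots> \<le> (\<Sum>n. upper (f n) + ennreal (e * (1/2) ^ Suc n))"
    by (intro suminf_le \<phi>) auto
  also have "\<dots> = (\<Sum>n. upper (f n)) + (\<Sum>n. ennreal (e * (1/2) ^ Suc n))"
    by (subst suminf_add[symmetric]) auto
  finally show "upper (\<lambda>x. \<Sum>n. f n x) \<le> (\<Sum>n. upper (f n)) + ennreal e"
    by (simp only: suminf_ennreal_halves[OF less_imp_le[OF e]])
qed

lemma upper_cmult_le:
  assumes "0 < c" shows "upper (\<lambda>x. ennreal c * f x) \<le> ennreal c * upper f"
proof (rule ennreal_le_epsilon)
  fix e :: real assume e: "0 < e" and fin: "ennreal c * upper f < top"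
  have "upper f < top" using fin assms by (auto simp: ennreal_mult_less_top)
  then obtain \<phi> where \<phi>: "\<phi> \<in> covers f" "(\<Sum>i. ennreal (\<Lambda> (\<phi> i))) \<le> upper f + ennreal (e / c)"
    using upper_approx[of f "e / c"] e assms by auto
  have c: "(\<lambda>i x. c * \<phi> i x) \<in> covers (\<lambda>x. ennreal c * f x)"
    using \<phi>(1) assms by (auto simp: covers_def C1c_cmult ennreal_mult intro!: mult_left_mono)
  have "upper (\<lambda>x. ennreal c * f x) \<le> (\<Sum>i. ennreal (\<Lambda> (\<lambda>x. c * \<phi> i x)))"
    by (rule upper_le[OF c])
  also have "\<dots> = ennreal c * (\<Sum>i. ennreal (\<Lambda> (\<phi> i)))"
  proof -
    have "ennreal (\<Lambda> (\<lambda>x. c * \<phi> i x)) = ennreal c * ennreal (\<Lambda> (\<phi> i))" for i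
      using \<phi>(1) assms nonneg[of "\<phi> i"] by (auto simp: covers_def cmult ennreal_mult)
    then show ?thesis by simp
  qed
  also have "\<dots> \<le> ennreal c * (upper f + ennreal (e / c))"
    by (intro mult_left_mono \<phi>) auto
  also have "\<dots> = ennreal c * upper f + ennreal e"
    using assms e by (simp add: distrib_left ennreal_mult[symmetric])
  finally show "upper (\<lambda>x. ennreal c * f x) \<le> ennreal c * upper f + ennreal e" .
qed

text \<open>For positive \<open>c\<close> this is \<open>upper_cmult_le\<close> with the factor
  \<open>1 / c\<close>, scaled back.\<close>

lemma upper_cmult_ge:
  assumes "0 \<le> c" shows "ennreal c * upper f \<le> upper (\<lambda>x. ennreal c * f x)"
proof (cases "c = 0")
  case False
  then have c: "c > 0" using assms by simp
  have *: "ennreal c * (ennreal (1 / c) * y) = y" "ennreal (1 / c) * (ennreal c * y) = y" for y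
    using c by (simp_all add: mult.assoc[symmetric] ennreal_mult[symmetric])
  have "upper f \<le> ennreal (1 / c) * upper (\<lambda>x. ennreal c * f x)"
    using upper_cmult_le[of "1 / c" "\<lambda>x. ennreal c * f x"] c by (simp add: *)
  then have "ennreal c * upper f \<le> ennreal c * (ennreal (1 / c) * upper (\<lambda>x. ennreal c * f x))"
    by (intro mult_left_mono) auto
  then show ?thesis by (simp add: *)
qed simp

text \<open>The lower bound is a Dini argument: up to a small multiple of a fixed bump, finitely many functions
  of a cover already dominate \<open>\<phi>\<close>.\<close>

lemma upper_C1c:
  assumes \<phi>: "C1c \<phi>" "\<And>x. 0 \<le> \<phi> x"
  shows "upper (\<lambda>x. ennreal (\<phi> x)) = ennreal (\<Lambda> \<phi>)"
proof (rule antisym)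
  have [simp]: "C1c (\<lambda>x. if b then \<phi> x else 0)" for b
    using \<phi> C1c_zero by (cases b) auto
  have "upper (\<lambda>x. ennreal (\<phi> x)) \<le> (\<Sum>i::nat. ennreal (\<Lambda> (\<lambda>x. if i = 0 then \<phi> x else 0)))"
  proof (rule upper_le)
    have "(\<Sum>i::nat. ennreal (if i = 0 then \<phi> x else 0)) = ennreal (\<phi> x)" for x
      by (subst suminf_finite[of "{0}"]) auto
    then show "(\<lambda>i x. if i = 0 then \<phi> x else 0) \<in> covers (\<lambda>x. ennreal (\<phi> x))"
      by (simp add: covers_def \<phi>)
  qed
  also have "\<dots> = ennreal (\<Lambda> \<phi>)"
    by (subst suminf_finite[of "{0}"]) (auto simp: zero)
  finally show "upper (\<lambda>x. ennreal (\<phi> x)) \<le> ennreal (\<Lambda> \<phi>)" .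
next
  show "ennreal (\<Lambda> \<phi>) \<le> upper (\<lambda>x. ennreal (\<phi> x))"
    unfolding upper_def
  proof (rule INF_greatest)
    fix \<psi> assume "\<psi> \<in> covers (\<lambda>x. ennreal (\<phi> x))"
    then have \<psi>: "\<And>i. C1c (\<psi> i)" "\<And>i x. 0 \<le> \<psi> i x" "\<And>x. ennreal (\<phi> x) \<le> (\<Sum>i. ennreal (\<psi> i x))"
      by (auto simp: covers_def)
    have \<psi>0: "0 \<le> \<Lambda> (\<psi> i)" for i using nonneg \<psi> by blast
    obtain R where R: "R > 0" "\<forall>x. norm x > R \<longrightarrow> \<phi> x = 0" by (rule C1c_support[OF \<phi>(1)])
    \<comment> \<open>A bump that is positive on the ball carrying \<open>\<phi>\<close>:
      subtracting \<open>e * \<omega>\<close> creates the strict slack that a finite subcover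
      requires.\<close>
    define \<omega> where "\<omega> = bump (0::'a) (R + 1)"
    have \<omega>: "C1c \<omega>" "\<And>x. 0 \<le> \<omega> x" "\<And>x. norm x \<le> R \<Longrightarrow> 0 < \<omega> x"
    proof -
      show "C1c \<omega>" "\<And>x. 0 \<le> \<omega> x" by (simp_all add: \<omega>_def C1c_bump bump_nonneg)
      fix x :: 'a assume "norm x \<le> R"
      then have "((R + 1)\<^sup>2 - R\<^sup>2)\<^sup>2 \<le> \<omega> x" unfolding \<omega>_def using R by (intro bump_ge) auto
      moreover have "(R + 1)\<^sup>2 - R\<^sup>2 > 0" using R by (simp add: power2_eq_square algebra_simps)
      ultimately show "0 < \<omega> x" by (smt (verit) zero_less_power)
    qed
    have key: "ennreal (\<Lambda> \<phi> - e * \<Lambda> \<omega>) \<le> (\<Sum>i. ennreal (\<Lambda> (\<psi> i)))" if e: "e > 0" for e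
    proof -
      \<comment> \<open>These open sets increase with \<open>N\<close>, so a finite subcover of the
        ball reduces to the single index \<open>M\<close>.\<close>
      define U where "U = (\<lambda>N. {x. \<phi> x - e * \<omega> x < (\<Sum>i<N. \<psi> i x)})"
      have "open (U N)" for N
        unfolding U_def
        by (intro open_Collect_less continuous_intros C1_continuous C1c_C1 \<phi> \<psi> \<omega>)
      moreover have "cball 0 R \<subseteq> (\<Union>N. U N)"
      proof
        fix x :: 'a assume "x \<in> cball 0 R"
        then have "\<omega> x > 0" using \<omega>(3) by simp
        then have lt: "\<phi> x - e * \<omega> x < \<phi> x" using e by simp
        show "x \<in> (\<Union>N. U N)"
        proof (cases "\<phi> x - e * \<omega> x < 0")
          case True then show ?thesis by (auto simp: U_def intro!: exI[of _ 0])
        next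
          case False
          then have "ennreal (\<phi> x - e * \<omega> x) < ennreal (\<phi> x)" using lt by (simp add: ennreal_lessI)
          then have "ennreal (\<phi> x - e * \<omega> x) < (SUP N. \<Sum>i<N. ennreal (\<psi> i x))"
            using \<psi>(3)[of x] by (simp add: suminf_eq_SUP)
          then obtain N where "ennreal (\<phi> x - e * \<omega> x) < (\<Sum>i<N. ennreal (\<psi> i x))"
            by (auto simp: less_SUP_iff)
          then have "\<phi> x - e * \<omega> x < (\<Sum>i<N. \<psi> i x)"
            using False by (simp add: sum_ennreal \<psi> sum_nonneg ennreal_less_iff)
          then show ?thesis by (auto simp: U_def)
        qed
      qed
      ultimately obtain I where I: "finite I" "cball 0 R \<subseteq> (\<Union>N\<in>I. U N)"
        using compactE_image[OF compact_cball[of 0 R], of UNIV U] by auto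
      define M where "M = Max (insert 0 I)"
      have le: "\<phi> x - e * \<omega> x \<le> (\<Sum>i<M. \<psi> i x)" for x
      proof (cases "norm x \<le> R")
        case True
        then obtain N where N: "N \<in> I" "x \<in> U N" using I by force
        then have "N \<le> M" using I by (auto simp: M_def intro!: Max_ge)
        then have "(\<Sum>i<N. \<psi> i x) \<le> (\<Sum>i<M. \<psi> i x)" by (intro sum_mono2) (auto simp: \<psi>)
        then show ?thesis using N by (auto simp: U_def)
      next
        case False
        then have "\<phi> x = 0" using R by auto
        then have "\<phi> x - e * \<omega> x \<le> 0" using \<omega>(2)[of x] e by simp
        then show ?thesis using sum_nonneg[of "{..<M}" "\<lambda>i. \<psi> i x"] \<psi>(2) by fastforce
      qed
      have "\<Lambda> \<phi> - e * \<Lambda> \<omega> = \<Lambda> (\<lambda>x. \<phi> x - e * \<omega> x)"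
        by (simp add: diff \<phi> \<omega> C1c_cmult cmult)
      also have "\<dots> \<le> \<Lambda> (\<lambda>x. \<Sum>i<M. \<psi> i x)"
        by (intro mono C1c_diff \<phi> \<omega> C1c_cmult C1c_sum \<psi> le)
      also have "\<dots> = (\<Sum>i<M. \<Lambda> (\<psi> i))" by (simp add: sum \<psi>)
      finally have "ennreal (\<Lambda> \<phi> - e * \<Lambda> \<omega>) \<le> (\<Sum>i<M. ennreal (\<Lambda> (\<psi> i)))"
        by (simp add: sum_ennreal \<psi>0 ennreal_leI)
      also have "\<dots> \<le> (\<Sum>i. ennreal (\<Lambda> (\<psi> i)))" by (intro sum_le_suminf) auto
      finally show ?thesis .
    qed
    show "ennreal (\<Lambda> \<phi>) \<le> (\<Sum>i. ennreal (\<Lambda> (\<psi> i)))"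
    proof (rule ennreal_le_epsilon)
      fix e :: real assume "0 < e"
      have \<omega>0: "0 \<le> \<Lambda> \<omega>" by (intro nonneg \<omega>)
      \<comment> \<open>The \<open>+ 1\<close> in the denominator covers the case
        \<open>\<Lambda> \<omega> = 0\<close>.\<close>
      have d: "e / (\<Lambda> \<omega> + 1) > 0" "e / (\<Lambda> \<omega> + 1) * \<Lambda> \<omega> \<le> e"
        using \<omega>0 \<open>0 < e\<close> by (auto simp: field_simps)
      have "\<Lambda> \<phi> \<le> (\<Lambda> \<phi> - e / (\<Lambda> \<omega> + 1) * \<Lambda> \<omega>) + e" using d by simp
      then have "ennreal (\<Lambda> \<phi>) \<le> ennreal ((\<Lambda> \<phi> - e / (\<Lambda> \<omega> + 1) * \<Lambda> \<omega>) + e)" by (rule ennreal_leI)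
      also have "\<dots> \<le> ennreal (\<Lambda> \<phi> - e / (\<Lambda> \<omega> + 1) * \<Lambda> \<omega>) + ennreal e"
        by (cases "0 \<le> \<Lambda> \<phi> - e / (\<Lambda> \<omega> + 1) * \<Lambda> \<omega>")
           (use \<open>0 < e\<close> in \<open>auto simp: ennreal_neg intro: ennreal_leI simp flip: ennreal_plus\<close>)
      also have "\<dots> \<le> (\<Sum>i. ennreal (\<Lambda> (\<psi> i))) + ennreal e"
        by (intro add_right_mono key d)
      finally show "ennreal (\<Lambda> \<phi>) \<le> (\<Sum>i. ennreal (\<Lambda> (\<psi> i))) + ennreal e" .
    qed
  qed
qed

text \<open>Multiplying each function of a cover by a decreasing sequence of strips splits it into a cover
  of the part of \<open>f\<close> in the half-space and a telescoping cover of the remaining part.\<close>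

lemma upper_halfspace:
  "upper (\<lambda>x. f x * indicator {x. x \<bullet> b \<le> c} x) + upper (\<lambda>x. f x * indicator (- {x. x \<bullet> b \<le> c}) x) \<le> upper f"
  (is "upper ?f1 + upper ?f2 \<le> _")
proof (rule ennreal_le_epsilon)
  fix e' :: real assume e': "0 < e'" and fin: "upper f < top"
  define e where "e = e' / 2"
  have e: "0 < e" using e' by (simp add: e_def)
  obtain \<phi> where \<phi>: "\<phi> \<in> covers f" "(\<Sum>i. ennreal (\<Lambda> (\<phi> i))) \<le> upper f + ennreal e"
    by (rule upper_approx[OF fin e])
  then have C: "\<And>i. C1c (\<phi> i)" and \<phi>0: "\<And>i x. 0 \<le> \<phi> i x" and cov: "\<And>x. f x \<le> (\<Sum>i. ennreal (\<phi> i x))"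
    by (auto simp: covers_def)
  define S where "S = strip b c"
  define a where "a = (\<lambda>i n. \<Lambda> (\<lambda>x. \<phi> i x * S n x))"
  have CS: "C1c (\<lambda>x. \<phi> i x * S n x)" for i n
    unfolding S_def by (intro C1c_mult C C1_strip)
  have S0: "0 \<le> S n x" "S n x \<le> 1" "S (Suc n) x \<le> S n x" for n x
    unfolding S_def by (auto simp: strip_bounds strip_Suc_le)
  have a0: "0 \<le> a i n" for i n
    unfolding a_def by (intro nonneg CS mult_nonneg_nonneg \<phi>0 S0)
  have adec: "decseq (a i)" for i
    unfolding a_def by (intro decseq_SucI mono CS mult_left_mono \<phi>0 S0)
  \<comment> \<open>\<open>l i\<close> stands for the share of \<open>\<Lambda> (\<phi> i)\<close>
    carried by the closed half-space, and \<open>\<Lambda> (\<phi> i) - l i\<close> for the share of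
    its complement.\<close>
  define l where "l = (\<lambda>i. lim (a i))"
  have al: "a i \<longlonglongrightarrow> l i" for i
    using adec a0 decseq_convergent[of "a i" 0] unfolding l_def by (metis convergentI convergent_LIMSEQ_iff)
  have l0: "0 \<le> l i" for i using a0 by (intro LIMSEQ_le_const[OF al]) auto
  have l1: "l i \<le> \<Lambda> (\<phi> i)" for i
  proof -
    have "l i \<le> a i 0" by (rule decseq_ge[OF adec al])
    also have "\<dots> \<le> \<Lambda> (\<phi> i)" unfolding a_def using S0 \<phi>0
      by (intro mono CS C) (simp add: mult_left_le)
    finally show ?thesis .
  qed
  have "\<exists>n. a i n < l i + e * (1/2) ^ Suc i" for i
  proof -
    have "l i < l i + e * (1/2) ^ Suc i" using e by simp
    then have "\<forall>\<^sub>F n in sequentially. a i n < l i + e * (1/2) ^ Suc i"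
      using order_tendstoD(2)[OF al] by blast
    then show ?thesis by (auto simp: eventually_sequentially)
  qed
  then obtain n where n: "\<And>i. a i (n i) < l i + e * (1/2) ^ Suc i" by metis
  have in1: "(\<lambda>i x. \<phi> i x * S (n i) x) \<in> covers ?f1"
  proof -
    have "?f1 x \<le> (\<Sum>i. ennreal (\<phi> i x * S (n i) x))" for x
    proof (cases "x \<bullet> b \<le> c")
      case True
      then have "S k x = 1" for k unfolding S_def by (rule strip_eq_1)
      then show ?thesis using cov[of x] True by (simp add: indicator_def)
    qed (simp add: indicator_def)
    then show ?thesis using CS S0 \<phi>0 by (auto simp: covers_def)
  qed
  have 1: "upper ?f1 \<le> (\<Sum>i. ennreal (l i)) + ennreal e"
  proof -
    have "upper ?f1 \<le> (\<Sum>i. ennreal (a i (n i)))"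
      using upper_le[OF in1] by (simp add: a_def)
    also have "\<dots> \<le> (\<Sum>i. ennreal (l i) + ennreal (e * (1/2) ^ Suc i))"
    proof (intro suminf_le)
      fix i
      have "ennreal (a i (n i)) \<le> ennreal (l i + e * (1/2) ^ Suc i)"
        by (intro ennreal_leI less_imp_le n)
      also have "\<dots> = ennreal (l i) + ennreal (e * (1/2) ^ Suc i)"
        using l0 e by (intro ennreal_plus) auto
      finally show "ennreal (a i (n i)) \<le> ennreal (l i) + ennreal (e * (1/2) ^ Suc i)" .
    qed auto
    also have "\<dots> = (\<Sum>i. ennreal (l i)) + (\<Sum>i. ennreal (e * (1/2) ^ Suc i))"
      by (subst suminf_add[symmetric]) auto
    finally show ?thesis by (simp only: suminf_ennreal_halves[OF less_imp_le[OF e]])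
  qed
  \<comment> \<open>Layers between consecutive strips. Since \<open>S 0 = 1\<close>, they sum to
    \<open>\<phi> i\<close> off the half-space, and their values under \<open>\<Lambda>\<close>
    telescope to at most \<open>\<Lambda> (\<phi> i) - l i\<close>.\<close>
  define \<psi> where "\<psi> = (\<lambda>i k x. \<phi> i x * S k x - \<phi> i x * S (Suc k) x)"
  have \<psi>: "C1c (\<psi> i k)" "0 \<le> \<psi> i k x" for i k x
  proof -
    show "C1c (\<psi> i k)" unfolding \<psi>_def by (rule C1c_diff[OF CS CS])
    show "0 \<le> \<psi> i k x" unfolding \<psi>_def using mult_left_mono[OF S0(3) \<phi>0] by simp
  qed
  have \<Lambda>\<psi>: "(\<Sum>k. ennreal (\<Lambda> (\<psi> i k))) \<le> ennreal (\<Lambda> (\<phi> i) - l i)" for i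
  proof -
    have "\<Lambda> (\<psi> i k) = a i k - a i (Suc k)" for k
      unfolding \<psi>_def a_def by (intro diff CS)
    then have "(\<lambda>k. \<Lambda> (\<psi> i k)) sums (a i 0 - l i)"
      using telescope_sums'[OF al] by simp
    then have "(\<Sum>k. ennreal (\<Lambda> (\<psi> i k))) = ennreal (a i 0 - l i)"
      by (intro suminf_ennreal_eq nonneg \<psi>)
    also have "a i 0 \<le> \<Lambda> (\<phi> i)" unfolding a_def using S0 \<phi>0
      by (intro mono CS C) (simp add: mult_left_le)
    then have "ennreal (a i 0 - l i) \<le> ennreal (\<Lambda> (\<phi> i) - l i)" by (intro ennreal_leI) simp
    finally show ?thesis .
  qed
  have 2: "upper ?f2 \<le> (\<Sum>i. ennreal (\<Lambda> (\<phi> i) - l i))"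
  proof -
    have "?f2 x \<le> (\<Sum>i. \<Sum>k. ennreal (\<psi> i k x))" for x
    proof (cases "x \<bullet> b \<le> c")
      case False
      have "(\<Sum>k. ennreal (\<psi> i k x)) = ennreal (\<phi> i x)" for i
      proof (rule suminf_ennreal_eq)
        have "(\<lambda>k. \<phi> i x * S k x) \<longlonglongrightarrow> \<phi> i x * 0"
          unfolding S_def using False by (intro tendsto_intros strip_tendsto_0) auto
        from telescope_sums'[OF this] show "(\<lambda>k. \<psi> i k x) sums \<phi> i x"
          by (simp add: \<psi>_def S_def strip_def cutoff_le0)
      qed (rule \<psi>)
      then show ?thesis using cov[of x] by (auto simp: indicator_def)
    qed (auto simp: indicator_def)
    then have "upper ?f2 \<le> upper (\<lambda>x. \<Sum>i. \<Sum>k. ennreal (\<psi> i k x))" by (rule upper_mono)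
    also have "\<dots> \<le> (\<Sum>i. upper (\<lambda>x. \<Sum>k. ennreal (\<psi> i k x)))" by (rule upper_suminf)
    also have "\<dots> \<le> (\<Sum>i. ennreal (\<Lambda> (\<phi> i) - l i))"
    proof (intro suminf_le)
      fix i
      have "upper (\<lambda>x. \<Sum>k. ennreal (\<psi> i k x)) \<le> (\<Sum>k. ennreal (\<Lambda> (\<psi> i k)))"
        by (intro upper_le) (auto simp: covers_def \<psi>)
      then show "upper (\<lambda>x. \<Sum>k. ennreal (\<psi> i k x)) \<le> ennreal (\<Lambda> (\<phi> i) - l i)"
        using \<Lambda>\<psi> order_trans by blast
    qed auto
    finally show ?thesis .
  qed
  have "upper ?f1 + upper ?f2 \<le> ((\<Sum>i. ennreal (l i)) + ennreal e) + (\<Sum>i. ennreal (\<Lambda> (\<phi> i) - l i))"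
    by (intro add_mono 1 2)
  also have "\<dots> = ((\<Sum>i. ennreal (l i)) + (\<Sum>i. ennreal (\<Lambda> (\<phi> i) - l i))) + ennreal e"
    by (simp add: ac_simps)
  also have "(\<Sum>i. ennreal (l i)) + (\<Sum>i. ennreal (\<Lambda> (\<phi> i) - l i)) = (\<Sum>i. ennreal (\<Lambda> (\<phi> i)))"
    using l0 l1 by (subst suminf_add) (auto simp flip: ennreal_plus)
  also have "\<dots> + ennreal e \<le> (upper f + ennreal e) + ennreal e"
    by (intro add_right_mono \<phi>)
  also have "\<dots> = upper f + ennreal e'"
  proof -
    have "ennreal e' = ennreal (e + e)" by (simp add: e_def)
    also have "\<dots> = ennreal e + ennreal e" using e by (intro ennreal_plus) auto
    finally show ?thesis by (simp only: add.assoc)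
  qed
  finally show "upper ?f1 + upper ?f2 \<le> upper f + ennreal e'" .
qed

lemma outer_measure_space_upper:
  "outer_measure_space (Pow UNIV) (\<lambda>A. upper (\<lambda>x. f x * indicator A x))"
  unfolding outer_measure_space_def
proof (intro conjI)
  show "positive (Pow UNIV) (\<lambda>A. upper (\<lambda>x. f x * indicator A x))"
    by (simp add: positive_def upper_zero)
  show "increasing (Pow UNIV) (\<lambda>A. upper (\<lambda>x. f x * indicator A x))"
    by (auto simp: increasing_def intro!: upper_mono mult_left_mono indicator_leI)
  show "countably_subadditive (Pow UNIV) (\<lambda>A. upper (\<lambda>x. f x * indicator A x))"
    unfolding countably_subadditive_def
  proof (intro allI impI)
    fix A :: "nat \<Rightarrow> 'a set" assume "disjoint_family A"
    then have "f x * indicator (\<Union>i. A i) x \<le> (\<Sum>i. f x * indicator (A i) x)" for x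
      by (cases "x \<in> (\<Union>i. A i)") (auto simp: suminf_cmult_indicator[where f="\<lambda>_. f x"] simp del: ennreal_suminf_cmult)
    then have "upper (\<lambda>x. f x * indicator (\<Union>i. A i) x) \<le> upper (\<lambda>x. \<Sum>i. f x * indicator (A i) x)"
      by (rule upper_mono)
    also have "\<dots> \<le> (\<Sum>i. upper (\<lambda>x. f x * indicator (A i) x))" by (rule upper_suminf)
    finally show "upper (\<lambda>x. f x * indicator (\<Union>i. A i) x) \<le> (\<Sum>i. upper (\<lambda>x. f x * indicator (A i) x))" .
  qed
qed

text \<open>The weight \<open>f\<close> lets one construction produce both the representing measure
  (\<open>f = 1\<close>) and the measure that turns out to have density \<open>\<phi>\<close> with
  respect to it (\<open>f = \<phi>\<close>).\<close>

definition upper_measure :: "('a \<Rightarrow> ennreal) \<Rightarrow> 'a measure" where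
  "upper_measure f = measure_of UNIV (sets borel) (\<lambda>A. upper (\<lambda>x. f x * indicator A x))"

lemma sets_upper_measure[simp, measurable_cong]: "sets (upper_measure f) = sets borel"
  using sets.sets_measure_of_eq[of borel] by (simp add: upper_measure_def)

text \<open>Caratheodory's theorem applies because the half-spaces, which generate the Borel sets,
  split every set \<open>B\<close> additively: this is \<open>upper_halfspace\<close> for the
  function \<open>f * indicator B\<close>.\<close>

lemma emeasure_upper_measure:
  assumes "A \<in> sets borel"
  shows "emeasure (upper_measure f) A = upper (\<lambda>x. f x * indicator A x)"
proof -
  let ?m = "\<lambda>A. upper (\<lambda>x. f x * indicator A x)"
  interpret P: sigma_algebra UNIV "Pow (UNIV :: 'a set)" by (rule sigma_algebra_Pow)
  let ?L = "lambda_system UNIV (Pow UNIV) ?m"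
  have L: "measure_space UNIV ?L ?m"
    by (rule P.caratheodory_lemma[OF outer_measure_space_upper])
  then interpret L: sigma_algebra UNIV ?L by (simp add: measure_space_def)
  have half: "{x::'a. x \<bullet> i \<le> a} \<in> ?L" for i a
  proof -
    have "?m (B \<inter> {x. x \<bullet> i \<le> a}) + ?m (B - {x. x \<bullet> i \<le> a}) = ?m B" for B
    proof (rule antisym)
      have e: "f x * indicator (B \<inter> {x. x \<bullet> i \<le> a}) x = (f x * indicator B x) * indicator {x. x \<bullet> i \<le> a} x"
        "f x * indicator (B - {x. x \<bullet> i \<le> a}) x = (f x * indicator B x) * indicator (- {x. x \<bullet> i \<le> a}) x" for x
        by (auto simp: indicator_def)
      show "?m (B \<inter> {x. x \<bullet> i \<le> a}) + ?m (B - {x. x \<bullet> i \<le> a}) \<le> ?m B"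
        unfolding e by (rule upper_halfspace)
      have "subadditive (Pow UNIV) ?m"
        using outer_measure_space_upper P.countably_subadditive_subadditive
        by (simp add: outer_measure_space_def)
      then have "?m ((B \<inter> {x. x \<bullet> i \<le> a}) \<union> (B - {x. x \<bullet> i \<le> a}))
          \<le> ?m (B \<inter> {x. x \<bullet> i \<le> a}) + ?m (B - {x. x \<bullet> i \<le> a})"
        by (intro subadditiveD[where f="?m"]) auto
      moreover have "(B \<inter> {x. x \<bullet> i \<le> a}) \<union> (B - {x. x \<bullet> i \<le> a}) = B" by blast
      ultimately show "?m B \<le> ?m (B \<inter> {x. x \<bullet> i \<le> a}) + ?m (B - {x. x \<bullet> i \<le> a})" by simp
    qed
    then show ?thesis unfolding P.lambda_system_eq by simp
  qed
  have sub: "sets borel \<subseteq> ?L"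
  proof -
    have "sigma_sets UNIV ((\<lambda> (a, i). {x::'a. x \<bullet> i \<le> a}) ` (UNIV \<times> Basis)) \<subseteq> ?L"
      by (intro L.sigma_sets_subset) (use half in auto)
    then show ?thesis by (subst borel_eq_halfspace_le) simp
  qed
  show ?thesis unfolding upper_measure_def
  proof (rule emeasure_measure_of_sigma)
    show "sigma_algebra UNIV (sets (borel :: 'a measure))"
      using sets.sigma_algebra_axioms[of borel] by simp
    show "positive (sets borel) ?m" by (simp add: positive_def upper_zero)
    show "countably_additive (sets borel) ?m"
      using L sub unfolding measure_space_def countably_additive_def by (meson order_trans subsetD)
  qed (rule assms)
qed

end

text \<open>The proof slices \<open>K\<close> along a fine partition of the range of \<open>\<phi>\<close>. Applied in both directions,
  the comparison identifies a measure with the density \<open>\<phi> \<cdot> \<mu>\<close>.\<close>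

lemma emeasure_level_set_comparison:
  fixes \<mu> \<nu> \<rho> :: "'b::topological_space measure" and \<phi> :: "'b \<Rightarrow> real"
  assumes sets: "sets \<mu> = sets borel" "sets \<nu> = sets borel" "sets \<rho> = sets borel"
    and \<phi>: "\<phi> \<in> borel_measurable borel" "\<And>x. 0 \<le> \<phi> x"
    and \<nu>: "\<And>A c. A \<in> sets borel \<Longrightarrow> 0 < c \<Longrightarrow> (\<And>x. x \<in> A \<Longrightarrow> \<phi> x \<le> c) \<Longrightarrow> emeasure \<nu> A \<le> ennreal c * emeasure \<mu> A"
    and \<rho>: "\<And>A c. A \<in> sets borel \<Longrightarrow> 0 \<le> c \<Longrightarrow> (\<And>x. x \<in> A \<Longrightarrow> c \<le> \<phi> x) \<Longrightarrow> ennreal c * emeasure \<mu> A \<le> emeasure \<rho> A"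
    and K: "K \<in> sets borel" "emeasure \<mu> K < top"
  shows "emeasure \<nu> K \<le> emeasure \<rho> K"
proof (rule ennreal_le_epsilon)
  fix e :: real assume e: "0 < e"
  \<comment> \<open>The mesh of the slicing, chosen so that the total error
    \<open>d * measure \<mu> K\<close> is at most \<open>e\<close>; the \<open>+ 1\<close> allows
    \<open>K\<close> to be a null set.\<close>
  define d where "d = e / (measure \<mu> K + 1)"
  have d: "d > 0" using e by (simp add: d_def add_nonneg_pos)
  define A where "A = (\<lambda>k::nat. {x\<in>K. real k * d \<le> \<phi> x \<and> \<phi> x < real (Suc k) * d})"
  have Am[measurable]: "A k \<in> sets borel" for k
    unfolding A_def using K(1) \<phi>(1) by measurable
  have UA: "(\<Union>k. A k) = K"
  proof -
    have "x \<in> A (nat \<lfloor>\<phi> x / d\<rfloor>)" if "x \<in> K" for x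
    proof -
      have "0 \<le> \<phi> x / d" using \<phi>(2) d by simp
      then have "real (nat \<lfloor>\<phi> x / d\<rfloor>) \<le> \<phi> x / d" "\<phi> x / d < real (nat \<lfloor>\<phi> x / d\<rfloor>) + 1"
        by linarith+
      then show ?thesis using that d by (simp add: A_def field_simps)
    qed
    then show ?thesis by (auto simp: A_def)
  qed
  have dis: "disjoint_family A"
  proof -
    have "k = j" if "x \<in> A k" "x \<in> A j" for k j x
    proof -
      have "real k * d < real (Suc j) * d" "real j * d < real (Suc k) * d"
        using that unfolding A_def by (auto intro: le_less_trans)
      then show ?thesis using d by simp
    qed
    then show ?thesis by (auto simp: disjoint_family_on_def)
  qed
  have eq: "emeasure N K = (\<Sum>k. emeasure N (A k))" if "sets N = sets borel" for N :: "'b measure"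
    by (subst suminf_emeasure[OF _ dis]) (auto simp: that UA)
  have "emeasure \<nu> K = (\<Sum>k. emeasure \<nu> (A k))" by (rule eq) fact
  also have "\<dots> \<le> (\<Sum>k. emeasure \<rho> (A k) + ennreal d * emeasure \<mu> (A k))"
  proof (rule suminf_le)
    fix k
    have "emeasure \<nu> (A k) \<le> ennreal (real (Suc k) * d) * emeasure \<mu> (A k)"
      using d by (intro \<nu>[OF Am]) (auto simp: A_def intro: less_imp_le)
    also have "\<dots> = ennreal (real k * d) * emeasure \<mu> (A k) + ennreal d * emeasure \<mu> (A k)"
    proof -
      have "ennreal (real (Suc k) * d) = ennreal (real k * d) + ennreal d"
        using d by (simp add: algebra_simps flip: ennreal_plus)
      then show ?thesis by (simp add: distrib_right)
    qed
    also have "\<dots> \<le> emeasure \<rho> (A k) + ennreal d * emeasure \<mu> (A k)"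
      using d by (intro add_right_mono \<rho>[OF Am]) (auto simp: A_def)
    finally show "emeasure \<nu> (A k) \<le> emeasure \<rho> (A k) + ennreal d * emeasure \<mu> (A k)" .
  qed auto
  also have "\<dots> = emeasure \<rho> K + ennreal d * emeasure \<mu> K"
    by (subst suminf_add[symmetric]) (auto simp: eq sets)
  also have "ennreal d * emeasure \<mu> K \<le> ennreal e"
  proof -
    have "emeasure \<mu> K = ennreal (measure \<mu> K)"
      using K by (intro emeasure_eq_ennreal_measure) auto
    moreover have "d * measure \<mu> K \<le> e"
    proof -
      have "d * measure \<mu> K \<le> d * (measure \<mu> K + 1)" using d by (intro mult_left_mono) auto
      also have "\<dots> = e" using measure_nonneg[of \<mu> K] by (simp add: d_def add_nonneg_eq_0_iff)
      finally show ?thesis .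
    qed
    ultimately show ?thesis using d by (simp add: ennreal_leI flip: ennreal_mult)
  qed
  finally show "emeasure \<nu> K \<le> emeasure \<rho> K + ennreal e" by simp
qed

context positive_functional
begin

section \<open>The representing measure and its integrals\<close>

definition representing_measure :: "'a measure" where
  "representing_measure = upper_measure (\<lambda>x. 1)"

lemma sets_representing_measure[simp, measurable_cong]: "sets representing_measure = sets borel"
  by (simp add: representing_measure_def)

lemma emeasure_representing_measure_bounded:
  assumes "A \<in> sets borel" "bounded A"
  shows "emeasure representing_measure A < top"
proof -
  obtain R where R: "R > 0" "\<And>x. x \<in> A \<Longrightarrow> norm x \<le> R" using assms(2) bounded_pos by blast
  \<comment> \<open>Enlarging the radius by 1 makes the bump at least 1 on \<open>A\<close>, because
    (R + 1)^2 - R^2 \<ge> 1.\<close>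
  define \<omega> where "\<omega> = bump (0::'a) (R + 1)"
  have \<omega>: "C1c \<omega>" "\<And>x. 0 \<le> \<omega> x" by (simp_all add: \<omega>_def C1c_bump bump_nonneg)
  have "1 \<le> \<omega> x" if "x \<in> A" for x
  proof -
    have "((R + 1)\<^sup>2 - R\<^sup>2)\<^sup>2 \<le> \<omega> x" unfolding \<omega>_def using R that by (intro bump_ge) auto
    moreover have "(R + 1)\<^sup>2 - R\<^sup>2 \<ge> 1" using R by (simp add: power2_eq_square algebra_simps)
    ultimately show "1 \<le> \<omega> x" by (meson one_le_power order_trans)
  qed
  then have "emeasure representing_measure A \<le> upper (\<lambda>x. ennreal (\<omega> x))"
    unfolding representing_measure_def emeasure_upper_measure[OF assms(1)]
    by (intro upper_mono) (auto simp: indicator_def)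
  also have "\<dots> < top" by (simp add: upper_C1c \<omega>)
  finally show ?thesis .
qed

text \<open>For nonnegative \<open>\<phi>\<close>, the measure \<open>upper_measure \<phi>\<close>
  and the density of \<open>\<phi>\<close> with respect to \<open>representing_measure\<close> obey
  the same bounds on level sets of \<open>\<phi>\<close>. By
  \<open>emeasure_level_set_comparison\<close> they agree on a ball carrying \<open>\<phi>\<close>,
  where their masses are \<open>\<Lambda> \<phi>\<close> and the integral of
  \<open>\<phi>\<close>.\<close>

theorem representing_measure_integral:
  assumes \<phi>: "C1c \<phi>"
  shows "integrable representing_measure \<phi> \<and> integral\<^sup>L representing_measure \<phi> = \<Lambda> \<phi>"
proof -
  have nonneg_case: "integrable representing_measure \<phi> \<and> integral\<^sup>L representing_measure \<phi> = \<Lambda> \<phi>"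
    if \<phi>: "C1c \<phi>" "\<And>x. 0 \<le> \<phi> x" for \<phi>
  proof -
    let ?\<mu> = representing_measure
    let ?\<nu> = "upper_measure (\<lambda>x. ennreal (\<phi> x))"
    have bm[measurable]: "\<phi> \<in> borel_measurable borel"
      using C1_continuous[OF C1c_C1[OF \<phi>(1)]] by (rule borel_measurable_continuous_onI)
    let ?\<rho> = "density ?\<mu> (\<lambda>x. ennreal (\<phi> x))"
    obtain R where R: "R > 0" "\<forall>x. norm x > R \<longrightarrow> \<phi> x = 0" by (rule C1c_support[OF \<phi>(1)])
    let ?K = "cball (0::'a) R"
    have K: "?K \<in> sets borel" "emeasure ?\<mu> ?K < top"
      by (auto intro: emeasure_representing_measure_bounded)
    have \<nu>1: "emeasure ?\<nu> A \<le> ennreal c * emeasure ?\<mu> A"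
      if "A \<in> sets borel" "0 < c" "\<And>x. x \<in> A \<Longrightarrow> \<phi> x \<le> c" for A c
      unfolding representing_measure_def emeasure_upper_measure[OF that(1)]
      using that by (intro order_trans[OF upper_mono upper_cmult_le]) (auto simp: indicator_def ennreal_leI)
    have \<nu>2: "ennreal c * emeasure ?\<mu> A \<le> emeasure ?\<nu> A"
      if "A \<in> sets borel" "0 \<le> c" "\<And>x. x \<in> A \<Longrightarrow> c \<le> \<phi> x" for A c
      unfolding representing_measure_def emeasure_upper_measure[OF that(1)]
      using that by (intro order_trans[OF upper_cmult_ge upper_mono]) (auto simp: indicator_def ennreal_leI)
    have \<rho>1: "emeasure ?\<rho> A \<le> ennreal c * emeasure ?\<mu> A"
      if "A \<in> sets borel" "0 < c" "\<And>x. x \<in> A \<Longrightarrow> \<phi> x \<le> c" for A c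
    proof -
      have "emeasure ?\<rho> A = (\<integral>\<^sup>+x. ennreal (\<phi> x) * indicator A x \<partial>?\<mu>)"
        using that by (subst emeasure_density) auto
      also have "\<dots> \<le> (\<integral>\<^sup>+x. ennreal c * indicator A x \<partial>?\<mu>)"
        using that by (intro nn_integral_mono) (auto simp: indicator_def ennreal_leI)
      finally show ?thesis using that by (simp add: nn_integral_cmult_indicator)
    qed
    have \<rho>2: "ennreal c * emeasure ?\<mu> A \<le> emeasure ?\<rho> A"
      if "A \<in> sets borel" "0 \<le> c" "\<And>x. x \<in> A \<Longrightarrow> c \<le> \<phi> x" for A c
    proof -
      have "ennreal c * emeasure ?\<mu> A = (\<integral>\<^sup>+x. ennreal c * indicator A x \<partial>?\<mu>)"
        using that by (simp add: nn_integral_cmult_indicator)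
      also have "\<dots> \<le> (\<integral>\<^sup>+x. ennreal (\<phi> x) * indicator A x \<partial>?\<mu>)"
        using that by (intro nn_integral_mono) (auto simp: indicator_def ennreal_leI)
      finally show ?thesis using that by (subst emeasure_density) auto
    qed
    have "emeasure ?\<nu> ?K = emeasure ?\<rho> ?K"
    proof (rule antisym)
      show "emeasure ?\<nu> ?K \<le> emeasure ?\<rho> ?K"
        by (rule emeasure_level_set_comparison[where \<mu>="?\<mu>" and \<phi>=\<phi>]) (use \<phi> \<nu>1 \<rho>2 K in auto)
      show "emeasure ?\<rho> ?K \<le> emeasure ?\<nu> ?K"
        by (rule emeasure_level_set_comparison[where \<mu>="?\<mu>" and \<phi>=\<phi>]) (use \<phi> \<rho>1 \<nu>2 K in auto)
    qed
    moreover have e: "ennreal (\<phi> x) * indicator ?K x = ennreal (\<phi> x)" for x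
      using R by (auto simp: indicator_def not_le)
    have "emeasure ?\<nu> ?K = ennreal (\<Lambda> \<phi>)"
      using \<phi> K by (simp add: emeasure_upper_measure e upper_C1c)
    moreover have "emeasure ?\<rho> ?K = (\<integral>\<^sup>+x. ennreal (\<phi> x) \<partial>?\<mu>)"
      using K by (subst emeasure_density) (auto simp: e)
    ultimately have nn: "(\<integral>\<^sup>+x. ennreal (\<phi> x) \<partial>?\<mu>) = ennreal (\<Lambda> \<phi>)" by simp
    have "\<phi> \<in> borel_measurable ?\<mu>" by measurable
    then show ?thesis
      using nn_integral_eq_integrable[of \<phi> ?\<mu> "\<Lambda> \<phi>"] nn \<phi> nonneg[of \<phi>] by auto
  qed
  obtain R where R: "R > 0" "\<forall>x. norm x > R \<longrightarrow> \<phi> x = 0" by (rule C1c_support[OF \<phi>])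
  obtain B where B: "B > 0" "\<And>x. \<bar>\<phi> x\<bar> \<le> B" using C1c_bounded[OF \<phi>] by metis
  \<comment> \<open>The positive part of \<open>\<phi>\<close> need not be \<open>C1\<close>;
    instead \<open>\<phi>\<close> is written as the difference of the nonnegative functions
    \<open>\<phi> + \<omega>\<close> and \<open>\<omega>\<close>.\<close>
  define \<omega> where "\<omega> = (\<lambda>x. B * bump (0::'a) (R + 1) x)"
  have \<omega>: "C1c \<omega>" "\<And>x. 0 \<le> \<omega> x" using B by (auto simp: \<omega>_def C1c_bump bump_nonneg C1c_cmult)
  have "- \<phi> x \<le> \<omega> x" for x
  proof (cases "norm x \<le> R")
    case True
    have "((R + 1)\<^sup>2 - R\<^sup>2)\<^sup>2 \<le> bump 0 (R + 1) x" using R True by (intro bump_ge) auto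
    moreover have "(R + 1)\<^sup>2 - R\<^sup>2 \<ge> 1" using R by (simp add: power2_eq_square algebra_simps)
    ultimately have "1 \<le> bump 0 (R + 1) x" by (meson one_le_power order_trans)
    then have "B * 1 \<le> \<omega> x" unfolding \<omega>_def using B by (intro mult_left_mono) auto
    then show ?thesis using B(2)[of x] by linarith
  next
    case False
    then show ?thesis using R \<omega>(2)[of x] by auto
  qed
  then have 1: "C1c (\<lambda>x. \<phi> x + \<omega> x)" "\<And>x. 0 \<le> \<phi> x + \<omega> x"
    using \<phi> \<omega> by (auto simp: C1c_add) (smt (verit))
  have "integrable representing_measure (\<lambda>x. (\<phi> x + \<omega> x) - \<omega> x)"
    "integral\<^sup>L representing_measure (\<lambda>x. (\<phi> x + \<omega> x) - \<omega> x) = \<Lambda> (\<lambda>x. \<phi> x + \<omega> x) - \<Lambda> \<omega>"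
    using nonneg_case[OF 1] nonneg_case[OF \<omega>]
      Bochner_Integration.integrable_diff[of representing_measure "\<lambda>x. \<phi> x + \<omega> x" \<omega>]
      Bochner_Integration.integral_diff[of representing_measure "\<lambda>x. \<phi> x + \<omega> x" \<omega>] by simp_all
  then show ?thesis using add[OF \<phi> \<omega>(1)] by simp
qed

end

section \<open>Difference quotients and distributional derivatives\<close>

lemma translation_measurable_lebesgue:
  "(+) (c::'a::euclidean_space) \<in> lebesgue \<rightarrow>\<^sub>M lebesgue"
  and distr_lebesgue_translation: "distr lebesgue lebesgue ((+) c) = lebesgue"
proof -
  have T: "(\<lambda>x. c + (\<Sum>j\<in>Basis. (1 * (x \<bullet> j)) *\<^sub>R j)) = (+) c"
    by (auto simp: euclidean_representation)
  show "(+) c \<in> lebesgue \<rightarrow>\<^sub>M lebesgue"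
    using lebesgue_affine_measurable[of "\<lambda>_. 1" c] by (simp add: T[simplified])
  have "lebesgue = density (distr lebesgue lebesgue ((+) c)) (\<lambda>_. 1)"
    using lebesgue_affine_euclidean[of "\<lambda>_. 1" c] by (simp add: T[simplified] prod_constant)
  then show "distr lebesgue lebesgue ((+) c) = lebesgue"
    by (simp add: density_1)
qed

lemma integral_lebesgue_translation:
  fixes f :: "'a::euclidean_space \<Rightarrow> real"
  assumes "f \<in> borel_measurable lebesgue"
  shows "(\<integral>x. f (c + x) \<partial>lebesgue) = (\<integral>x. f x \<partial>lebesgue)"
  using integral_distr[OF translation_measurable_lebesgue assms] by (simp add: distr_lebesgue_translation)

lemma AE_lebesgue_translation:
  assumes "AE x in lebesgue. P x" shows "AE x in lebesgue. P ((c::'a::euclidean_space) + x)"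
proof -
  have "AE x in distr lebesgue lebesgue ((+) c). P x" using assms by (simp only: distr_lebesgue_translation)
  then show ?thesis by (rule AE_distrD[OF translation_measurable_lebesgue])
qed

text \<open>The bound is required at every point of a ball, not almost everywhere; the final proof
  therefore first modifies its map on a null set.\<close>

definition locally_bounded :: "('a::real_normed_vector \<Rightarrow> 'b::real_normed_vector) \<Rightarrow> bool" where
  "locally_bounded f \<longleftrightarrow> (\<forall>R. \<exists>B. \<forall>x. norm x \<le> R \<longrightarrow> norm (f x) \<le> B)"

lemma locally_boundedD:
  assumes "locally_bounded f" obtains B where "B > 0" "\<forall>x. norm x \<le> R \<longrightarrow> norm (f x) \<le> B"
proof -
  obtain B where "\<forall>x. norm x \<le> R \<longrightarrow> norm (f x) \<le> B" using assms unfolding locally_bounded_def by blast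
  then show ?thesis by (intro that[of "max B 1"]) (auto simp: le_max_iff_disj)
qed

lemma locally_bounded_mult:
  fixes f g :: "'a::real_normed_vector \<Rightarrow> real"
  assumes "locally_bounded f" "locally_bounded g" shows "locally_bounded (\<lambda>x. f x * g x)"
  unfolding locally_bounded_def
proof
  fix R
  obtain A where A: "A > 0" "\<forall>x. norm x \<le> R \<longrightarrow> norm (f x) \<le> A" by (rule locally_boundedD[OF assms(1)])
  obtain B where B: "B > 0" "\<forall>x. norm x \<le> R \<longrightarrow> norm (g x) \<le> B" by (rule locally_boundedD[OF assms(2)])
  have "norm (f x * g x) \<le> A * B" if "norm x \<le> R" for x
    using A B that by (auto simp: abs_mult intro!: mult_mono)
  then show "\<exists>B. \<forall>x. norm x \<le> R \<longrightarrow> norm (f x * g x) \<le> B" by blast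
qed

lemma locally_bounded_inner:
  fixes u :: "'a::real_normed_vector \<Rightarrow> 'b::real_inner"
  assumes "locally_bounded u" shows "locally_bounded (\<lambda>x. u x \<bullet> v)"
  unfolding locally_bounded_def
proof
  fix R
  obtain A where A: "A > 0" "\<forall>x. norm x \<le> R \<longrightarrow> norm (u x) \<le> A" by (rule locally_boundedD[OF assms(1)])
  have "norm (u x \<bullet> v) \<le> A * norm v" if "norm x \<le> R" for x
    using A that Cauchy_Schwarz_ineq2[of "u x" v] by (smt (verit) mult_right_mono norm_ge_zero real_norm_def)
  then show "\<exists>B. \<forall>x. norm x \<le> R \<longrightarrow> norm (u x \<bullet> v) \<le> B" by blast
qed

lemma continuous_locally_bounded:
  fixes f :: "'a::euclidean_space \<Rightarrow> 'b::real_normed_vector"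
  assumes "continuous_on UNIV f" shows "locally_bounded f"
  unfolding locally_bounded_def
proof
  fix R
  have "bounded (f ` cball 0 R)"
    using assms by (intro compact_imp_bounded compact_continuous_image) (auto intro: continuous_on_subset)
  then obtain B where "\<forall>y\<in>f ` cball 0 R. norm y \<le> B" unfolding bounded_iff by blast
  then show "\<exists>B. \<forall>x. norm x \<le> R \<longrightarrow> norm (f x) \<le> B" by (intro exI[of _ B]) auto
qed

lemma integrable_locally_bounded:
  fixes f :: "'a::euclidean_space \<Rightarrow> 'b::euclidean_space"
  assumes "f \<in> borel_measurable lebesgue" "locally_bounded f" "\<And>x. norm x > R \<Longrightarrow> f x = 0"
  shows "integrable lebesgue f"
proof -
  obtain B where B: "B > 0" "\<forall>x. norm x \<le> R \<longrightarrow> norm (f x) \<le> B" by (rule locally_boundedD[OF assms(2)])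
  have "integrable lebesgue (\<lambda>x. B * indicator (cball (0::'a) R) x)"
    using emeasure_lborel_cball_finite[of "0::'a" R]
    by (intro integrable_mult_right integrable_real_indicator) auto
  then show ?thesis
    by (rule Bochner_Integration.integrable_bound[OF _ assms(1)])
       (use B assms(3) in \<open>auto simp: indicator_def not_le\<close>)
qed

lemma integrable_locally_bounded_mult:
  fixes f g :: "'a::euclidean_space \<Rightarrow> real"
  assumes "f \<in> borel_measurable lebesgue" "locally_bounded f" "continuous_on UNIV g" "\<And>x. norm x > R \<Longrightarrow> g x = 0"
  shows "integrable lebesgue (\<lambda>x. f x * g x)"
proof (rule integrable_locally_bounded)
  have "g \<in> borel_measurable borel" using assms(3) by (rule borel_measurable_continuous_onI)
  then have "g \<in> borel_measurable lebesgue" by (simp add: measurable_completion)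
  then show "(\<lambda>x. f x * g x) \<in> borel_measurable lebesgue" using assms(1) by simp
qed (use assms in \<open>auto intro: locally_bounded_mult continuous_locally_bounded\<close>)

lemma integrable_mult_C1c:
  assumes "f \<in> borel_measurable lebesgue" "locally_bounded f" "C1c \<phi>"
  shows "integrable lebesgue (\<lambda>x. f x * \<phi> x)"
    and "integrable lebesgue (\<lambda>x. f x * (grad \<phi> x \<bullet> v))"
proof -
  obtain R where R: "R > 0" "\<forall>x. norm x > R \<longrightarrow> \<phi> x = 0" by (rule C1c_support[OF assms(3)])
  show "integrable lebesgue (\<lambda>x. f x * \<phi> x)"
    using R by (intro integrable_locally_bounded_mult[where R=R] assms C1_continuous C1c_C1) auto
  show "integrable lebesgue (\<lambda>x. f x * (grad \<phi> x \<bullet> v))"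
    using R C1c_grad_support[OF assms(3)]
    by (intro integrable_locally_bounded_mult[where R=R] assms continuous_intros C1_continuous_grad C1c_C1) auto
qed

lemma C1c_lipschitz:
  assumes "C1c \<phi>" obtains L where "L > 0" "\<And>x y. \<bar>\<phi> x - \<phi> y\<bar> \<le> L * norm (x - y)"
proof -
  obtain R where R: "R > 0" "\<forall>x. norm x > R \<longrightarrow> \<phi> x = 0" by (rule C1c_support[OF assms])
  have "locally_bounded (grad \<phi>)"
    by (intro continuous_locally_bounded C1_continuous_grad C1c_C1 assms)
  then obtain B where B: "B > 0" "\<forall>x. norm x \<le> R \<longrightarrow> norm (grad \<phi> x) \<le> B" by (rule locally_boundedD)
  have g: "norm (grad \<phi> x) \<le> B" for x
    using B R C1c_grad_support[OF assms R(2), of x] by (cases "norm x \<le> R") auto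
  have "norm (\<phi> x - \<phi> y) \<le> B * norm (x - y)" for x y
  proof (rule differentiable_bound[of UNIV])
    fix z
    show "(\<phi> has_derivative (\<lambda>v. grad \<phi> z \<bullet> v)) (at z within UNIV)"
      using C1_has_derivative[OF C1c_C1[OF assms]] by simp
    show "onorm (\<lambda>v. grad \<phi> z \<bullet> v) \<le> B"
    proof (rule onorm_bound)
      show "norm (grad \<phi> z \<bullet> x) \<le> B * norm x" for x
        using Cauchy_Schwarz_ineq2[of "grad \<phi> z" x] mult_right_mono[OF g[of z] norm_ge_zero[of x]] by simp
    qed (use B in simp)
  qed auto
  then show ?thesis using that B(1) by simp
qed

text \<open>Only \<open>\<phi>\<close> is translated, so measurability and local boundedness of
  \<open>w\<close> suffice. The difference quotients of \<open>\<phi>\<close> are bounded by its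
  Lipschitz constant times \<open>norm v\<close> and live in one common ball, which permits
  dominated convergence.\<close>

lemma DERIV_integral_translate:
  fixes w \<phi> :: "'a::euclidean_space \<Rightarrow> real"
  assumes w: "w \<in> borel_measurable lebesgue" "locally_bounded w" and \<phi>: "C1c \<phi>"
  shows "((\<lambda>t. \<integral>x. w x * \<phi> (x - t *\<^sub>R v) \<partial>lebesgue) has_real_derivative
      - (\<integral>x. w x * (grad \<phi> x \<bullet> v) \<partial>lebesgue)) (at 0)"
  unfolding has_field_derivative_iff tendsto_at_iff_sequentially comp_def
proof (intro allI impI)
  fix \<epsilon> :: "nat \<Rightarrow> real" assume "\<forall>i. \<epsilon> i \<in> UNIV - {0}" and \<epsilon>0: "\<epsilon> \<longlonglongrightarrow> 0"
  then have \<epsilon>: "\<epsilon> n \<noteq> 0" for n by auto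
  obtain E where E: "\<And>n. \<bar>\<epsilon> n\<bar> \<le> E"
    using convergent_imp_Bseq[OF convergentI[OF \<epsilon>0]] unfolding Bseq_def by auto
  obtain R where R: "R > 0" "\<forall>x. norm x > R \<longrightarrow> \<phi> x = 0" by (rule C1c_support[OF \<phi>])
  obtain L where L: "L > 0" "\<And>x y. \<bar>\<phi> x - \<phi> y\<bar> \<le> L * norm (x - y)" by (rule C1c_lipschitz[OF \<phi>]) blast
  \<comment> \<open>The ball of this radius contains the supports of all translates
    \<open>\<phi> (x - \<epsilon> n *\<^sub>R v)\<close>, because
    \<open>\<bar>\<epsilon> n\<bar> \<le> E\<close>.\<close>
  define R' where "R' = R + E * norm v"
  obtain B where B: "B > 0" "\<forall>x. norm x \<le> R' \<longrightarrow> norm (w x) \<le> B" by (rule locally_boundedD[OF w(2)])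
  define q where "q = (\<lambda>n x. (\<phi> (x - \<epsilon> n *\<^sub>R v) - \<phi> x) / \<epsilon> n)"
  have cont: "continuous_on UNIV \<phi>" by (intro C1_continuous C1c_C1 \<phi>)
  have cq: "continuous_on UNIV (\<lambda>x. \<phi> (x - c *\<^sub>R v))" for c
    by (intro continuous_on_compose2[OF cont] continuous_intros) auto
  have supp: "\<phi> (x - \<epsilon> n *\<^sub>R v) = 0" if "norm x > R'" for x n
  proof -
    have "norm (\<epsilon> n *\<^sub>R v) \<le> E * norm v" using E[of n] by (simp add: mult_right_mono)
    then have "norm (x - \<epsilon> n *\<^sub>R v) > R" using that norm_triangle_ineq2[of x "\<epsilon> n *\<^sub>R v"] by (simp add: R'_def)
    then show ?thesis using R by blast
  qed
  have supp0: "\<phi> x = 0" if "norm x > R'" for x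
  proof -
    have "0 \<le> E * norm v" using E[of 0] by (intro mult_nonneg_nonneg) auto
    then have "norm x > R" using that unfolding R'_def by linarith
    then show ?thesis using R(2) by blast
  qed
  have I1: "integrable lebesgue (\<lambda>x. w x * \<phi> (x - \<epsilon> n *\<^sub>R v))" for n
    by (rule integrable_locally_bounded_mult[OF w cq supp])
  have I2: "integrable lebesgue (\<lambda>x. w x * \<phi> x)" by (rule integrable_mult_C1c[OF w \<phi>])
  have q: "(\<integral>x. w x * q n x \<partial>lebesgue)
        = ((\<integral>x. w x * \<phi> (x - \<epsilon> n *\<^sub>R v) \<partial>lebesgue) - (\<integral>x. w x * \<phi> x \<partial>lebesgue)) / \<epsilon> n" for n
  proof -
    have "(\<integral>x. w x * q n x \<partial>lebesgue) = (\<integral>x. (w x * \<phi> (x - \<epsilon> n *\<^sub>R v) - w x * \<phi> x) / \<epsilon> n \<partial>lebesgue)"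
      by (simp only: q_def times_divide_eq_right right_diff_distrib)
    also have "\<dots> = (\<integral>x. w x * \<phi> (x - \<epsilon> n *\<^sub>R v) - w x * \<phi> x \<partial>lebesgue) / \<epsilon> n"
      by (rule integral_divide_zero)
    finally show ?thesis by (simp only: Bochner_Integration.integral_diff[OF I1 I2])
  qed
  have "(\<lambda>n. \<integral>x. w x * q n x \<partial>lebesgue) \<longlonglongrightarrow> (\<integral>x. w x * (- (grad \<phi> x \<bullet> v)) \<partial>lebesgue)"
  proof (rule integral_dominated_convergence[where w="\<lambda>x. (B * (L * norm v)) * indicator (cball 0 R') x"])
    have "continuous_on UNIV (\<lambda>x. - (grad \<phi> x \<bullet> v))"
      by (intro continuous_intros C1_continuous_grad C1c_C1 \<phi>)
    then show "(\<lambda>x. w x * (- (grad \<phi> x \<bullet> v))) \<in> borel_measurable lebesgue"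
      using w(1) borel_measurable_continuous_onI[of "\<lambda>x. - (grad \<phi> x \<bullet> v)"]
      by (intro borel_measurable_times) (auto simp: measurable_completion)
    show "(\<lambda>x. w x * q n x) \<in> borel_measurable lebesgue" for n
    proof -
      have "(\<lambda>x. (w x * \<phi> (x - \<epsilon> n *\<^sub>R v) - w x * \<phi> x) / \<epsilon> n) \<in> borel_measurable lebesgue"
        using I1[of n] I2 by (intro borel_measurable_divide borel_measurable_diff) auto
      then show ?thesis by (simp only: q_def times_divide_eq_right right_diff_distrib)
    qed
    show "integrable lebesgue (\<lambda>x. (B * (L * norm v)) * indicator (cball (0::'a) R') x)"
      using emeasure_lborel_cball_finite[of "0::'a" R']
      by (intro integrable_mult_right integrable_real_indicator) auto
    show "AE x in lebesgue. (\<lambda>n. w x * q n x) \<longlonglongrightarrow> w x * (- (grad \<phi> x \<bullet> v))"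
    proof (intro AE_I2 tendsto_mult tendsto_const)
      fix x
      have "((\<lambda>t. \<phi> (x - t *\<^sub>R v)) has_real_derivative - (grad \<phi> x \<bullet> v)) (at 0)"
      proof -
        have "((\<lambda>t. x - t *\<^sub>R v) has_derivative (\<lambda>t. - (t *\<^sub>R v))) (at 0)"
          by (auto intro!: derivative_eq_intros)
        from has_derivative_compose[OF this, of \<phi> "\<lambda>v. grad \<phi> x \<bullet> v"] C1_has_derivative[OF C1c_C1[OF \<phi>], of x]
        have "((\<lambda>t. \<phi> (x - t *\<^sub>R v)) has_derivative (\<lambda>t. grad \<phi> x \<bullet> (- (t *\<^sub>R v)))) (at 0)" by simp
        moreover have "(\<lambda>t. grad \<phi> x \<bullet> (- (t *\<^sub>R v))) = (*) (- (grad \<phi> x \<bullet> v))" by auto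
        ultimately show ?thesis unfolding has_field_derivative_def by simp
      qed
      then have "((\<lambda>t. (\<phi> (x - t *\<^sub>R v) - \<phi> x) / t) \<longlongrightarrow> - (grad \<phi> x \<bullet> v)) (at 0)"
        unfolding has_field_derivative_iff by simp
      moreover have "filterlim \<epsilon> (at 0) sequentially"
        using \<epsilon>0 \<epsilon> by (simp add: filterlim_at)
      ultimately show "(\<lambda>n. q n x) \<longlonglongrightarrow> - (grad \<phi> x \<bullet> v)"
        unfolding q_def by (rule filterlim_compose)
    qed
    show "AE x in lebesgue. norm (w x * q n x) \<le> B * (L * norm v) * indicator (cball 0 R') x" for n
    proof (intro AE_I2)
      fix x
      show "norm (w x * q n x) \<le> B * (L * norm v) * indicator (cball 0 R') x"
      proof (cases "norm x \<le> R'")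
        case True
        have "\<bar>\<phi> (x - \<epsilon> n *\<^sub>R v) - \<phi> x\<bar> \<le> L * (\<bar>\<epsilon> n\<bar> * norm v)"
          using L(2)[of "x - \<epsilon> n *\<^sub>R v" x] by simp
        then have "\<bar>q n x\<bar> \<le> L * norm v"
          using \<epsilon>[of n] by (simp add: q_def abs_divide divide_le_eq mult_ac)
        then have "\<bar>w x\<bar> * \<bar>q n x\<bar> \<le> B * (L * norm v)"
          using B True by (intro mult_mono) auto
        then show ?thesis using True by (simp add: abs_mult)
      next
        case False
        then show ?thesis using supp[of x n] supp0[of x] by (simp add: q_def)
      qed
    qed
  qed
  moreover have "(\<integral>x. w x * (- (grad \<phi> x \<bullet> v)) \<partial>lebesgue) = - (\<integral>x. w x * (grad \<phi> x \<bullet> v) \<partial>lebesgue)"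
    by simp
  ultimately show "(\<lambda>n. ((\<integral>x. w x * \<phi> (x - \<epsilon> n *\<^sub>R v) \<partial>lebesgue) - (\<integral>x. w x * \<phi> (x - 0 *\<^sub>R v) \<partial>lebesgue)) / (\<epsilon> n - 0))
      \<longlonglongrightarrow> - (\<integral>x. w x * (grad \<phi> x \<bullet> v) \<partial>lebesgue)"
    by (simp add: q)
qed

text \<open>Integrating the one-sided difference quotient against \<open>\<phi>\<close> and moving the translation onto
  \<open>\<phi>\<close> turns a pointwise bound into a bound on the distributional derivative.\<close>

lemma distributional_derivative_le:
  fixes w k :: "'a::euclidean_space \<Rightarrow> real"
  assumes w: "w \<in> borel_measurable lebesgue" "locally_bounded w"
    and k: "k \<in> borel_measurable lebesgue" "locally_bounded k"
    and D: "AE x in lebesgue. x \<in> D"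
    and le: "\<And>x \<epsilon>. x \<in> D \<Longrightarrow> 0 < \<epsilon> \<Longrightarrow> \<epsilon> \<le> 1 \<Longrightarrow> x + \<epsilon> *\<^sub>R v \<in> D \<Longrightarrow> w (x + \<epsilon> *\<^sub>R v) - w x \<le> \<epsilon> * k x"
    and \<phi>: "C1c \<phi>" "\<And>x. 0 \<le> \<phi> x"
  shows "0 \<le> (\<integral>x. w x * (grad \<phi> x \<bullet> v) \<partial>lebesgue) + (\<integral>x. k x * \<phi> x \<partial>lebesgue)"
proof -
  define F where "F = (\<lambda>t. \<integral>x. w x * \<phi> (x - t *\<^sub>R v) \<partial>lebesgue)"
  have cont: "continuous_on UNIV \<phi>" by (intro C1_continuous C1c_C1 \<phi>)
  have cq: "continuous_on UNIV (\<lambda>x. \<phi> (x - c *\<^sub>R v))" for c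
    by (intro continuous_on_compose2[OF cont] continuous_intros) auto
  obtain R where R: "R > 0" "\<forall>x. norm x > R \<longrightarrow> \<phi> x = 0" by (rule C1c_support[OF \<phi>(1)])
  have I1: "integrable lebesgue (\<lambda>x. w x * \<phi> (x - \<epsilon> *\<^sub>R v))" for \<epsilon>
  proof (rule integrable_locally_bounded_mult[OF w cq])
    fix x :: 'a assume "norm x > R + norm (\<epsilon> *\<^sub>R v)"
    then have "norm (x - \<epsilon> *\<^sub>R v) > R" using norm_triangle_ineq2[of x "\<epsilon> *\<^sub>R v"] by simp
    then show "\<phi> (x - \<epsilon> *\<^sub>R v) = 0" using R by blast
  qed
  have I2: "integrable lebesgue (\<lambda>x. w x * \<phi> x)" by (rule integrable_mult_C1c[OF w \<phi>(1)])
  have I3: "integrable lebesgue (\<lambda>x. k x * \<phi> x)" by (rule integrable_mult_C1c[OF k \<phi>(1)])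
  have bound: "(F \<epsilon> - F 0) / \<epsilon> \<le> (\<integral>x. k x * \<phi> x \<partial>lebesgue)" if \<epsilon>: "0 < \<epsilon>" "\<epsilon> \<le> 1" for \<epsilon>
  proof -
    have m: "(\<lambda>x. w x * \<phi> (x - \<epsilon> *\<^sub>R v)) \<in> borel_measurable lebesgue" using I1 by auto
    have tr: "(\<integral>x. w (\<epsilon> *\<^sub>R v + x) * \<phi> x \<partial>lebesgue) = F \<epsilon>"
      using integral_lebesgue_translation[OF m, of "\<epsilon> *\<^sub>R v"] by (simp add: F_def)
    have trI: "integrable lebesgue (\<lambda>x. w (\<epsilon> *\<^sub>R v + x) * \<phi> x)"
    proof -
      have "integrable (distr lebesgue lebesgue ((+) (\<epsilon> *\<^sub>R v))) (\<lambda>x. w x * \<phi> (x - \<epsilon> *\<^sub>R v))"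
        using I1 by (simp add: distr_lebesgue_translation)
      from integrable_distr[OF translation_measurable_lebesgue this] show ?thesis by simp
    qed
    \<comment> \<open>Both \<open>x\<close> and \<open>x + \<epsilon> *\<^sub>R v\<close> have to
      lie in \<open>D\<close>; translation invariance of Lebesgue measure secures this almost
      everywhere.\<close>
    have "AE x in lebesgue. w (\<epsilon> *\<^sub>R v + x) * \<phi> x - w x * \<phi> x \<le> \<epsilon> * (k x * \<phi> x)"
      using D AE_lebesgue_translation[OF D, of "\<epsilon> *\<^sub>R v"]
    proof eventually_elim
      case (elim x)
      then have "w (x + \<epsilon> *\<^sub>R v) - w x \<le> \<epsilon> * k x" using \<epsilon> by (intro le) (auto simp: add.commute)
      from mult_right_mono[OF this \<phi>(2)[of x]] show ?case by (simp add: algebra_simps)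
    qed
    then have "(\<integral>x. w (\<epsilon> *\<^sub>R v + x) * \<phi> x - w x * \<phi> x \<partial>lebesgue) \<le> (\<integral>x. \<epsilon> * (k x * \<phi> x) \<partial>lebesgue)"
      using trI I2 I3 by (intro integral_mono_AE) auto
    then have "F \<epsilon> - F 0 \<le> \<epsilon> * (\<integral>x. k x * \<phi> x \<partial>lebesgue)"
      by (simp only: Bochner_Integration.integral_diff[OF trI I2] tr integral_mult_right_zero)
         (simp add: F_def)
    then show ?thesis using \<epsilon>(1) by (simp only: pos_divide_le_eq mult.commute[of "\<epsilon>"])
  qed
  \<comment> \<open>The derivative at 0 exists, so its value may be computed from the right, where
    \<open>bound\<close> is available.\<close>
  have "((\<lambda>t. (F t - F 0) / t) \<longlongrightarrow> - (\<integral>x. w x * (grad \<phi> x \<bullet> v) \<partial>lebesgue)) (at 0)"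
    using DERIV_integral_translate[OF w \<phi>(1), of v] unfolding has_field_derivative_iff F_def by simp
  then have "((\<lambda>t. (F t - F 0) / t) \<longlongrightarrow> - (\<integral>x. w x * (grad \<phi> x \<bullet> v) \<partial>lebesgue)) (at_right 0)"
    by (rule tendsto_mono[rotated]) (simp add: at_le)
  moreover have "eventually (\<lambda>t. (F t - F 0) / t \<le> (\<integral>x. k x * \<phi> x \<partial>lebesgue)) (at_right (0::real))"
    unfolding eventually_at_right_field by (intro exI[of _ 1]) (use bound in auto)
  ultimately have "- (\<integral>x. w x * (grad \<phi> x \<bullet> v) \<partial>lebesgue) \<le> (\<integral>x. k x * \<phi> x \<partial>lebesgue)"
    by (rule tendsto_upperbound) simp
  then show ?thesis by simp
qed

lemma positive_functional_distributional_derivative: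
  fixes w k :: "'a::euclidean_space \<Rightarrow> real"
  assumes "w \<in> borel_measurable lebesgue" "locally_bounded w"
    and "k \<in> borel_measurable lebesgue" "locally_bounded k"
    and "AE x in lebesgue. x \<in> D"
    and "\<And>x \<epsilon>. x \<in> D \<Longrightarrow> 0 < \<epsilon> \<Longrightarrow> \<epsilon> \<le> 1 \<Longrightarrow> x + \<epsilon> *\<^sub>R v \<in> D \<Longrightarrow> w (x + \<epsilon> *\<^sub>R v) - w x \<le> \<epsilon> * k x"
  shows "positive_functional (\<lambda>\<phi>. (\<integral>x. w x * (grad \<phi> x \<bullet> v) \<partial>lebesgue) + (\<integral>x. k x * \<phi> x \<partial>lebesgue))"
proof
  show "0 \<le> (\<integral>x. w x * (grad \<phi> x \<bullet> v) \<partial>lebesgue) + (\<integral>x. k x * \<phi> x \<partial>lebesgue)"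
    if "C1c \<phi>" "\<And>x. 0 \<le> \<phi> x" for \<phi>
    using assms that by (rule distributional_derivative_le)
next
  fix \<phi> \<psi> :: "'a \<Rightarrow> real" assume c: "C1c \<phi>" "C1c \<psi>"
  show "(\<integral>x. w x * (grad (\<lambda>x. \<phi> x + \<psi> x) x \<bullet> v) \<partial>lebesgue) + (\<integral>x. k x * (\<phi> x + \<psi> x) \<partial>lebesgue)
      = ((\<integral>x. w x * (grad \<phi> x \<bullet> v) \<partial>lebesgue) + (\<integral>x. k x * \<phi> x \<partial>lebesgue))
        + ((\<integral>x. w x * (grad \<psi> x \<bullet> v) \<partial>lebesgue) + (\<integral>x. k x * \<psi> x \<partial>lebesgue))"
    using c integrable_mult_C1c[OF assms(1,2)] integrable_mult_C1c(1)[OF assms(3,4)]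
    by (simp add: grad_add C1c_C1 inner_add_left distrib_left)
next
  fix \<phi> :: "'a \<Rightarrow> real" and c :: real assume "C1c \<phi>"
  then show "(\<integral>x. w x * (grad (\<lambda>x. c * \<phi> x) x \<bullet> v) \<partial>lebesgue) + (\<integral>x. k x * (c * \<phi> x) \<partial>lebesgue)
      = c * ((\<integral>x. w x * (grad \<phi> x \<bullet> v) \<partial>lebesgue) + (\<integral>x. k x * \<phi> x \<partial>lebesgue))"
    by (simp add: grad_cmult C1c_C1 mult.left_commute[of _ c] distrib_left)
qed

section \<open>One-sided Lipschitz maps have bounded deformation\<close>

lemma (in positive_functional) emeasure_compact_finite:
  "compact K \<Longrightarrow> emeasure representing_measure K < \<infinity>"
  by (simp add: emeasure_representing_measure_bounded borel_compact compact_imp_bounded)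

text \<open>The measures representing \<open>A\<close> and \<open>B\<close> serve as the two parts;
  finiteness on compact sets is their finiteness on bounded Borel sets.\<close>

lemma represented_by_signed_radon_diff:
  assumes "positive_functional A" "positive_functional B"
    and "\<And>\<phi>. test_fn \<phi> \<Longrightarrow> \<Delta> \<phi> = A \<phi> - B \<phi>"
  shows "represented_by_signed_radon \<Delta>"
proof -
  interpret A: positive_functional A by fact
  interpret B: positive_functional B by fact
  show ?thesis
    unfolding represented_by_signed_radon_def
    using A.representing_measure_integral B.representing_measure_integral assms(3)
    by (intro exI[of _ A.representing_measure] exI[of _ B.representing_measure])
       (auto simp: A.emeasure_compact_finite B.emeasure_compact_finite test_fn_C1c
             simp flip: infinity_ennreal_def)
qed

lemma positive_functional_combination:
  assumes "positive_functional A" "positive_functional B" "0 \<le> a" "0 \<le> b"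
  shows "positive_functional (\<lambda>\<phi>. a * A \<phi> + b * B \<phi>)"
proof -
  interpret A: positive_functional A by fact
  interpret B: positive_functional B by fact
  show ?thesis
    by unfold_locales
       (auto simp: A.add B.add A.cmult B.cmult A.nonneg B.nonneg algebra_simps assms)
qed

lemma positive_functional_integral:
  assumes "k \<in> borel_measurable lebesgue" "locally_bounded k" "\<And>x. 0 \<le> k x"
  shows "positive_functional (\<lambda>\<phi>. \<integral>x. k x * \<phi> x \<partial>lebesgue)"
  by unfold_locales
     (use integrable_mult_C1c(1)[OF assms(1,2)] assms(3) in
      \<open>auto simp: distrib_left mult.left_commute[of _ c for c]\<close>)

text \<open>One-sided Lipschitz maps have a symmetrized gradient that is bounded above, so the polarization
  \<open>2 (u\<^sub>i \<partial>\<^sub>j + u\<^sub>j \<partial>\<^sub>i) = (u \<bullet> (i + j)) \<partial>\<^sub>i\<^sub>+\<^sub>j - (u \<bullet> (i - j)) \<partial>\<^sub>i\<^sub>-\<^sub>j\<close>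
  exhibits each of its entries as a difference of positive functionals.\<close>

lemma bounded_deformation_one_sided_lipschitz:
  fixes u :: "'a::euclidean_space \<Rightarrow> 'a"
  assumes u: "u \<in> borel_measurable lebesgue" "locally_bounded u"
    and D: "AE x in lebesgue. x \<in> D"
    and os: "\<And>R. \<exists>K. \<forall>x\<in>D. \<forall>y\<in>D. norm x \<le> R \<longrightarrow> norm y \<le> R \<longrightarrow>
              (u y - u x) \<bullet> (y - x) \<le> K * (norm (y - x))\<^sup>2"
  shows "bounded_deformation u"
proof -
  obtain K0 where K0: "\<And>R x y. x \<in> D \<Longrightarrow> y \<in> D \<Longrightarrow> norm x \<le> R \<Longrightarrow> norm y \<le> R \<Longrightarrow>
      (u y - u x) \<bullet> (y - x) \<le> K0 R * (norm (y - x))\<^sup>2"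
    using os by metis
  \<comment> \<open>The one-sided constant belongs to a ball, so a weight varying with the point is
    needed. The \<open>+ 2\<close> leaves room for steps \<open>\<epsilon> *\<^sub>R v\<close> with
    \<open>\<epsilon> \<le> 1\<close> and \<open>norm v \<le> 2\<close>; rounding the norm makes
    \<open>g\<close> measurable although nothing is known about \<open>K0\<close>.\<close>
  define g where "g = (\<lambda>x::'a. \<bar>K0 (real (nat \<lceil>norm x\<rceil>) + 2)\<bar>)"
  have g0: "0 \<le> g x" for x by (simp add: g_def)
  have gm: "g \<in> borel_measurable lebesgue"
  proof -
    have "(\<lambda>x::'a. nat \<lceil>norm x\<rceil>) \<in> borel \<rightarrow>\<^sub>M count_space UNIV" by measurable
    then have "(\<lambda>x::'a. \<bar>K0 (real (nat \<lceil>norm x\<rceil>) + 2)\<bar>) \<in> borel \<rightarrow>\<^sub>M borel"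
      by (rule measurable_compose) simp
    then show ?thesis unfolding g_def by (simp add: measurable_completion)
  qed
  have gb: "locally_bounded g"
    unfolding locally_bounded_def
  proof
    fix R
    \<comment> \<open>\<open>K0\<close> need not be monotone, so the finitely many values that can
      occur are summed.\<close>
    have "norm (g x) \<le> (\<Sum>n\<le>nat \<lceil>R\<rceil>. \<bar>K0 (real n + 2)\<bar>)" if "norm x \<le> R" for x
    proof -
      have "nat \<lceil>norm x\<rceil> \<le> nat \<lceil>R\<rceil>" using that by (intro nat_mono ceiling_mono)
      then have "\<bar>K0 (real (nat \<lceil>norm x\<rceil>) + 2)\<bar> \<le> (\<Sum>n\<le>nat \<lceil>R\<rceil>. \<bar>K0 (real n + 2)\<bar>)"
        by (intro member_le_sum[where f="\<lambda>n. \<bar>K0 (real n + 2)\<bar>"]) auto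
      then show ?thesis by (simp add: g_def)
    qed
    then show "\<exists>B. \<forall>x. norm x \<le> R \<longrightarrow> norm (g x) \<le> B" by blast
  qed
  define G where "G = (\<lambda>\<phi>. \<integral>x. g x * \<phi> x \<partial>lebesgue)"
  have G: "positive_functional G" unfolding G_def by (intro positive_functional_integral gm gb g0)
  \<comment> \<open>The distributional derivative of \<open>u \<bullet> v\<close> along
    \<open>v\<close> with its sign changed, shifted by a multiple of the weight so as to become
    nonnegative.\<close>
  define S where "S = (\<lambda>v \<phi>. (\<integral>x. (u x \<bullet> v) * (grad \<phi> x \<bullet> v) \<partial>lebesgue) + (norm v)\<^sup>2 * G \<phi>)"
  have um: "(\<lambda>x. u x \<bullet> v) \<in> borel_measurable lebesgue" "locally_bounded (\<lambda>x. u x \<bullet> v)" for v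
    using u by (auto intro: locally_bounded_inner)
  have S: "positive_functional (S v)" if v: "norm v \<le> 2" for v
  proof -
    have km: "(\<lambda>x. (norm v)\<^sup>2 * g x) \<in> borel_measurable lebesgue" using gm by simp
    have kb: "locally_bounded (\<lambda>x. (norm v)\<^sup>2 * g x)"
      by (intro locally_bounded_mult gb) (auto simp: locally_bounded_def)
    have "u (x + \<epsilon> *\<^sub>R v) \<bullet> v - u x \<bullet> v \<le> \<epsilon> * ((norm v)\<^sup>2 * g x)"
      if x: "x \<in> D" and e: "0 < \<epsilon>" "\<epsilon> \<le> 1" and y: "x + \<epsilon> *\<^sub>R v \<in> D" for x \<epsilon>
    proof -
      let ?R = "real (nat \<lceil>norm x\<rceil>) + 2"
      have nx: "norm x \<le> real (nat \<lceil>norm x\<rceil>)" by linarith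
      have "norm (\<epsilon> *\<^sub>R v) \<le> 1 * 2" using e v unfolding norm_scaleR by (intro mult_mono) auto
      then have "norm (x + \<epsilon> *\<^sub>R v) \<le> ?R" using nx norm_triangle_ineq[of x "\<epsilon> *\<^sub>R v"] by linarith
      then have "(u (x + \<epsilon> *\<^sub>R v) - u x) \<bullet> (x + \<epsilon> *\<^sub>R v - x) \<le> K0 ?R * (norm (x + \<epsilon> *\<^sub>R v - x))\<^sup>2"
        using nx x y by (intro K0) linarith+
      also have "\<dots> \<le> g x * (norm (x + \<epsilon> *\<^sub>R v - x))\<^sup>2" unfolding g_def by (intro mult_right_mono) auto
      finally have "\<epsilon> * ((u (x + \<epsilon> *\<^sub>R v) - u x) \<bullet> v) \<le> \<epsilon> * (\<epsilon> * ((norm v)\<^sup>2 * g x))"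
        by (simp add: power_mult_distrib power2_eq_square mult_ac)
      then show ?thesis using e by (simp add: inner_diff_left)
    qed
    from positive_functional_distributional_derivative[OF um km kb D this]
    have "positive_functional (\<lambda>\<phi>. (\<integral>x. (u x \<bullet> v) * (grad \<phi> x \<bullet> v) \<partial>lebesgue)
        + (\<integral>x. (norm v)\<^sup>2 * g x * \<phi> x \<partial>lebesgue))" .
    then show ?thesis unfolding S_def G_def by (simp add: mult.assoc)
  qed
  have "represented_by_signed_radon
        (\<lambda>\<phi>. - (1/2) * (\<integral>x. (u x \<bullet> i) * frechet_derivative \<phi> (at x) j
                              + (u x \<bullet> j) * frechet_derivative \<phi> (at x) i \<partial>lebesgue))"
    if ij: "i \<in> Basis" "j \<in> Basis" for i j
  proof (rule represented_by_signed_radon_diff)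
    have n: "norm (i - j) \<le> 2" "norm (i + j) \<le> 2"
      using norm_triangle_ineq4[of i j] norm_triangle_ineq[of i j] ij by auto
    \<comment> \<open>The weights of \<open>G\<close> are exchanged between the two functionals: in
      the difference they cancel the shifts inside \<open>S (i - j)\<close> and
      \<open>S (i + j)\<close>, and all coefficients stay nonnegative.\<close>
    show "positive_functional (\<lambda>\<phi>. (1/4) * S (i - j) \<phi> + ((norm (i + j))\<^sup>2 / 4) * G \<phi>)"
      by (intro positive_functional_combination S G n) auto
    show "positive_functional (\<lambda>\<phi>. (1/4) * S (i + j) \<phi> + ((norm (i - j))\<^sup>2 / 4) * G \<phi>)"
      by (intro positive_functional_combination S G n) auto
    fix \<phi> :: "'a \<Rightarrow> real" assume "test_fn \<phi>"
    then have \<phi>: "C1c \<phi>" by (rule test_fn_C1c)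
    have fd: "frechet_derivative \<phi> (at x) v = grad \<phi> x \<bullet> v" for x v
      using \<phi> by (intro frechet_derivative_grad C1_differentiable C1c_C1)
    have I: "integrable lebesgue (\<lambda>x. (u x \<bullet> v) * (grad \<phi> x \<bullet> w))" for v w
      by (intro integrable_mult_C1c um \<phi>)
    define J where "J = (\<lambda>v w. \<integral>x. (u x \<bullet> v) * (grad \<phi> x \<bullet> w) \<partial>lebesgue)"
    have J: "J (i + j) (i + j) = J i i + J i j + (J j i + J j j)" "J (i - j) (i - j) = J i i - J i j - (J j i - J j j)"
      using I by (simp_all add: J_def inner_add_right inner_diff_right distrib_left distrib_right left_diff_distrib right_diff_distrib)
    have D: "(\<integral>x. (u x \<bullet> i) * frechet_derivative \<phi> (at x) j + (u x \<bullet> j) * frechet_derivative \<phi> (at x) i \<partial>lebesgue)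
        = J i j + J j i"
      using I by (simp add: fd J_def)
    have SJ: "S v \<phi> = J v v + (norm v)\<^sup>2 * G \<phi>" for v by (simp add: S_def J_def)
    show "- (1/2) * (\<integral>x. (u x \<bullet> i) * frechet_derivative \<phi> (at x) j
                              + (u x \<bullet> j) * frechet_derivative \<phi> (at x) i \<partial>lebesgue)
       = ((1/4) * S (i - j) \<phi> + ((norm (i + j))\<^sup>2 / 4) * G \<phi>)
         - ((1/4) * S (i + j) \<phi> + ((norm (i - j))\<^sup>2 / 4) * G \<phi>)"
      unfolding D SJ J by (simp add: field_simps)
  qed
  moreover have "L1_loc u"
    unfolding L1_loc_def
  proof (intro conjI allI impI u(1))
    fix K :: "'a set" assume K: "compact K"
    then obtain R where R: "\<forall>x\<in>K. norm x \<le> R" using compact_imp_bounded bounded_iff by metis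
    have "(\<lambda>x. indicator K x *\<^sub>R u x) \<in> borel_measurable lebesgue"
    proof -
      have "K \<in> sets lebesgue" using K compact_imp_closed borel_closed by fastforce
      then show ?thesis using u(1) by (intro borel_measurable_scaleR borel_measurable_indicator)
    qed
    moreover have "locally_bounded (\<lambda>x. indicator K x *\<^sub>R u x)"
      unfolding locally_bounded_def
    proof
      fix R
      obtain B where "B > 0" "\<forall>x. norm x \<le> R \<longrightarrow> norm (u x) \<le> B" by (rule locally_boundedD[OF u(2)])
      then show "\<exists>B. \<forall>x. norm x \<le> R \<longrightarrow> norm (indicator K x *\<^sub>R u x) \<le> B"
        by (intro exI[of _ B]) (auto simp: indicator_def)
    qed
    moreover have "indicator K x *\<^sub>R u x = 0" if "norm x > R" for x
      using R that by (auto simp: indicator_def not_le)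
    ultimately show "set_integrable lebesgue K u"
      unfolding set_integrable_def by (rule integrable_locally_bounded)
  qed
  ultimately show ?thesis by (simp add: bounded_deformation_def)
qed

section \<open>Density points and approximate continuity\<close>

lemma lmeasurable_outer_approx:
  assumes "E \<in> lmeasurable" "0 < e"
  obtains U where "open U" "E \<subseteq> U" "U \<in> lmeasurable" "measure lebesgue (U - E) < e"
proof -
  obtain U where U: "open U" "E \<subseteq> U" "U - E \<in> lmeasurable" "emeasure lebesgue (U - E) < ennreal e"
    using sets_lebesgue_outer_open[OF fmeasurableD[OF assms(1)] assms(2)] by blast
  have "U = (U - E) \<union> E" using U(2) by blast
  then have "U \<in> lmeasurable" using U(3) assms(1) fmeasurable.Un by metis
  moreover have "measure lebesgue (U - E) < e"
    using U(3,4) assms(2) by (simp add: emeasure_eq_measure2 ennreal_less_iff)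
  ultimately show ?thesis using that U by blast
qed

lemma lmeasurable_ball_Collect:
  fixes f :: "'a::euclidean_space \<Rightarrow> real"
  assumes "f \<in> borel_measurable lebesgue"
  shows "{y\<in>ball x r. c \<le> f y} \<in> lmeasurable" and "{y\<in>ball x r. c < f y} \<in> lmeasurable"
proof -
  have P: "{y\<in>ball x r. P y} \<in> lmeasurable" if "{y\<in>space lebesgue. P y} \<in> sets lebesgue" for P
  proof (rule fmeasurableI2[OF lmeasurable_ball[of x r]])
    have "ball x r \<inter> {y\<in>space lebesgue. P y} \<in> sets lebesgue" using that by (intro sets.Int) auto
    moreover have "ball x r \<inter> {y\<in>space lebesgue. P y} = {y\<in>ball x r. P y}" by auto
    ultimately show "{y\<in>ball x r. P y} \<in> sets lebesgue" by simp
  qed auto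
  show "{y\<in>ball x r. c \<le> f y} \<in> lmeasurable"
    using assms by (intro P borel_measurable_le) auto
  show "{y\<in>ball x r. c < f y} \<in> lmeasurable"
    using assms by (intro P borel_measurable_less) auto
qed

text \<open>Vitali's covering lemma with factor 5. The last clause holds because the selected balls
  are disjoint subsets of \<open>U\<close>; it is the form in which the lemma enters every summation
  below.\<close>

lemma Vitali_disjoint_balls:
  fixes S U :: "'a::euclidean_space set"
  assumes "\<And>x. x \<in> S \<Longrightarrow> 0 < r x \<and> r x \<le> 1 \<and> ball x (r x) \<subseteq> U" "U \<in> lmeasurable"
  obtains C where "countable C" "C \<subseteq> S" "disjoint_family_on (\<lambda>x. ball x (r x)) C"
    "S \<subseteq> (\<Union>x\<in>C. ball x (5 * r x))"
    "\<forall>F. finite F \<longrightarrow> F \<subseteq> C \<longrightarrow> (\<Sum>x\<in>F. measure lebesgue (ball x (r x))) \<le> measure lebesgue U"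
proof -
  have "S \<subseteq> (\<Union>x\<in>S. ball x (r x))" using assms(1) by force
  then obtain C where C: "countable C" "C \<subseteq> S"
     "pairwise (\<lambda>i j. disjnt (ball i (r i)) (ball j (r j))) C" "S \<subseteq> (\<Union>i\<in>C. ball i (5 * r i))"
    by (rule Vitali_covering_lemma_balls[where a="\<lambda>x. x" and B=1]) (use assms(1) in auto)
  have dis: "disjoint_family_on (\<lambda>x. ball x (r x)) C"
    using C(3) by (auto simp: disjoint_family_on_def pairwise_def disjnt_def)
  have "(\<Sum>x\<in>F. measure lebesgue (ball x (r x))) \<le> measure lebesgue U" if F: "finite F" "F \<subseteq> C" for F
  proof -
    have "(\<Sum>x\<in>F. measure lebesgue (ball x (r x))) = measure lebesgue (\<Union>x\<in>F. ball x (r x))"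
      using F(1) fmeasurableD2[OF lmeasurable_ball]
      by (intro measure_finite_Union[symmetric] disjoint_family_on_mono[OF F(2) dis]) auto
    also have "\<dots> \<le> measure lebesgue U"
    proof (rule measure_mono_fmeasurable)
      show "(\<Union>x\<in>F. ball x (r x)) \<subseteq> U"
        using assms(1) F(2) C(2) by (intro UN_least) blast
      show "(\<Union>x\<in>F. ball x (r x)) \<in> sets lebesgue" using F(1) by (intro sets.finite_UN) auto
    qed (rule assms)
    finally show ?thesis .
  qed
  then show ?thesis by (intro that[OF C(1,2) dis C(4)]) blast
qed

lemma measure_ball_scale:
  fixes a b :: "'a::euclidean_space"
  assumes "0 \<le> c" "0 \<le> r"
  shows "measure lebesgue (ball a (c * r)) = c ^ DIM('a) * measure lebesgue (ball b r)"
proof -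
  have m: "measure lebesgue (ball x s) = s ^ DIM('a) * measure lborel (ball (0::'a) 1)" if "0 \<le> s" for x :: 'a and s
    using content_ball_conv_unit_ball[OF that, of x] by (subst measure_completion) auto
  show ?thesis
    using assms by (simp only: m mult_nonneg_nonneg power_mult_distrib mult.assoc)
qed

text \<open>In an open \<open>U\<close> barely larger than \<open>E \<inter> ball 0 R\<close>, each
  bad ball puts more than the fraction \<open>c\<close> of its mass into
  \<open>U - E \<inter> ball 0 R\<close>. Disjoint bad balls thus have small total mass, and their
  fivefold enlargements cover \<open>S\<close>.\<close>

lemma negligible_density_defect:
  fixes E :: "'a::euclidean_space set" and R :: real
  assumes E: "E \<in> sets lebesgue" and c: "0 < c"
  defines "S \<equiv> {x\<in>E \<inter> ball 0 R. \<forall>d>0. \<exists>r. 0 < r \<and> r < d \<and> c * measure lebesgue (ball x r) < measure lebesgue (ball x r - E)}"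
  shows "negligible S"
  unfolding negligible_outer_le
proof (intro allI impI)
  fix e :: real assume e: "0 < e"
  \<comment> \<open>Enlargement by 5 costs \<open>5 ^ DIM('a)\<close>, and a bad ball weighs at most
    \<open>1 / c\<close> times its part outside \<open>E\<close>.\<close>
  define K where "K = (5::real) ^ DIM('a) / c"
  have K: "K > 0" using c by (simp add: K_def)
  have E': "E \<inter> ball 0 R \<in> lmeasurable"
    by (rule fmeasurableI2[OF lmeasurable_ball[of 0 R]]) (use E in auto)
  obtain U where U: "open U" "E \<inter> ball 0 R \<subseteq> U" "U \<in> lmeasurable" "measure lebesgue (U - E \<inter> ball 0 R) < e / K"
    using lmeasurable_outer_approx[OF E', of "e / K"] e K by (metis divide_pos_pos)
  have "\<exists>r. 0 < r \<and> r \<le> 1 \<and> ball x r \<subseteq> U \<and> c * measure lebesgue (ball x r) < measure lebesgue (ball x r - E)"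
    if x: "x \<in> S" for x
  proof -
    have "x \<in> U" using x U unfolding S_def by blast
    then obtain d where d: "d > 0" "ball x d \<subseteq> U" using U(1) openE by blast
    have "\<forall>d>0. \<exists>r. 0 < r \<and> r < d \<and> c * measure lebesgue (ball x r) < measure lebesgue (ball x r - E)"
      using x unfolding S_def by blast
    from this[rule_format, of "min d 1"] obtain r
      where "0 < r" "r < min d 1" "c * measure lebesgue (ball x r) < measure lebesgue (ball x r - E)"
      using d(1) by (metis min_less_iff_conj zero_less_one)
    moreover have "ball x r \<subseteq> U" if "r < min d 1" for r
      using d(2) subset_ball[of r d x] that by (meson less_imp_le min_less_iff_conj order_trans)
    ultimately show ?thesis by (intro exI[of _ r]) auto
  qed
  then obtain r where r: "\<And>x. x \<in> S \<Longrightarrow> 0 < r x \<and> r x \<le> 1 \<and> ball x (r x) \<subseteq> U"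
    "\<And>x. x \<in> S \<Longrightarrow> c * measure lebesgue (ball x (r x)) < measure lebesgue (ball x (r x) - E)"
    by metis
  obtain C where C: "countable C" "C \<subseteq> S" "disjoint_family_on (\<lambda>x. ball x (r x)) C"
    "S \<subseteq> (\<Union>x\<in>C. ball x (5 * r x))"
    by (rule Vitali_disjoint_balls[OF r(1) U(3)]) blast+
  have b: "measure lebesgue (\<Union>x\<in>F. ball x (5 * r x)) \<le> e" if F: "F \<subseteq> C" "finite F" for F
  proof -
    have BE: "ball x (r x) - E \<in> lmeasurable" for x
      using E by (intro fmeasurable.Diff fmeasurable_Diff) auto
    have "measure lebesgue (\<Union>x\<in>F. ball x (5 * r x)) \<le> (\<Sum>x\<in>F. measure lebesgue (ball x (5 * r x)))"
      using F by (intro measure_UNION_le) auto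
    also have "\<dots> \<le> (\<Sum>x\<in>F. K * measure lebesgue (ball x (r x) - E))"
    proof (rule sum_mono)
      fix x assume "x \<in> F"
      then have x: "x \<in> S" using F C by blast
      have "measure lebesgue (ball x (5 * r x)) = K * (c * measure lebesgue (ball x (r x)))"
        using r(1)[OF x] c measure_ball_scale[of 5 "r x" x x] by (simp add: K_def)
      also have "\<dots> \<le> K * measure lebesgue (ball x (r x) - E)"
        using r(2)[OF x] K by (intro mult_left_mono) auto
      finally show "measure lebesgue (ball x (5 * r x)) \<le> K * measure lebesgue (ball x (r x) - E)" .
    qed
    also have "\<dots> = K * (\<Sum>x\<in>F. measure lebesgue (ball x (r x) - E))" by (simp add: sum_distrib_left)
    also have "(\<Sum>x\<in>F. measure lebesgue (ball x (r x) - E)) = measure lebesgue (\<Union>x\<in>F. ball x (r x) - E)"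
    proof (rule measure_finite_Union[symmetric])
      show "disjoint_family_on (\<lambda>x. ball x (r x) - E) F"
        using C(3) F(1) by (auto simp: disjoint_family_on_def)
      show "(\<lambda>x. ball x (r x) - E) ` F \<subseteq> sets lebesgue" using fmeasurableD[OF BE] by blast
    qed (use F fmeasurableD2[OF BE] in auto)
    also have "\<dots> \<le> measure lebesgue (U - E \<inter> ball 0 R)"
    proof (rule measure_mono_fmeasurable)
      show "(\<Union>x\<in>F. ball x (r x) - E) \<subseteq> U - E \<inter> ball 0 R"
      proof (rule UN_least)
        fix x assume "x \<in> F"
        then have "ball x (r x) \<subseteq> U" using F(1) C(2) r(1) by blast
        then show "ball x (r x) - E \<subseteq> U - E \<inter> ball 0 R" by blast
      qed
      show "(\<Union>x\<in>F. ball x (r x) - E) \<in> sets lebesgue" using F BE by (intro sets.finite_UN fmeasurableD)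
      show "U - E \<inter> ball 0 R \<in> lmeasurable" using U E' by (intro fmeasurable.Diff) auto
    qed
    also have "K * measure lebesgue (U - E \<inter> ball 0 R) \<le> e" using U(4) K by (simp add: field_simps)
    finally show ?thesis using K by simp
  qed
  show "\<exists>T. S \<subseteq> T \<and> T \<in> lmeasurable \<and> measure lebesgue T \<le> e"
  proof (intro exI conjI)
    show "S \<subseteq> (\<Union>x\<in>C. ball x (5 * r x))" by (rule C(4))
    show "(\<Union>x\<in>C. ball x (5 * r x)) \<in> lmeasurable"
      by (rule fmeasurable_UN_bound[OF C(1) lmeasurable_ball b])
    show "measure lebesgue (\<Union>x\<in>C. ball x (5 * r x)) \<le> e"
      by (rule measure_UN_bound[OF C(1) lmeasurable_ball b])
  qed
qed

text \<open>The exceptional sets for \<open>c = 1 / (n + 1)\<close> and integer radii form a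
  countable family of null sets.\<close>

theorem Lebesgue_density:
  fixes E :: "'a::euclidean_space set"
  assumes E: "E \<in> sets lebesgue"
  shows "AE x in lebesgue. x \<in> E \<longrightarrow> (\<forall>c>0. \<exists>d>0. \<forall>r. 0 < r \<longrightarrow> r < d \<longrightarrow>
      measure lebesgue (ball x r - E) \<le> c * measure lebesgue (ball x r))"
proof -
  define S where "S = (\<lambda>c R. {x\<in>E \<inter> ball 0 R. \<forall>d>0. \<exists>r. 0 < r \<and> r < d \<and>
      c * measure lebesgue (ball x r) < measure lebesgue (ball x r - E)})"
  have "negligible (S (1 / real (Suc n)) (real m))" for n m
    unfolding S_def by (intro negligible_density_defect E) auto
  then have "negligible (\<Union>m. S (1 / real (Suc n)) (real m))" for n
    by (intro negligible_countable_Union) (auto simp del: of_nat_Suc)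
  then have "negligible (\<Union>n. \<Union>m. S (1 / real (Suc n)) (real m))"
    by (intro negligible_countable_Union) (auto simp del: of_nat_Suc)
  moreover have "\<exists>d>0. \<forall>r. 0 < r \<longrightarrow> r < d \<longrightarrow> measure lebesgue (ball x r - E) \<le> c * measure lebesgue (ball x r)"
    if x: "x \<notin> (\<Union>n. \<Union>m. S (1 / real (Suc n)) (real m))" "x \<in> E" and c: "c > 0" for x c
  proof -
    obtain n where n: "1 / real (Suc n) < c" using nat_approx_posE[OF c] by blast
    obtain m where "norm x < real m" using reals_Archimedean2 by blast
    then have "x \<in> E \<inter> ball 0 (real m)" using x by simp
    moreover have "x \<notin> S (1 / real (Suc n)) (real m)" using x by blast
    ultimately have "\<not> (\<forall>d>0. \<exists>r. 0 < r \<and> r < d \<and>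
        1 / real (Suc n) * measure lebesgue (ball x r) < measure lebesgue (ball x r - E))"
      unfolding S_def by blast
    then obtain d where d: "d > 0" "\<forall>r. 0 < r \<longrightarrow> r < d \<longrightarrow>
        measure lebesgue (ball x r - E) \<le> 1 / real (Suc n) * measure lebesgue (ball x r)"
      by (meson not_less)
    have "measure lebesgue (ball x r - E) \<le> c * measure lebesgue (ball x r)" if "0 < r" "r < d" for r
      using d(2)[rule_format, OF that] mult_right_mono[OF less_imp_le[OF n] measure_nonneg[of lebesgue "ball x r"]] by linarith
    then show ?thesis using d(1) by blast
  qed
  ultimately show ?thesis
    unfolding eventually_ae_filter_negligible
    by (intro exI[of _ "\<Union>n. \<Union>m. S (1 / real (Suc n)) (real m)"] conjI) blast+
qed

text \<open>The density theorem is applied to the preimages of the balls of radius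
  \<open>1 / (n + 1)\<close> around a countable dense set. Values at two points of one preimage
  differ by less than \<open>2 / (n + 1)\<close>, so points with values far from \<open>f x\<close>
  lie outside a preimage that has density 1 at \<open>x\<close>.\<close>

theorem approximately_continuous_AE:
  fixes f :: "'a::euclidean_space \<Rightarrow> 'b::euclidean_space"
  assumes f: "f \<in> borel_measurable lebesgue"
  shows "AE x in lebesgue. \<forall>\<eta>>0. \<forall>c>0. \<exists>d>0. \<forall>r. 0 < r \<longrightarrow> r < d \<longrightarrow>
      measure lebesgue {y\<in>ball x r. \<eta> \<le> norm (f y - f x)} \<le> c * measure lebesgue (ball x r)"
proof -
  obtain Q :: "'b set" where Q: "countable Q" "\<And>X. open X \<Longrightarrow> X \<noteq> {} \<Longrightarrow> \<exists>d\<in>Q. d \<in> X"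
    by (rule countable_dense_setE) blast
  define E where "E = (\<lambda>q n. {y. norm (f y - q) < 1 / real (Suc n)})"
  have E: "E q n \<in> sets lebesgue" for q n
  proof -
    have "(\<lambda>y. norm (f y - q)) \<in> borel_measurable lebesgue" using f by measurable
    then have "{y\<in>space lebesgue. norm (f y - q) < 1 / real (Suc n)} \<in> sets lebesgue"
      by (intro borel_measurable_less) auto
    then show ?thesis by (simp add: E_def)
  qed
  have "AE x in lebesgue. \<forall>q\<in>Q. \<forall>n. x \<in> E q n \<longrightarrow> (\<forall>c>0. \<exists>d>0. \<forall>r. 0 < r \<longrightarrow> r < d \<longrightarrow>
      measure lebesgue (ball x r - E q n) \<le> c * measure lebesgue (ball x r))"
    using Q(1) Lebesgue_density[OF E] by (simp only: AE_ball_countable AE_all_countable) blast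
  then show ?thesis
  proof eventually_elim
    case (elim x)
    show ?case
    proof (intro allI impI)
      fix \<eta> c :: real assume \<eta>: "0 < \<eta>" and c: "0 < c"
      obtain n where n: "1 / real (Suc n) < \<eta> / 2" using nat_approx_posE[of "\<eta> / 2"] \<eta> by auto
      obtain q where q: "q \<in> Q" "q \<in> ball (f x) (1 / real (Suc n))"
        using Q(2)[of "ball (f x) (1 / real (Suc n))"] by auto
      then have "x \<in> E q n" by (simp add: E_def dist_norm)
      then obtain d where d: "d > 0" "\<And>r. 0 < r \<Longrightarrow> r < d \<Longrightarrow>
          measure lebesgue (ball x r - E q n) \<le> c * measure lebesgue (ball x r)"
        using elim q c by blast
      have "measure lebesgue {y\<in>ball x r. \<eta> \<le> norm (f y - f x)} \<le> c * measure lebesgue (ball x r)"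
        if r: "0 < r" "r < d" for r
      proof -
        have "measure lebesgue {y\<in>ball x r. \<eta> \<le> norm (f y - f x)} \<le> measure lebesgue (ball x r - E q n)"
        proof (rule measure_mono_fmeasurable)
          show "{y\<in>ball x r. \<eta> \<le> norm (f y - f x)} \<subseteq> ball x r - E q n"
          proof clarsimp
            fix y assume "\<eta> \<le> norm (f y - f x)" "y \<in> E q n"
            then show False using q n norm_triangle_ineq4[of "f y - q" "f x - q"]
              by (simp add: E_def dist_norm norm_minus_commute)
          qed
          show "{y\<in>ball x r. \<eta> \<le> norm (f y - f x)} \<in> sets lebesgue"
          proof -
            have "(\<lambda>y. norm (f y - f x)) \<in> borel_measurable lebesgue" using f by measurable
            then show ?thesis by (intro fmeasurableD lmeasurable_ball_Collect)
          qed
          show "ball x r - E q n \<in> lmeasurable" using E by (intro fmeasurable_Diff) auto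
        qed
        then show ?thesis using d(2)[OF r] by linarith
      qed
      then show "\<exists>d>0. \<forall>r. 0 < r \<longrightarrow> r < d \<longrightarrow>
          measure lebesgue {y\<in>ball x r. \<eta> \<le> norm (f y - f x)} \<le> c * measure lebesgue (ball x r)"
        using d(1) by blast
    qed
  qed
qed

text \<open>Off the exceptional set the integrand is below \<open>e / 2\<close>; on it the crude
  bound \<open>2 * M\<close> is compensated by its small measure.\<close>

lemma Lebesgue_point_bounded:
  fixes f :: "'a::euclidean_space \<Rightarrow> 'b::euclidean_space"
  assumes f: "f \<in> borel_measurable lebesgue" "\<And>x. norm (f x) \<le> M"
    and x: "\<forall>\<eta>>0. \<forall>c>0. \<exists>d>0. \<forall>r. 0 < r \<longrightarrow> r < d \<longrightarrow>
      measure lebesgue {y\<in>ball x r. \<eta> \<le> norm (f y - f x)} \<le> c * measure lebesgue (ball x r)"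
    and e: "0 < e"
  shows "\<exists>d>0. \<forall>r. 0 < r \<longrightarrow> r < d \<longrightarrow>
      (\<integral>y. indicator (ball x r) y * norm (f y - f x) \<partial>lebesgue) \<le> e * measure lebesgue (ball x r)"
proof -
  have M: "0 \<le> M" using f(2)[of x] norm_ge_zero[of "f x"] by linarith
  \<comment> \<open>Chosen so that \<open>2 * M * c \<le> e / 2\<close>; the \<open>+ 2\<close>
    keeps the denominator positive when \<open>M = 0\<close>.\<close>
  define c where "c = e / (4 * M + 2)"
  have c: "c > 0" using e M by (simp add: c_def)
  have "2 * M * c \<le> (4 * M + 2) * c / 2" using c by (simp add: algebra_simps)
  also have "\<dots> = e / 2" using M by (simp add: c_def)
  finally have c2: "2 * M * c \<le> e / 2" .
  have "e / 2 > 0" using e by simp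
  with x c obtain d where d: "d > 0" "\<forall>r. 0 < r \<longrightarrow> r < d \<longrightarrow>
      measure lebesgue {y\<in>ball x r. e / 2 \<le> norm (f y - f x)} \<le> c * measure lebesgue (ball x r)"
    by blast
  have "(\<integral>y. indicator (ball x r) y * norm (f y - f x) \<partial>lebesgue) \<le> e * measure lebesgue (ball x r)"
    if r: "0 < r" "r < d" for r
  proof -
    define A where "A = {y\<in>ball x r. e / 2 \<le> norm (f y - f x)}"
    have nm: "(\<lambda>y. norm (f y - f x)) \<in> borel_measurable lebesgue" using f(1) by measurable
    have A: "A \<in> lmeasurable" unfolding A_def using nm by (rule lmeasurable_ball_Collect)
    have int: "integrable lebesgue (indicator B :: 'a \<Rightarrow> real)" if "B \<in> lmeasurable" for B
      using that by (intro integrable_real_indicator) (auto simp: fmeasurable_def)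
    have le: "indicator (ball x r) y * norm (f y - f x) \<le> e / 2 * indicator (ball x r) y + 2 * M * indicator A y" for y
      using norm_triangle_ineq4[of "f y" "f x"] f(2)[of y] f(2)[of x] e M by (auto simp: indicator_def A_def)
    have I: "integrable lebesgue (\<lambda>y. e / 2 * indicator (ball x r) y + 2 * M * indicator A y)"
      by (intro Bochner_Integration.integrable_add integrable_mult_right int A lmeasurable_ball)
    have "integrable lebesgue (\<lambda>y. indicator (ball x r) y * norm (f y - f x))"
    proof (rule Bochner_Integration.integrable_bound[OF I])
      show "(\<lambda>y. indicator (ball x r) y * norm (f y - f x)) \<in> borel_measurable lebesgue"
        using nm by (intro borel_measurable_times borel_measurable_indicator) auto
      show "AE y in lebesgue. norm (indicator (ball x r) y * norm (f y - f x))
          \<le> norm (e / 2 * indicator (ball x r) y + 2 * M * indicator A y)"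
      proof (rule AE_I2)
        fix y
        have "0 \<le> indicator (ball x r) y * norm (f y - f x)" by simp
        then show "norm (indicator (ball x r) y * norm (f y - f x)) \<le> norm (e / 2 * indicator (ball x r) y + 2 * M * indicator A y)"
          using le[of y] by (simp only: real_norm_def)
      qed
    qed
    then have "(\<integral>y. indicator (ball x r) y * norm (f y - f x) \<partial>lebesgue)
        \<le> (\<integral>y. e / 2 * indicator (ball x r) y + 2 * M * indicator A y \<partial>lebesgue)"
      by (rule integral_mono[OF _ I le])
    also have "\<dots> = e / 2 * measure lebesgue (ball x r) + 2 * M * measure lebesgue A"
      using int[OF A] int[OF lmeasurable_ball[of x r]] A by (simp add: fmeasurableD)
    also have "\<dots> \<le> e / 2 * measure lebesgue (ball x r) + 2 * M * (c * measure lebesgue (ball x r))"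
      unfolding A_def using d(2) r M by (intro add_left_mono mult_left_mono) auto
    also have "\<dots> \<le> e * measure lebesgue (ball x r)"
      using mult_right_mono[OF c2 measure_nonneg[of lebesgue "ball x r"]] by (simp add: algebra_simps)
    finally show ?thesis .
  qed
  then show ?thesis using d(1) by blast
qed

section \<open>Absolutely continuous functionals\<close>

lemma locally_bounded_const: "locally_bounded (\<lambda>x. c)"
  by (auto simp: locally_bounded_def)

lemma integrable_C1c:
  assumes "C1c \<phi>" shows "integrable lebesgue \<phi>"
  using integrable_mult_C1c(1)[of "\<lambda>_. 1", OF _ locally_bounded_const assms] by simp

lemma integrable_indicator_lmeasurable:
  "A \<in> lmeasurable \<Longrightarrow> integrable lebesgue (indicator A :: 'a::euclidean_space \<Rightarrow> real)"
  by (intro integrable_real_indicator) (auto simp: fmeasurable_def)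

lemma integral_bump_le:
  assumes "0 \<le> r"
  shows "(\<integral>x. bump (a::'a::euclidean_space) r x \<partial>lebesgue) \<le> r ^ 4 * measure lebesgue (ball a r)"
proof -
  have "(\<integral>x. bump a r x \<partial>lebesgue) \<le> (\<integral>x. r ^ 4 * indicator (ball a r) x \<partial>lebesgue)"
  proof (rule integral_mono)
    show "integrable lebesgue (bump a r)" by (intro integrable_C1c C1c_bump)
    show "integrable lebesgue (\<lambda>x. r ^ 4 * indicator (ball a r) x)"
      by (intro integrable_mult_right integrable_indicator_lmeasurable lmeasurable_ball)
    fix x show "bump a r x \<le> r ^ 4 * indicator (ball a r) x"
      using bump_le[of a r x] bump_outside[OF assms, of x a]
      by (cases "x \<in> ball a r") (auto simp: dist_norm norm_minus_commute)
  qed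
  also have "\<dots> = r ^ 4 * measure lebesgue (ball a r)" by simp
  finally show ?thesis .
qed

context positive_functional
begin

lemma fmeasurable_representing_measure:
  "A \<in> sets borel \<Longrightarrow> bounded A \<Longrightarrow> A \<in> fmeasurable representing_measure"
  by (intro fmeasurableI) (auto simp: emeasure_representing_measure_bounded)

text \<open>The test function is a bump of twice the radius: it is at least (100 - 25)^2 r^4 = 5625
  r^4 on the ball and at most 10000 r^4 anywhere, and 10000 / 5625 \<le> 2. The radius
  \<open>5 * r\<close> anticipates Vitali's enlargement.\<close>

lemma representing_measure_ball_le:
  assumes dom: "\<And>\<phi>. C1c \<phi> \<Longrightarrow> (\<And>x. 0 \<le> \<phi> x) \<Longrightarrow> \<Lambda> \<phi> \<le> K * (\<integral>x. \<phi> x \<partial>lebesgue)"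
    and K: "0 \<le> K" and r: "0 < r"
  shows "measure representing_measure (ball (a::'a) (5 * r)) \<le> 2 * K * 10 ^ DIM('a) * measure lebesgue (ball a r)"
proof -
  let ?\<mu> = representing_measure
  define \<phi> where "\<phi> = bump a (10 * r)"
  have \<phi>: "C1c \<phi>" "\<And>x. 0 \<le> \<phi> x" by (simp_all add: \<phi>_def C1c_bump bump_nonneg)
  have B: "ball a (5 * r) \<in> fmeasurable ?\<mu>" by (intro fmeasurable_representing_measure) auto
  have "5625 * r ^ 4 * measure ?\<mu> (ball a (5 * r)) = (\<integral>x. 5625 * r ^ 4 * indicator (ball a (5 * r)) x \<partial>?\<mu>)"
    using B by (simp add: fmeasurableD)
  also have "\<dots> \<le> integral\<^sup>L ?\<mu> \<phi>"
  proof (rule integral_mono)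
    show "integrable ?\<mu> (\<lambda>x. 5625 * r ^ 4 * indicator (ball a (5 * r)) x)"
      using B by (intro integrable_mult_right integrable_real_indicator) (auto simp: fmeasurable_def)
    show "integrable ?\<mu> \<phi>" using representing_measure_integral[OF \<phi>(1)] by simp
    fix x
    have "((10 * r)\<^sup>2 - (5 * r)\<^sup>2)\<^sup>2 = 5625 * r ^ 4" by (simp add: power2_eq_square power4_eq_xxxx)
    then show "5625 * r ^ 4 * indicator (ball a (5 * r)) x \<le> \<phi> x"
      using \<phi>(2)[of x] bump_ge[of x a "5 * r" "10 * r"] r
      by (cases "x \<in> ball a (5 * r)") (auto simp: \<phi>_def dist_norm norm_minus_commute)
  qed
  also have "\<dots> = \<Lambda> \<phi>" using representing_measure_integral[OF \<phi>(1)] by simp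
  also have "\<dots> \<le> K * (\<integral>x. \<phi> x \<partial>lebesgue)" by (rule dom[OF \<phi>])
  also have "\<dots> \<le> K * ((10 * r) ^ 4 * measure lebesgue (ball a (10 * r)))"
    unfolding \<phi>_def using r K by (intro mult_left_mono integral_bump_le) auto
  also have "measure lebesgue (ball a (10 * r)) = 10 ^ DIM('a) * measure lebesgue (ball a r)"
    using r by (intro measure_ball_scale) auto
  finally have "r ^ 4 * (5625 * measure ?\<mu> (ball a (5 * r))) \<le> r ^ 4 * (10000 * (K * 10 ^ DIM('a) * measure lebesgue (ball a r)))"
    by (simp add: power_mult_distrib mult_ac)
  then have "5625 * measure ?\<mu> (ball a (5 * r)) \<le> 10000 * (K * 10 ^ DIM('a) * measure lebesgue (ball a r))"
    using r by (simp only: mult_le_cancel_left_pos zero_less_power)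
  moreover have "0 \<le> K * 10 ^ DIM('a) * measure lebesgue (ball a r)" using K by simp
  ultimately show ?thesis by linarith
qed

text \<open>The domination passes from test functions to sets through Vitali's lemma: disjoint balls
  inside an open set slightly larger than \<open>A\<close> have total volume at most that of the
  open set, and their enlargements, estimated by \<open>representing_measure_ball_le\<close>, cover
  \<open>A\<close>.\<close>

lemma representing_measure_le:
  assumes dom: "\<And>\<phi>. C1c \<phi> \<Longrightarrow> (\<And>x. 0 \<le> \<phi> x) \<Longrightarrow> \<Lambda> \<phi> \<le> K * (\<integral>x. \<phi> x \<partial>lebesgue)"
    and K: "0 \<le> K" and A: "A \<in> sets borel" "bounded A"
  shows "measure representing_measure A \<le> 2 * K * 10 ^ DIM('a) * measure lebesgue A"
proof -
  let ?\<mu> = representing_measure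
  define C where "C = 2 * K * (10::real) ^ DIM('a)"
  have C: "C \<ge> 0" using K by (simp add: C_def)
  have "measure ?\<mu> A \<le> C * measure lebesgue A"
  proof (rule field_le_epsilon)
    fix e :: real assume e: "0 < e"
    define e' where "e' = e / (C + 1)"
    have e'0: "e' > 0" using e C by (simp add: e'_def)
    have "C * e' \<le> (C + 1) * e'" using e'0 by (intro mult_right_mono) auto
    also have "\<dots> = e" using C by (simp add: e'_def)
    finally have e': "e' > 0" "C * e' \<le> e" using e'0 by auto
    have AL: "A \<in> lmeasurable"
      using A by (intro bounded_set_imp_lmeasurable) auto
    obtain U where U: "open U" "A \<subseteq> U" "U \<in> lmeasurable" "measure lebesgue (U - A) < e'"
      by (rule lmeasurable_outer_approx[OF AL e'(1)])
    have "\<exists>r. 0 < r \<and> r \<le> 1 \<and> ball x r \<subseteq> U" if "x \<in> A" for x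
    proof -
      have "x \<in> U" using U(2) that by blast
      then obtain d where d: "d > 0" "ball x d \<subseteq> U" using U(1) openE by blast
      have "ball x (min d 1) \<subseteq> ball x d" by (rule subset_ball) simp
      then show ?thesis using d by (intro exI[of _ "min d 1"] conjI) (simp, simp, rule order_trans)
    qed
    then obtain r where r: "\<And>x. x \<in> A \<Longrightarrow> 0 < r x \<and> r x \<le> 1 \<and> ball x (r x) \<subseteq> U" by metis
    obtain S where S: "countable S" "S \<subseteq> A" "disjoint_family_on (\<lambda>x. ball x (r x)) S" "A \<subseteq> (\<Union>x\<in>S. ball x (5 * r x))"
      "\<forall>F. finite F \<longrightarrow> F \<subseteq> S \<longrightarrow> (\<Sum>x\<in>F. measure lebesgue (ball x (r x))) \<le> measure lebesgue U"
      by (rule Vitali_disjoint_balls[OF r U(3)])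
    have f: "ball x (5 * r x) \<in> fmeasurable ?\<mu>" for x by (intro fmeasurable_representing_measure) auto
    have b: "measure ?\<mu> (\<Union>x\<in>F. ball x (5 * r x)) \<le> C * measure lebesgue U" if F: "F \<subseteq> S" "finite F" for F
    proof -
      have "measure ?\<mu> (\<Union>x\<in>F. ball x (5 * r x)) \<le> (\<Sum>x\<in>F. measure ?\<mu> (ball x (5 * r x)))"
        using F by (intro measure_UNION_le) auto
      also have "\<dots> \<le> (\<Sum>x\<in>F. C * measure lebesgue (ball x (r x)))"
      proof (rule sum_mono)
        fix x assume "x \<in> F"
        then have "r x > 0" using r F S(2) by blast
        then show "measure ?\<mu> (ball x (5 * r x)) \<le> C * measure lebesgue (ball x (r x))"
          unfolding C_def using K by (intro representing_measure_ball_le dom) auto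
      qed
      also have "\<dots> = C * (\<Sum>x\<in>F. measure lebesgue (ball x (r x)))" by (simp add: sum_distrib_left)
      also have "\<dots> \<le> C * measure lebesgue U" using F C S(5) by (intro mult_left_mono) auto
      finally show ?thesis .
    qed
    have "measure ?\<mu> A \<le> measure ?\<mu> (\<Union>x\<in>S. ball x (5 * r x))"
      by (rule measure_mono_fmeasurable[OF S(4) _ fmeasurable_UN_bound[OF S(1) f b]]) (use A in auto)
    also have "\<dots> \<le> C * measure lebesgue U" by (rule measure_UN_bound[OF S(1) f b])
    also have "measure lebesgue U = measure lebesgue (U - A) + measure lebesgue A"
      using measurable_measure_Diff[OF U(3) fmeasurableD[OF AL] U(2)] by simp
    also have "C * (measure lebesgue (U - A) + measure lebesgue A) \<le> C * (e' + measure lebesgue A)"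
      using C U(4) by (intro mult_left_mono) auto
    also have "\<dots> \<le> C * measure lebesgue A + e" using e'(2) by (simp add: algebra_simps)
    finally show "measure ?\<mu> A \<le> C * measure lebesgue A + e" .
  qed
  then show ?thesis by (simp add: C_def)
qed

text \<open>Comparison with Lebesgue measure gives absolute continuity and hence a Radon-Nikodym
  density; the same comparison on the set where the density exceeds \<open>C\<close> bounds it
  almost everywhere.\<close>

theorem bounded_density:
  assumes dom: "\<And>\<phi>. C1c \<phi> \<Longrightarrow> (\<And>x. 0 \<le> \<phi> x) \<Longrightarrow> \<Lambda> \<phi> \<le> K * (\<integral>x. \<phi> x \<partial>lebesgue)"
    and K: "0 \<le> K"
  obtains g M where "g \<in> borel_measurable borel" "\<forall>x. \<bar>g x\<bar> \<le> M"
    "\<forall>\<phi>. C1c \<phi> \<longrightarrow> \<Lambda> \<phi> = (\<integral>x. g x * \<phi> x \<partial>lebesgue)"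
proof -
  let ?\<mu> = representing_measure
  define C where "C = 2 * K * (10::real) ^ DIM('a)"
  have C: "C \<ge> 0" using K by (simp add: C_def)
  have le: "emeasure ?\<mu> A \<le> ennreal C * emeasure lborel A" if A: "A \<in> sets borel" "bounded A" for A
  proof -
    have "emeasure ?\<mu> A = ennreal (measure ?\<mu> A)"
      using fmeasurable_representing_measure[OF A] by (intro emeasure_eq_ennreal_measure) (auto dest: fmeasurableD2)
    also have "\<dots> \<le> ennreal (C * measure lebesgue A)"
      unfolding C_def by (intro ennreal_leI representing_measure_le dom K A)
    also have "\<dots> = ennreal C * emeasure lebesgue A"
      using C bounded_set_imp_lmeasurable[OF A(2)] A(1)
      by (simp add: ennreal_mult emeasure_eq_measure2)
    finally show ?thesis using A(1) by simp
  qed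
  \<comment> \<open>The comparison \<open>le\<close> concerns bounded sets only, so the space is
    exhausted by balls.\<close>
  have U: "A = (\<Union>n. A \<inter> ball 0 (real n))" for A :: "'a set"
    using reals_Archimedean2[of "norm x" for x] by (auto simp: set_eq_iff)
  have "absolutely_continuous lborel ?\<mu>"
    unfolding absolutely_continuous_def
  proof
    fix A :: "'a set" assume A: "A \<in> null_sets lborel"
    have "A \<inter> ball 0 (real n) \<in> null_sets ?\<mu>" for n
    proof -
      have An: "A \<inter> ball 0 (real n) \<in> null_sets lborel" using A by (intro null_set_Int2) auto
      have "emeasure ?\<mu> (A \<inter> ball 0 (real n)) \<le> ennreal C * emeasure lborel (A \<inter> ball 0 (real n))"
        using A by (intro le) (auto intro: bounded_subset[OF bounded_ball])
      also have "\<dots> = 0" using An by auto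
      finally show ?thesis using An by (auto simp: null_sets_def)
    qed
    then have "(\<Union>n. A \<inter> ball 0 (real n)) \<in> null_sets ?\<mu>" by (rule null_sets_UN)
    then show "A \<in> null_sets ?\<mu>" by (simp only: U[symmetric])
  qed
  then have "\<exists>f\<in>borel_measurable lborel. density lborel f = ?\<mu>"
    by (rule sigma_finite_measure.Radon_Nikodym[OF sigma_finite_lborel]) simp
  then obtain f where f: "f \<in> borel_measurable lborel" "density lborel f = ?\<mu>" by blast
  have fm[measurable]: "f \<in> borel_measurable borel" using f(1) by simp
  have AE_le: "AE x in lborel. f x \<le> ennreal C"
  proof -
    have "AE x in lborel. x \<in> ball 0 (real n) \<longrightarrow> f x \<le> ennreal C" for n
    proof -
      \<comment> \<open>The difference of \<open>f\<close> and \<open>C\<close> is positive on this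
        set, yet its integral over it vanishes by \<open>le\<close>, so the set is null. Restriction
        to a ball keeps the subtracted integral finite.\<close>
      define A where "A = {x \<in> ball 0 (real n). ennreal C < f x}"
      have A[measurable]: "A \<in> sets borel" unfolding A_def by measurable
      have bA: "bounded A" by (rule bounded_subset[OF bounded_ball[of 0 "real n"]]) (auto simp: A_def)
      have fin: "emeasure lborel A < top"
        using bounded_set_imp_lmeasurable[OF bA] A by (auto simp: fmeasurable_def)
      have 1: "(\<integral>\<^sup>+x. f x * indicator A x \<partial>lborel) \<le> ennreal C * emeasure lborel A"
      proof -
        have "(\<integral>\<^sup>+x. f x * indicator A x \<partial>lborel) = emeasure (density lborel f) A"
          by (rule emeasure_density[symmetric]) auto
        then show ?thesis using le[OF A bA] by (simp only: f(2))
      qed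
      have 2: "(\<integral>\<^sup>+x. ennreal C * indicator A x \<partial>lborel) = ennreal C * emeasure lborel A"
        by (simp add: nn_integral_cmult_indicator)
      have "(\<integral>\<^sup>+x. f x * indicator A x - ennreal C * indicator A x \<partial>lborel)
          = (\<integral>\<^sup>+x. f x * indicator A x \<partial>lborel) - (\<integral>\<^sup>+x. ennreal C * indicator A x \<partial>lborel)"
      proof (rule nn_integral_diff)
        show "(\<integral>\<^sup>+x. ennreal C * indicator A x \<partial>lborel) \<noteq> \<infinity>"
          using fin by (simp add: 2 ennreal_mult_eq_top_iff)
      qed (auto simp: indicator_def A_def)
      also have "\<dots> = 0"
      proof -
        have "ennreal C * emeasure lborel A < top" using fin by (simp add: ennreal_mult_less_top)
        then show ?thesis unfolding 2 using 1 by (intro diff_eq_0_ennreal) (rule le_less_trans)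
      qed
      finally have "AE x in lborel. f x * indicator A x - ennreal C * indicator A x = 0"
        by (subst (asm) nn_integral_0_iff_AE) auto
      then show ?thesis
      proof eventually_elim
        case (elim x)
        show ?case
        proof (rule impI, rule ccontr)
          assume x: "x \<in> ball 0 (real n)" "\<not> f x \<le> ennreal C"
          then have "x \<in> A" by (simp add: A_def)
          then have "f x - ennreal C = 0" using elim by simp
          then show False using x(2) ennreal_minus_eq_0 by blast
        qed
      qed
    qed
    then have "AE x in lborel. \<forall>n. x \<in> ball 0 (real n) \<longrightarrow> f x \<le> ennreal C"
      unfolding AE_all_countable by blast
    then show ?thesis
    proof eventually_elim
      case (elim x)
      obtain n where "norm x < real n" using reals_Archimedean2 by blast
      then have "x \<in> ball 0 (real n)" by simp
      then show ?case using elim by blast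
    qed
  qed
  \<comment> \<open>Truncation turns the almost everywhere bound into a bound at every point without
    changing the density measure.\<close>
  define g where "g = (\<lambda>x. enn2real (min (f x) (ennreal C)))"
  have g[measurable]: "g \<in> borel_measurable borel" unfolding g_def by measurable
  have gC: "0 \<le> g x" "g x \<le> C" for x
  proof -
    show "0 \<le> g x" by (simp add: g_def)
    have "g x \<le> enn2real (ennreal C)" unfolding g_def by (rule enn2real_mono) auto
    then show "g x \<le> C" using C by simp
  qed
  have \<mu>: "?\<mu> = density lborel (\<lambda>x. ennreal (g x))"
  proof -
    have "AE x in lborel. f x = ennreal (g x)"
      using AE_le
    proof eventually_elim
      case (elim x)
      have "f x < top" using elim by (rule le_less_trans) simp
      moreover have "min (f x) (ennreal C) = f x" using elim by (rule min_absorb1)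
      ultimately show ?case unfolding g_def by (simp only: ennreal_enn2real)
    qed
    moreover have "(\<lambda>x. ennreal (g x)) \<in> borel_measurable lborel" by simp
    ultimately have "density lborel f = density lborel (\<lambda>x. ennreal (g x))"
      by (intro density_cong f(1))
    then show ?thesis by (simp only: f(2))
  qed
  have \<Lambda>: "\<Lambda> \<phi> = (\<integral>x. g x * \<phi> x \<partial>lebesgue)" if \<phi>: "C1c \<phi>" for \<phi>
  proof -
    have m[measurable]: "\<phi> \<in> borel_measurable borel"
      using C1_continuous[OF C1c_C1[OF \<phi>]] by (rule borel_measurable_continuous_onI)
    have "\<Lambda> \<phi> = integral\<^sup>L (density lborel (\<lambda>x. ennreal (g x))) \<phi>"
      using representing_measure_integral[OF \<phi>] by (simp only: \<mu>)
    also have "\<dots> = (\<integral>x. g x *\<^sub>R \<phi> x \<partial>lborel)"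
      by (rule integral_density) (auto simp: gC)
    also have "\<dots> = (\<integral>x. g x * \<phi> x \<partial>lebesgue)"
      by (subst integral_completion) auto
    finally show ?thesis .
  qed
  have gb: "\<bar>g x\<bar> \<le> C" for x using gC(1)[of x] gC(2)[of x] by linarith
  show ?thesis by (rule that[of g C]) (blast intro: g gb \<Lambda>)+
qed

end

section \<open>Rademacher's theorem\<close>

lemma lipschitz_continuous_real:
  fixes f :: "'a::euclidean_space \<Rightarrow> real"
  assumes "\<And>x y. \<bar>f x - f y\<bar> \<le> L * norm (x - y)"
  shows "continuous_on UNIV f"
proof -
  have "\<bar>L\<bar>-lipschitz_on UNIV f"
  proof (rule lipschitz_onI)
    fix x y :: 'a
    have "L * norm (x - y) \<le> \<bar>L\<bar> * norm (x - y)" by (intro mult_right_mono) auto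
    then show "dist (f x) (f y) \<le> \<bar>L\<bar> * dist x y" using assms[of x y] by (simp add: dist_norm)
  qed simp
  then show ?thesis by (rule lipschitz_on_continuous_on)
qed

text \<open>Adding \<open>L\<close> times the Lebesgue integral to the distributional derivative
  gives a functional that lies between 0 and \<open>2 * L\<close> times the Lebesgue integral on
  nonnegative functions; its bounded density \<open>g\<close> yields the weak derivative
  \<open>g - L\<close>.\<close>

lemma lipschitz_weak_derivative:
  fixes f :: "'a::euclidean_space \<Rightarrow> real"
  assumes L: "\<And>x y. \<bar>f x - f y\<bar> \<le> L * norm (x - y)" and b: "b \<in> Basis"
  obtains g M where "g \<in> borel_measurable borel" "\<forall>x. \<bar>g x\<bar> \<le> M"
    "\<forall>\<phi>. C1c \<phi> \<longrightarrow> (\<integral>x. f x * (grad \<phi> x \<bullet> b) \<partial>lebesgue) = - (\<integral>x. g x * \<phi> x \<partial>lebesgue)"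
proof -
  have cont: "continuous_on UNIV f" by (rule lipschitz_continuous_real[OF L])
  have f: "f \<in> borel_measurable lebesgue" "locally_bounded f"
    using borel_measurable_continuous_onI[OF cont] continuous_locally_bounded[OF cont]
    by (auto simp: measurable_completion)
  have mf: "(\<lambda>x. - f x) \<in> borel_measurable lebesgue" "locally_bounded (\<lambda>x. - f x)"
    using f by (auto simp: locally_bounded_def)
  have k: "(\<lambda>x::'a. L) \<in> borel_measurable lebesgue" "locally_bounded (\<lambda>x::'a. L)"
    by (auto intro: locally_bounded_const)
  have L0: "0 \<le> L" using L[of b 0] b by (auto intro: order_trans[OF abs_ge_zero])
  have step: "\<bar>f (x + \<epsilon> *\<^sub>R b) - f x\<bar> \<le> \<epsilon> * L" if "0 < \<epsilon>" for x \<epsilon>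
    using L[of "x + \<epsilon> *\<^sub>R b" x] b that by (simp add: mult.commute)
  have P: "positive_functional (\<lambda>\<phi>. (\<integral>x. - f x * (grad \<phi> x \<bullet> b) \<partial>lebesgue) + (\<integral>x. L * \<phi> x \<partial>lebesgue))"
  proof (rule positive_functional_distributional_derivative[OF mf k, where D=UNIV])
    show "- f (x + \<epsilon> *\<^sub>R b) - - f x \<le> \<epsilon> * L" if "0 < \<epsilon>" for x \<epsilon>
      using step[OF that, of x] by linarith
  qed auto
  interpret P: positive_functional "\<lambda>\<phi>. (\<integral>x. - f x * (grad \<phi> x \<bullet> b) \<partial>lebesgue) + (\<integral>x. L * \<phi> x \<partial>lebesgue)"
    by (rule P)
  have dom: "(\<integral>x. - f x * (grad \<phi> x \<bullet> b) \<partial>lebesgue) + (\<integral>x. L * \<phi> x \<partial>lebesgue) \<le> (2 * L) * (\<integral>x. \<phi> x \<partial>lebesgue)"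
    if "C1c \<phi>" "\<And>x. 0 \<le> \<phi> x" for \<phi>
  proof -
    have "0 \<le> (\<integral>x. f x * (grad \<phi> x \<bullet> b) \<partial>lebesgue) + (\<integral>x. L * \<phi> x \<partial>lebesgue)"
    proof (rule distributional_derivative_le[OF f k, where D=UNIV])
      show "f (x + \<epsilon> *\<^sub>R b) - f x \<le> \<epsilon> * L" if "0 < \<epsilon>" for x \<epsilon>
        using step[OF that, of x] by linarith
    qed (use that in auto)
    then show ?thesis by simp
  qed
  obtain g M where g: "g \<in> borel_measurable borel" "\<forall>x. \<bar>g x\<bar> \<le> M"
    "\<forall>\<phi>. C1c \<phi> \<longrightarrow> (\<integral>x. - f x * (grad \<phi> x \<bullet> b) \<partial>lebesgue) + (\<integral>x. L * \<phi> x \<partial>lebesgue) = (\<integral>x. g x * \<phi> x \<partial>lebesgue)"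
    by (rule P.bounded_density[OF dom]) (use L0 in auto)
  show ?thesis
  proof (rule that[of "\<lambda>x. g x - L" "M + L"])
    show "(\<lambda>x. g x - L) \<in> borel_measurable borel" using g(1) by simp
    show "\<forall>x. \<bar>g x - L\<bar> \<le> M + L"
    proof
      fix x show "\<bar>g x - L\<bar> \<le> M + L" using g(2)[rule_format, of x] L0 by linarith
    qed
    show "\<forall>\<phi>. C1c \<phi> \<longrightarrow> (\<integral>x. f x * (grad \<phi> x \<bullet> b) \<partial>lebesgue) = - (\<integral>x. (g x - L) * \<phi> x \<partial>lebesgue)"
    proof (intro allI impI)
      fix \<phi> :: "'a \<Rightarrow> real" assume \<phi>: "C1c \<phi>"
      have gm: "g \<in> borel_measurable lebesgue" using g(1) by (simp add: measurable_completion)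
      have gb: "locally_bounded g" using g(2) by (auto simp: locally_bounded_def)
      have I: "integrable lebesgue (\<lambda>x. g x * \<phi> x)" "integrable lebesgue (\<lambda>x. L * \<phi> x)"
        using integrable_mult_C1c(1)[OF gm gb \<phi>] integrable_mult_C1c(1)[OF k \<phi>] by auto
      have "(\<integral>x. (g x - L) * \<phi> x \<partial>lebesgue) = (\<integral>x. g x * \<phi> x \<partial>lebesgue) - (\<integral>x. L * \<phi> x \<partial>lebesgue)"
        using Bochner_Integration.integral_diff[OF I] by (simp only: left_diff_distrib)
      moreover have "(\<integral>x. - f x * (grad \<phi> x \<bullet> b) \<partial>lebesgue) = - (\<integral>x. f x * (grad \<phi> x \<bullet> b) \<partial>lebesgue)"
        by (simp only: mult_minus_left Bochner_Integration.integral_minus)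
      ultimately show "(\<integral>x. f x * (grad \<phi> x \<bullet> b) \<partial>lebesgue) = - (\<integral>x. (g x - L) * \<phi> x \<partial>lebesgue)"
        using g(3)[rule_format, OF \<phi>] by linarith
    qed
  qed
qed

text \<open>Difference quotients of a linear function are exact, so
  \<open>distributional_derivative_le\<close> applied to \<open>a\<close> and to \<open>- a\<close>
  gives the two inequalities.\<close>

lemma integral_linear_grad:
  fixes a v :: "'a::euclidean_space"
  assumes \<phi>: "C1c \<phi>" "\<And>x. 0 \<le> \<phi> x"
  shows "(\<integral>x. (a \<bullet> x) * (grad \<phi> x \<bullet> v) \<partial>lebesgue) = - (\<integral>x. (a \<bullet> v) * \<phi> x \<partial>lebesgue)"
proof (rule antisym)
  have le: "0 \<le> (\<integral>x. (c \<bullet> x) * (grad \<phi> x \<bullet> v) \<partial>lebesgue) + (\<integral>x. (c \<bullet> v) * \<phi> x \<partial>lebesgue)" for c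
  proof (rule distributional_derivative_le[where D=UNIV])
    have cont: "continuous_on UNIV (\<lambda>x. c \<bullet> x)" by (intro continuous_intros)
    then show "(\<lambda>x. c \<bullet> x) \<in> borel_measurable lebesgue" "locally_bounded (\<lambda>x. c \<bullet> x)"
      using borel_measurable_continuous_onI[OF cont] continuous_locally_bounded[OF cont]
      by (auto simp: measurable_completion)
  qed (use \<phi> in \<open>auto simp: inner_add_right intro: locally_bounded_const\<close>)
  show "- (\<integral>x. (a \<bullet> v) * \<phi> x \<partial>lebesgue) \<le> (\<integral>x. (a \<bullet> x) * (grad \<phi> x \<bullet> v) \<partial>lebesgue)"
    using le[of a] by linarith
  have "(\<integral>x. (- a \<bullet> x) * (grad \<phi> x \<bullet> v) \<partial>lebesgue) = - (\<integral>x. (a \<bullet> x) * (grad \<phi> x \<bullet> v) \<partial>lebesgue)"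
    "(\<integral>x. (- a \<bullet> v) * \<phi> x \<partial>lebesgue) = - (\<integral>x. (a \<bullet> v) * \<phi> x \<partial>lebesgue)"
    by (simp_all only: inner_minus_left mult_minus_left Bochner_Integration.integral_minus)
  then show "(\<integral>x. (a \<bullet> x) * (grad \<phi> x \<bullet> v) \<partial>lebesgue) \<le> - (\<integral>x. (a \<bullet> v) * \<phi> x \<partial>lebesgue)"
    using le[of "- a"] by linarith
qed

text \<open>Subtracting the linear function \<open>a \<bullet> x\<close>, \<open>a = G x0\<close>, the weak gradient becomes small in mean
  near \<open>x0\<close>. Averages of the difference over small balls moving from \<open>x0\<close> to \<open>x0 + v\<close> therefore
  barely change, and they are close to the values at the centres by the Lipschitz bound.\<close>

lemma has_derivative_weak_gradient:
  fixes f :: "'a::euclidean_space \<Rightarrow> real" and G :: "'a \<Rightarrow> 'a"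
  assumes L: "\<And>x y. \<bar>f x - f y\<bar> \<le> L * norm (x - y)"
    and G: "G \<in> borel_measurable lebesgue" "\<And>x. norm (G x) \<le> M"
    and weak: "\<And>\<phi> v. C1c \<phi> \<Longrightarrow> (\<integral>x. f x * (grad \<phi> x \<bullet> v) \<partial>lebesgue) = - (\<integral>x. (G x \<bullet> v) * \<phi> x \<partial>lebesgue)"
    and x0: "\<And>e. 0 < e \<Longrightarrow> \<exists>d>0. \<forall>r. 0 < r \<longrightarrow> r < d \<longrightarrow>
      (\<integral>y. indicator (ball x0 r) y * norm (G y - G x0) \<partial>lebesgue) \<le> e * measure lebesgue (ball x0 r)"
  shows "(f has_derivative (\<lambda>v. G x0 \<bullet> v)) (at x0)"
proof -
  define a where "a = G x0"
  define f1 where "f1 = (\<lambda>x. f x - a \<bullet> x)"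
  define L1 where "L1 = \<bar>L\<bar> + norm a + 1"
  have L1: "L1 > 0" by (simp add: L1_def add_nonneg_pos)
  have f1L: "\<bar>f1 x - f1 y\<bar> \<le> L1 * norm (x - y)" for x y
  proof -
    have "\<bar>f1 x - f1 y\<bar> \<le> \<bar>f x - f y\<bar> + \<bar>a \<bullet> (x - y)\<bar>" by (simp add: f1_def inner_diff_right)
    also have "\<dots> \<le> \<bar>L\<bar> * norm (x - y) + norm a * norm (x - y)"
      using L[of x y] Cauchy_Schwarz_ineq2[of a "x - y"] mult_right_mono[OF abs_ge_self[of L] norm_ge_zero[of "x - y"]]
      by linarith
    also have "\<dots> \<le> L1 * norm (x - y)" by (simp add: L1_def distrib_right)
    finally show ?thesis .
  qed
  have cont: "continuous_on UNIV f" "continuous_on UNIV f1" "continuous_on UNIV (\<lambda>x. a \<bullet> x)"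
    by (rule lipschitz_continuous_real[OF L], rule lipschitz_continuous_real[OF f1L]) (intro continuous_intros)
  have meas: "g \<in> borel_measurable lebesgue" "locally_bounded g" if "continuous_on UNIV g" for g :: "'a \<Rightarrow> real"
    using borel_measurable_continuous_onI[OF that] continuous_locally_bounded[OF that]
    by (auto simp: measurable_completion)
  have Gv: "(\<lambda>x. G x \<bullet> v) \<in> borel_measurable lebesgue" "locally_bounded (\<lambda>x. G x \<bullet> v)" for v
  proof -
    show "(\<lambda>x. G x \<bullet> v) \<in> borel_measurable lebesgue" using G(1) by simp
    have "locally_bounded G" using G(2) by (auto simp: locally_bounded_def)
    then show "locally_bounded (\<lambda>x. G x \<bullet> v)" by (rule locally_bounded_inner)
  qed
  have weak1: "(\<integral>x. f1 x * (grad \<phi> x \<bullet> v) \<partial>lebesgue) = - (\<integral>x. ((G x - a) \<bullet> v) * \<phi> x \<partial>lebesgue)"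
    if \<phi>: "C1c \<phi>" "\<And>x. 0 \<le> \<phi> x" for \<phi> v
  proof -
    note I = integrable_mult_C1c(2)[OF meas[OF cont(1)] \<phi>(1), of v] integrable_mult_C1c(2)[OF meas[OF cont(3)] \<phi>(1), of v]
    note J = integrable_mult_C1c(1)[OF Gv[of v] \<phi>(1)] integrable_mult_C1c(1)[OF _ locally_bounded_const[of "a \<bullet> v"] \<phi>(1)]
    have "(\<integral>x. f1 x * (grad \<phi> x \<bullet> v) \<partial>lebesgue)
        = (\<integral>x. f x * (grad \<phi> x \<bullet> v) \<partial>lebesgue) - (\<integral>x. (a \<bullet> x) * (grad \<phi> x \<bullet> v) \<partial>lebesgue)"
      unfolding f1_def left_diff_distrib by (rule Bochner_Integration.integral_diff[OF I])
    moreover have "(\<integral>x. ((G x - a) \<bullet> v) * \<phi> x \<partial>lebesgue) = (\<integral>x. (G x \<bullet> v) * \<phi> x \<partial>lebesgue) - (\<integral>x. (a \<bullet> v) * \<phi> x \<partial>lebesgue)"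
      unfolding inner_diff_left left_diff_distrib by (rule Bochner_Integration.integral_diff[OF J]) simp
    ultimately show ?thesis using weak[OF \<phi>(1), of v] integral_linear_grad[OF \<phi>, of a v] by linarith
  qed
  have "\<exists>d>0. \<forall>y. norm (y - x0) < d \<longrightarrow> norm (f y - f x0 - a \<bullet> (y - x0)) \<le> e * norm (y - x0)"
    if e: "e > 0" for e
  proof -
    \<comment> \<open>The ratio of the averaging radius to \<open>norm v\<close>: replacing averages
      by the values at both ends costs \<open>2 * L1 * \<delta> \<le> e / 2\<close> per unit of
      \<open>norm v\<close>.\<close>
    define \<delta> where "\<delta> = min (1/2) (e / (4 * L1))"
    have \<delta>: "\<delta> > 0" "\<delta> \<le> 1" using e L1 by (auto simp: \<delta>_def)
    have \<delta>L: "2 * L1 * \<delta> \<le> e / 2"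
    proof -
      have "\<delta> \<le> e / (4 * L1)" by (simp add: \<delta>_def)
      then have "\<delta> * (4 * L1) \<le> e" using L1 by (simp add: pos_le_divide_eq)
      then show ?thesis by (simp add: mult_ac)
    qed
    \<comment> \<open>The volume ratio of a ball of radius \<open>2 * r\<close> to one of radius
      \<open>\<rho> / 2\<close>, where \<open>\<rho> = \<delta> * r\<close>.\<close>
    define N where "N = (4 / \<delta>) ^ DIM('a)"
    have N: "N > 0" using \<delta> by (simp add: N_def)
    \<comment> \<open>Makes the drift of the averages at most \<open>e / 2\<close> per unit of
      \<open>norm v\<close>; \<open>9/16 * \<rho> ^ 4\<close> is the lower bound of the bump on the
      ball of half its radius.\<close>
    define \<kappa> where "\<kappa> = e / 2 * (9/16) / N"
    have \<kappa>: "\<kappa> > 0" using e N by (simp add: \<kappa>_def)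
    obtain d where d: "d > 0" "\<forall>r. 0 < r \<longrightarrow> r < d \<longrightarrow>
        (\<integral>y. indicator (ball x0 r) y * norm (G y - G x0) \<partial>lebesgue) \<le> \<kappa> * measure lebesgue (ball x0 r)"
      using x0[OF \<kappa>] by blast
    have main: "\<bar>f1 (x0 + v) - f1 x0\<bar> \<le> e * norm v" if v: "v \<noteq> 0" "norm v < d / 2" for v
    proof -
      define r where "r = norm v"
      have r: "r > 0" "2 * r < d" using v by (auto simp: r_def)
      define \<rho> where "\<rho> = \<delta> * r"
      have \<rho>: "\<rho> > 0" "\<rho> \<le> r" using \<delta> r by (auto simp: \<rho>_def mult_le_cancel_right1)
      define \<beta> where "\<beta> = (\<lambda>t. bump (x0 + t *\<^sub>R v) \<rho>)"
      have \<beta>: "C1c (\<beta> t)" "0 \<le> \<beta> t x" for t x by (simp_all add: \<beta>_def C1c_bump bump_nonneg)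
      have \<beta>_shift: "\<beta> t x = \<beta> 0 (x - t *\<^sub>R v)" for t x by (simp add: \<beta>_def bump_translate)
      define I where "I = (\<integral>x. \<beta> 0 x \<partial>lebesgue)"
      have I_t: "(\<integral>x. \<beta> t x \<partial>lebesgue) = I" for t
      proof -
        have "\<beta> 0 \<in> borel_measurable lebesgue" by (intro meas C1_continuous C1c_C1 \<beta>)
        from integral_lebesgue_translation[OF this, of "- (t *\<^sub>R v)"]
        show ?thesis by (simp add: I_def \<beta>_shift[of t])
      qed
      define m where "m = measure lebesgue (ball x0 (\<rho> / 2))"
      have m: "m > 0" using \<rho> content_ball_gt_0_iff[of x0 "\<rho> / 2"] by (simp add: m_def)
      have I_ge: "9/16 * \<rho> ^ 4 * m \<le> I"
      proof -
        have "(\<integral>x. 9/16 * \<rho> ^ 4 * indicator (ball x0 (\<rho> / 2)) x \<partial>lebesgue) \<le> I"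
          unfolding I_def
        proof (rule integral_mono)
          show "integrable lebesgue (\<lambda>x. 9/16 * \<rho> ^ 4 * indicator (ball x0 (\<rho> / 2)) x)"
            by (intro integrable_mult_right integrable_indicator_lmeasurable lmeasurable_ball)
          show "integrable lebesgue (\<beta> 0)" by (intro integrable_C1c \<beta>)
          fix x
          have "(\<rho>\<^sup>2 - (\<rho> / 2)\<^sup>2)\<^sup>2 = 9/16 * \<rho> ^ 4" by (simp add: power2_eq_square power4_eq_xxxx)
          then show "9/16 * \<rho> ^ 4 * indicator (ball x0 (\<rho> / 2)) x \<le> \<beta> 0 x"
            using \<beta>(2)[of 0 x] bump_ge[of x x0 "\<rho> / 2" \<rho>] \<rho>
            by (cases "x \<in> ball x0 (\<rho> / 2)") (auto simp: \<beta>_def dist_norm norm_minus_commute)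
        qed
        then show ?thesis by (simp add: m_def)
      qed
      then have I0: "I > 0" using m \<rho> by (intro less_le_trans[OF _ I_ge]) auto
      \<comment> \<open>The unnormalized average of \<open>f1\<close> over a ball moving along the
        segment from \<open>x0\<close> to \<open>x0 + v\<close>; its derivative in \<open>t\<close>
        is an integral of the weak gradient \<open>G x - a\<close>.\<close>
      define F where "F = (\<lambda>t. \<integral>x. f1 x * \<beta> t x \<partial>lebesgue)"
      note If = integrable_mult_C1c(1)[OF meas[OF cont(2)] \<beta>(1)]
      have F_close: "\<bar>F t - f1 (x0 + t *\<^sub>R v) * I\<bar> \<le> L1 * \<rho> * I" for t
      proof -
        let ?c = "f1 (x0 + t *\<^sub>R v)"
        have IB: "integrable lebesgue (\<lambda>x. c * \<beta> t x)" for c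
          by (intro integrable_mult_right integrable_C1c \<beta>)
        have "F t - ?c * I = (\<integral>x. f1 x * \<beta> t x \<partial>lebesgue) - (\<integral>x. ?c * \<beta> t x \<partial>lebesgue)"
          using I_t[of t] by (simp add: F_def)
        also have "\<dots> = (\<integral>x. (f1 x - ?c) * \<beta> t x \<partial>lebesgue)"
          unfolding left_diff_distrib by (rule Bochner_Integration.integral_diff[OF If IB, symmetric])
        also have "\<bar>\<dots>\<bar> \<le> (\<integral>x. \<bar>(f1 x - ?c) * \<beta> t x\<bar> \<partial>lebesgue)" by (rule integral_abs_bound)
        also have "\<dots> \<le> (\<integral>x. (L1 * \<rho>) * \<beta> t x \<partial>lebesgue)"
        proof (rule integral_mono)
          have "integrable lebesgue (\<lambda>x. (f1 x - ?c) * \<beta> t x)"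
            unfolding left_diff_distrib by (rule Bochner_Integration.integrable_diff[OF If IB])
          then show "integrable lebesgue (\<lambda>x. \<bar>(f1 x - ?c) * \<beta> t x\<bar>)" by (rule integrable_abs)
          show "integrable lebesgue (\<lambda>x. (L1 * \<rho>) * \<beta> t x)" by (rule IB)
          fix x
          show "\<bar>(f1 x - ?c) * \<beta> t x\<bar> \<le> (L1 * \<rho>) * \<beta> t x"
          proof (cases "norm (x - (x0 + t *\<^sub>R v)) \<le> \<rho>")
            case True
            have "\<bar>f1 x - ?c\<bar> \<le> L1 * \<rho>"
              using f1L[of x "x0 + t *\<^sub>R v"] mult_left_mono[OF True less_imp_le[OF L1]] by linarith
            then show ?thesis using \<beta>(2)[of t x] by (simp add: abs_mult mult_right_mono)
          next
            case False
            then have "\<beta> t x = 0" unfolding \<beta>_def using \<rho> by (intro bump_outside) auto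
            then show ?thesis by simp
          qed
        qed
        also have "\<dots> = L1 * \<rho> * I" using I_t[of t] by simp
        finally show ?thesis .
      qed
      have F_deriv: "(F has_real_derivative (\<integral>x. ((G x - a) \<bullet> v) * \<beta> t x \<partial>lebesgue)) (at t)" for t
      proof -
        have "((\<lambda>s. \<integral>x. f1 x * \<beta> t (x - s *\<^sub>R v) \<partial>lebesgue) has_real_derivative
            - (\<integral>x. f1 x * (grad (\<beta> t) x \<bullet> v) \<partial>lebesgue)) (at 0)"
          by (rule DERIV_integral_translate[OF meas[OF cont(2)] \<beta>(1)])
        moreover have "(\<lambda>s. \<integral>x. f1 x * \<beta> t (x - s *\<^sub>R v) \<partial>lebesgue) = (\<lambda>s. F (s + t))"
        proof
          fix s
          have "\<beta> t (x - s *\<^sub>R v) = \<beta> (s + t) x" for x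
            unfolding \<beta>_shift[of t] \<beta>_shift[of "s + t"] by (simp add: scaleR_add_left algebra_simps)
          then show "(\<integral>x. f1 x * \<beta> t (x - s *\<^sub>R v) \<partial>lebesgue) = F (s + t)" by (simp add: F_def)
        qed
        ultimately show ?thesis
          using DERIV_shift[of F _ 0 t] weak1[OF \<beta>, of t v] by simp
      qed
      have F_bound: "\<bar>\<integral>x. ((G x - a) \<bullet> v) * \<beta> t x \<partial>lebesgue\<bar> \<le> r * \<rho> ^ 4 * (\<kappa> * measure lebesgue (ball x0 (2 * r)))"
        if t: "0 < t" "t < 1" for t
      proof -
        have pt: "\<bar>((G x - a) \<bullet> v) * \<beta> t x\<bar> \<le> r * \<rho> ^ 4 * (indicator (ball x0 (2 * r)) x * norm (G x - G x0))" for x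
        proof (cases "norm (x - (x0 + t *\<^sub>R v)) < \<rho>")
          case True
          have "norm (t *\<^sub>R v) \<le> r" using t by (simp add: r_def mult_left_le_one_le)
          then have "norm (x - x0) < 2 * r"
            using True \<rho>(2) norm_triangle_ineq[of "x - (x0 + t *\<^sub>R v)" "t *\<^sub>R v"] by simp
          then have "x \<in> ball x0 (2 * r)" by (simp add: dist_norm norm_minus_commute)
          moreover have "\<bar>(G x - a) \<bullet> v\<bar> * \<beta> t x \<le> (norm (G x - a) * r) * \<rho> ^ 4"
            unfolding r_def \<beta>_def using bump_nonneg bump_le Cauchy_Schwarz_ineq2 by (intro mult_mono) auto
          ultimately show ?thesis using \<beta>(2)[of t x] by (simp add: abs_mult a_def mult_ac)
        next
          case False
          then have "\<beta> t x = 0" unfolding \<beta>_def using \<rho> by (intro bump_outside) auto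
          then show ?thesis using r \<rho> by simp
        qed
        have Gi: "integrable lebesgue (\<lambda>x. indicator (ball x0 (2 * r)) x * norm (G x - G x0))"
        proof (rule integrable_locally_bounded)
          have "(\<lambda>x. norm (G x - G x0)) \<in> borel_measurable lebesgue" using G(1) by measurable
          then show "(\<lambda>x. indicator (ball x0 (2 * r)) x * norm (G x - G x0)) \<in> borel_measurable lebesgue"
            by (intro borel_measurable_times borel_measurable_indicator) auto
          show "locally_bounded (\<lambda>x. indicator (ball x0 (2 * r)) x * norm (G x - G x0))"
            unfolding locally_bounded_def
          proof (intro allI exI impI)
            fix x
            show "norm (indicator (ball x0 (2 * r)) x * norm (G x - G x0)) \<le> 2 * M"
              using norm_triangle_ineq4[of "G x" "G x0"] G(2)[of x] G(2)[of x0] order_trans[OF norm_ge_zero G(2)[of x]]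
              by (auto simp: indicator_def)
          qed
          show "indicator (ball x0 (2 * r)) x * norm (G x - G x0) = 0" if "norm x > norm x0 + 2 * r" for x
            using that norm_triangle_ineq2[of x x0] by (auto simp: indicator_def dist_norm norm_minus_commute)
        qed
        have "locally_bounded (\<lambda>x. (G x - a) \<bullet> v)"
        proof -
          have "norm (G x - a) \<le> 2 * M" for x
            using norm_triangle_ineq4[of "G x" a] G(2)[of x] G(2)[of x0] by (simp add: a_def)
          then have "locally_bounded (\<lambda>x. G x - a)" by (auto simp: locally_bounded_def)
          then show ?thesis by (rule locally_bounded_inner)
        qed
        then have Ii: "integrable lebesgue (\<lambda>x. ((G x - a) \<bullet> v) * \<beta> t x)"
          using G(1) by (intro integrable_mult_C1c(1) \<beta>) auto
        have "\<bar>\<integral>x. ((G x - a) \<bullet> v) * \<beta> t x \<partial>lebesgue\<bar> \<le> (\<integral>x. \<bar>((G x - a) \<bullet> v) * \<beta> t x\<bar> \<partial>lebesgue)"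
          by (rule integral_abs_bound)
        also have "\<dots> \<le> (\<integral>x. r * \<rho> ^ 4 * (indicator (ball x0 (2 * r)) x * norm (G x - G x0)) \<partial>lebesgue)"
          by (rule integral_mono[OF integrable_abs[OF Ii] integrable_mult_right[OF Gi] pt])
        also have "\<dots> = r * \<rho> ^ 4 * (\<integral>x. indicator (ball x0 (2 * r)) x * norm (G x - G x0) \<partial>lebesgue)"
          by (rule integral_mult_right_zero)
        also have "\<dots> \<le> r * \<rho> ^ 4 * (\<kappa> * measure lebesgue (ball x0 (2 * r)))"
          using d(2) r \<rho> by (intro mult_left_mono) auto
        finally show ?thesis .
      qed
      obtain z where z: "0 < z" "z < 1" "F 1 - F 0 = (1 - 0) * (\<integral>x. ((G x - a) \<bullet> v) * \<beta> z x \<partial>lebesgue)"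
        using MVT2[of 0 1 F "\<lambda>t. \<integral>x. ((G x - a) \<bullet> v) * \<beta> t x \<partial>lebesgue"] F_deriv by auto
      have "\<bar>F 1 - F 0\<bar> \<le> r * (e / 2) * I"
      proof -
        have E1: "measure lebesgue (ball x0 (2 * r)) = N * m"
        proof -
          have "2 * r = (4 / \<delta>) * (\<rho> / 2)" using \<delta> by (simp add: \<rho>_def)
          then show ?thesis
            unfolding N_def m_def using \<delta> \<rho> measure_ball_scale[of "4 / \<delta>" "\<rho> / 2" x0 x0] by simp
        qed
        have E2: "\<kappa> * (N * m) = e / 2 * (9/16 * m)" using N by (simp add: \<kappa>_def)
        have "\<bar>F 1 - F 0\<bar> \<le> r * \<rho> ^ 4 * (e / 2 * (9/16 * m))"
          using F_bound[OF z(1,2)] unfolding z(3) E1 E2 by (simp only: diff_zero mult_1)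
        also have "\<dots> = r * (e / 2) * (9/16 * \<rho> ^ 4 * m)" by simp
        also have "\<dots> \<le> r * (e / 2) * I" using r e by (intro mult_left_mono I_ge) auto
        finally show ?thesis .
      qed
      moreover have "\<bar>F 1 - f1 (x0 + v) * I\<bar> \<le> L1 * \<rho> * I" "\<bar>F 0 - f1 x0 * I\<bar> \<le> L1 * \<rho> * I"
        using F_close[of 1] F_close[of 0] by auto
      ultimately have "\<bar>f1 (x0 + v) * I - f1 x0 * I\<bar> \<le> 2 * (L1 * \<rho> * I) + r * (e / 2) * I" by linarith
      also have "\<dots> = ((2 * L1 * \<delta>) * r + (e / 2) * r) * I" by (simp add: \<rho>_def algebra_simps)
      also have "\<dots> \<le> ((e / 2) * r + (e / 2) * r) * I"
        using \<delta>L r I0 by (intro mult_right_mono add_right_mono) auto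
      finally have "\<bar>f1 (x0 + v) - f1 x0\<bar> * I \<le> (e * r) * I"
        using I0 by (simp add: abs_mult flip: left_diff_distrib)
      then show ?thesis using I0 by (simp add: r_def)
    qed
    show ?thesis
    proof (intro exI[of _ "d / 2"] conjI allI impI)
      show "0 < d / 2" using d by simp
      fix y assume y: "norm (y - x0) < d / 2"
      show "norm (f y - f x0 - a \<bullet> (y - x0)) \<le> e * norm (y - x0)"
      proof (cases "y = x0")
        case False
        then have "\<bar>f1 (x0 + (y - x0)) - f1 x0\<bar> \<le> e * norm (y - x0)" using y by (intro main) auto
        moreover have "f1 y - f1 x0 = f y - f x0 - a \<bullet> (y - x0)" by (simp add: f1_def inner_diff_right)
        ultimately show ?thesis by simp
      qed simp
    qed
  qed
  then show ?thesis
    unfolding has_derivative_at_alt a_def by (simp add: bounded_linear_inner_right)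
qed

text \<open>The weak partial derivatives are assembled into a bounded field \<open>G\<close>. Being
  bounded, \<open>G\<close> has a Lebesgue point wherever it is approximately continuous, and there
  \<open>has_derivative_weak_gradient\<close> applies.\<close>

theorem Rademacher_real:
  fixes f :: "'a::euclidean_space \<Rightarrow> real"
  assumes L: "\<And>x y. \<bar>f x - f y\<bar> \<le> L * norm (x - y)"
  shows "AE x in lebesgue. f differentiable (at x)"
proof -
  define W where "W = (\<lambda>b g M. g \<in> borel_measurable borel \<and> (\<forall>x. \<bar>g x\<bar> \<le> (M::real)) \<and>
    (\<forall>\<phi>. C1c \<phi> \<longrightarrow> (\<integral>x. f x * (grad \<phi> x \<bullet> b) \<partial>lebesgue) = - (\<integral>x. g x * \<phi> x \<partial>lebesgue)))"
  have "\<exists>g M. W b g M" if "b \<in> Basis" for b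
    unfolding W_def by (rule lipschitz_weak_derivative[OF L that]) blast
  then obtain g M where "\<And>b. b \<in> Basis \<Longrightarrow> W b (g b) (M b)" by metis
  then have g: "\<And>b. b \<in> Basis \<Longrightarrow> g b \<in> borel_measurable borel"
    "\<And>b x. b \<in> Basis \<Longrightarrow> \<bar>g b x\<bar> \<le> M b"
    "\<And>b \<phi>. b \<in> Basis \<Longrightarrow> C1c \<phi> \<Longrightarrow> (\<integral>x. f x * (grad \<phi> x \<bullet> b) \<partial>lebesgue) = - (\<integral>x. g b x * \<phi> x \<partial>lebesgue)"
    unfolding W_def by blast+
  define G where "G = (\<lambda>x. \<Sum>b\<in>Basis. g b x *\<^sub>R b)"
  have Gm: "G \<in> borel_measurable lebesgue"
    unfolding G_def
  proof (intro borel_measurable_sum borel_measurable_scaleR)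
    show "g b \<in> borel_measurable lebesgue" if "b \<in> Basis" for b
      using g(1)[OF that] by (simp add: measurable_completion)
  qed simp
  have Gb: "norm (G x) \<le> (\<Sum>b\<in>Basis. M b)" for x
    unfolding G_def
  proof (rule order_trans[OF norm_sum sum_mono])
    show "norm (g b x *\<^sub>R b) \<le> M b" if "b \<in> Basis" for b
      using g(2)[OF that, of x] that by simp
  qed
  have weak: "(\<integral>x. f x * (grad \<phi> x \<bullet> v) \<partial>lebesgue) = - (\<integral>x. (G x \<bullet> v) * \<phi> x \<partial>lebesgue)" if \<phi>: "C1c \<phi>" for \<phi> v
  proof -
    have cont: "continuous_on UNIV f" by (rule lipschitz_continuous_real[OF L])
    have fm: "f \<in> borel_measurable lebesgue" "locally_bounded f"
      using borel_measurable_continuous_onI[OF cont] continuous_locally_bounded[OF cont]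
      by (auto simp: measurable_completion)
    have gm: "g b \<in> borel_measurable lebesgue" "locally_bounded (g b)" if "b \<in> Basis" for b
      using g(1,2)[OF that] by (auto simp: measurable_completion locally_bounded_def)
    have "(\<integral>x. f x * (grad \<phi> x \<bullet> v) \<partial>lebesgue) = (\<integral>x. (\<Sum>b\<in>Basis. (v \<bullet> b) * (f x * (grad \<phi> x \<bullet> b))) \<partial>lebesgue)"
      by (simp add: euclidean_inner[of "grad \<phi> _" v] sum_distrib_left mult_ac)
    also have "\<dots> = (\<Sum>b\<in>Basis. (v \<bullet> b) * (\<integral>x. f x * (grad \<phi> x \<bullet> b) \<partial>lebesgue))"
      by (subst Bochner_Integration.integral_sum)
         (auto intro!: integrable_mult_right integrable_mult_C1c(2)[OF fm \<phi>])
    also have "\<dots> = (\<Sum>b\<in>Basis. - ((v \<bullet> b) * (\<integral>x. g b x * \<phi> x \<partial>lebesgue)))"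
      by (intro sum.cong refl) (simp add: g(3)[OF _ \<phi>])
    also have "\<dots> = - (\<integral>x. (\<Sum>b\<in>Basis. (v \<bullet> b) * (g b x * \<phi> x)) \<partial>lebesgue)"
      by (subst Bochner_Integration.integral_sum)
         (auto intro!: integrable_mult_right integrable_mult_C1c(1)[OF gm \<phi>] simp: sum_negf)
    also have "(\<lambda>x. \<Sum>b\<in>Basis. (v \<bullet> b) * (g b x * \<phi> x)) = (\<lambda>x. (G x \<bullet> v) * \<phi> x)"
      by (auto simp: G_def inner_sum_left sum_distrib_left sum_distrib_right inner_commute[of v] mult_ac)
    finally show ?thesis .
  qed
  show ?thesis
    using approximately_continuous_AE[OF Gm]
  proof eventually_elim
    case (elim x)
    have "(f has_derivative (\<lambda>v. G x \<bullet> v)) (at x)"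
      by (rule has_derivative_weak_gradient[OF L Gm Gb weak Lebesgue_point_bounded[OF Gm Gb elim]])
    then show ?case unfolding differentiable_def by blast
  qed
qed

section \<open>Singular values and continuity points\<close>

text \<open>Translates of the slab by multiples of \<open>3 s / m\<close> in the normal direction are disjoint and stay
  in a ball of comparable radius, so the slab carries at most the fraction \<open>1 / m\<close> of that ball.\<close>

lemma measure_slab_le:
  fixes c \<nu> :: "'a::euclidean_space"
  assumes \<nu>: "norm \<nu> = 1" and s: "0 < s" and L: "0 \<le> L" and m: "0 < m"
  defines "A \<equiv> {y \<in> cball c (L * s). \<bar>(y - c) \<bullet> \<nu>\<bar> \<le> s / real m}"
  shows "A \<in> lmeasurable" "real m * measure lebesgue A \<le> measure lebesgue (ball c ((L + 4) * s))"
proof -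
  have "A = cball c (L * s) \<inter> {y. \<bar>(y - c) \<bullet> \<nu>\<bar> \<le> s / real m}" by (auto simp: A_def)
  moreover have "closed {y. \<bar>(y - c) \<bullet> \<nu>\<bar> \<le> s / real m}" by (intro closed_Collect_le continuous_intros)
  ultimately have "compact A" by (simp add: compact_Int_closed)
  then show A: "A \<in> lmeasurable" by (rule lmeasurable_compact)
  \<comment> \<open>The slab has width \<open>2 * s / m\<close>, less than the spacing
    \<open>3 * s / m\<close>, so the translates are disjoint; no shift exceeds
    \<open>3 * s\<close>.\<close>
  define T where "T = (\<lambda>k::nat. (+) ((3 * s * real k / real m) *\<^sub>R \<nu>) ` A)"
  have T: "T k \<in> lmeasurable" "measure lebesgue (T k) = measure lebesgue A" for k
    using A by (auto simp: T_def measurable_translation measure_translation)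
  have dis: "disjoint_family_on T {..<m}"
    unfolding disjoint_family_on_def
  proof (intro ballI impI)
    fix k l :: nat assume kl: "k \<noteq> l"
    show "T k \<inter> T l = {}"
    proof (rule ccontr)
      assume "T k \<inter> T l \<noteq> {}"
      then obtain y z where yz: "y \<in> A" "z \<in> A"
        "(3 * s * real k / real m) *\<^sub>R \<nu> + y = (3 * s * real l / real m) *\<^sub>R \<nu> + z"
        unfolding T_def by auto
      have "\<nu> \<bullet> \<nu> = 1" using \<nu> by (simp add: norm_eq_1)
      then have "(3 * s / real m) * (real k - real l) = (z - c) \<bullet> \<nu> - (y - c) \<bullet> \<nu>"
        using arg_cong[OF yz(3), of "\<lambda>x. x \<bullet> \<nu>"] by (simp add: inner_add_left inner_diff_left algebra_simps diff_divide_distrib)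
      then have "\<bar>(3 * s / real m) * (real k - real l)\<bar> \<le> 2 * (s / real m)"
        using yz(1,2) unfolding A_def by auto
      moreover have "\<bar>real k - real l\<bar> \<ge> 1" using kl by linarith
      then have "(3 * s / real m) * 1 \<le> \<bar>(3 * s / real m) * (real k - real l)\<bar>"
        using s m unfolding abs_mult by (intro mult_mono) auto
      moreover have "s / real m > 0" using s m by simp
      ultimately show False by simp
    qed
  qed
  have "real m * measure lebesgue A = (\<Sum>k<m. measure lebesgue (T k))" by (simp add: T)
  also have "\<dots> = measure lebesgue (\<Union>k<m. T k)"
    using fmeasurableD[OF T(1)] fmeasurableD2[OF T(1)] by (intro measure_finite_Union[symmetric] dis) auto
  also have "\<dots> \<le> measure lebesgue (ball c ((L + 4) * s))"
  proof (rule measure_mono_fmeasurable)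
    show "(\<Union>k<m. T k) \<subseteq> ball c ((L + 4) * s)"
    proof (rule UN_least)
      fix k :: nat assume "k \<in> {..<m}"
      then have "real k / real m \<le> 1" using m by simp
      then have k: "3 * s * (real k / real m) \<le> 3 * s * 1" using s by (intro mult_left_mono) auto
      show "T k \<subseteq> ball c ((L + 4) * s)"
      proof
        fix x assume "x \<in> T k"
        then obtain y where y: "y \<in> A" "x = (3 * s * real k / real m) *\<^sub>R \<nu> + y" by (auto simp: T_def)
        have "norm (x - c) \<le> norm ((3 * s * real k / real m) *\<^sub>R \<nu>) + norm (y - c)"
          unfolding y(2) using norm_triangle_ineq[of "(3 * s * real k / real m) *\<^sub>R \<nu>" "y - c"] by (simp add: algebra_simps)
        also have "norm ((3 * s * real k / real m) *\<^sub>R \<nu>) \<le> 3 * s" using k s m \<nu> by simp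
        also have "norm (y - c) \<le> L * s" using y(1) by (simp add: A_def dist_norm norm_minus_commute)
        finally show "x \<in> ball c ((L + 4) * s)" using s by (simp add: dist_norm norm_minus_commute distrib_right)
      qed
    qed
    show "(\<Union>k<m. T k) \<in> sets lebesgue" using fmeasurableD[OF T(1)] by (intro sets.finite_UN) auto
  qed simp
  finally show "real m * measure lebesgue A \<le> measure lebesgue (ball c ((L + 4) * s))" .
qed

text \<open>A non-injective endomorphism is not surjective, so its range lies in a
  hyperplane.\<close>

lemma not_inj_imp_normal:
  fixes D :: "'a::euclidean_space \<Rightarrow> 'a"
  assumes "linear D" "\<not> inj D"
  obtains \<nu> where "norm \<nu> = 1" "\<forall>v. D v \<bullet> \<nu> = 0"
proof -
  have "range D \<noteq> UNIV" using assms linear_surjective_imp_injective by blast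
  moreover have "span (range D) = range D"
    using assms(1) by (simp add: span_eq_iff linear_subspace_image)
  ultimately obtain a where a: "a \<noteq> 0" "\<forall>x\<in>range D. a \<bullet> x = 0"
    using span_not_UNIV_orthogonal[of "range D"] by metis
  show ?thesis
  proof (rule that[of "a /\<^sub>R norm a"])
    show "\<forall>v. D v \<bullet> (a /\<^sub>R norm a) = 0" using a(2) by (simp add: inner_commute)
  qed (use a in simp)
qed

text \<open>A Sard argument: near a singular point, \<open>J\<close> sends a small ball into a thin
  slab along a hyperplane that contains the range of the derivative, and the slab has at most
  \<open>K / m\<close> times the measure of the ball. Vitali's lemma sums these bounds, and
  \<open>m\<close> is arbitrarily large.\<close>

lemma negligible_singular_image:
  fixes J :: "'a::euclidean_space \<Rightarrow> 'a"
  assumes L: "\<And>x y. norm (J x - J y) \<le> L * norm (x - y)" "0 \<le> L"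
  shows "negligible (J ` {z. \<exists>D. (J has_derivative D) (at z) \<and> \<not> inj D})"
proof -
  define S where "S = {z. \<exists>D. (J has_derivative D) (at z) \<and> \<not> inj D}"
  have "negligible (J ` (S \<inter> ball 0 R))" if R: "R > 0" for R
    unfolding negligible_outer_le
  proof (intro allI impI)
    fix e :: real assume e: "0 < e"
    define U where "U = ball (0::'a) (R + 1)"
    \<comment> \<open>The factor 5 comes from Vitali's enlargement, \<open>L + 4\<close> from
      \<open>measure_slab_le\<close>.\<close>
    define K where "K = (5 * (L + 4)) ^ DIM('a)"
    have K: "K > 0" using L by (simp add: K_def)
    obtain m0 :: nat where m0: "K * measure lebesgue U / e < real m0" using reals_Archimedean2 by blast
    define m where "m = Suc m0"
    have m: "m > 0" "K / real m * measure lebesgue U \<le> e"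
    proof -
      have "K * measure lebesgue U / e < real m" using m0 by (simp add: m_def)
      then have "K * measure lebesgue U < real m * e" using e by (simp add: pos_divide_less_eq)
      then show "K / real m * measure lebesgue U \<le> e" by (simp add: m_def pos_divide_le_eq mult.commute)
    qed (simp add: m_def)
    define P where "P = (\<lambda>z r A. 0 < r \<and> r \<le> 1 \<and> ball z r \<subseteq> U \<and> J ` ball z (5 * r) \<subseteq> A \<and> A \<in> lmeasurable \<and>
      measure lebesgue A \<le> K / real m * measure lebesgue (ball z r))"
    have "\<exists>r A. P z r A" if z: "z \<in> S \<inter> ball 0 R" for z
    proof -
      obtain D where D: "(J has_derivative D) (at z)" "\<not> inj D" using z by (auto simp: S_def)
      have lin: "linear D" using D(1) has_derivative_linear by blast
      obtain \<nu> where \<nu>: "norm \<nu> = 1" "\<forall>v. D v \<bullet> \<nu> = 0" by (rule not_inj_imp_normal[OF lin D(2)])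
      obtain d where d: "d > 0" "\<forall>y. norm (y - z) < d \<longrightarrow> norm (J y - J z - D (y - z)) \<le> 1 / real m * norm (y - z)"
        using D(1) m(1) unfolding has_derivative_at_alt by (metis of_nat_0_less_iff zero_less_divide_1_iff)
      \<comment> \<open>The enlarged ball stays where the expansion at \<open>z\<close> is valid,
        and the ball itself stays inside \<open>U\<close>.\<close>
      define r where "r = min (d / 5) (min 1 (R - norm z))"
      have "norm z < R" using z by simp
      then have r: "0 < r" "r \<le> 1" "5 * r \<le> d" "r \<le> R - norm z" using d(1) by (auto simp: r_def min_def)
      define A where "A = {y \<in> cball (J z) (L * (5 * r)). \<bar>(y - J z) \<bullet> \<nu>\<bar> \<le> (5 * r) / real m}"
      have A: "A \<in> lmeasurable" "real m * measure lebesgue A \<le> measure lebesgue (ball (J z) ((L + 4) * (5 * r)))"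
        unfolding A_def using measure_slab_le[OF \<nu>(1) _ L(2) m(1), of "5 * r" "J z"] r(1) by auto
      have "J ` ball z (5 * r) \<subseteq> A"
      proof (rule image_subsetI)
        fix y assume "y \<in> ball z (5 * r)"
        then have y: "norm (y - z) < 5 * r" by (simp add: dist_norm norm_minus_commute)
        have "norm (J y - J z) \<le> L * (5 * r)"
          using L(1)[of y z] mult_left_mono[OF less_imp_le[OF y] L(2)] by linarith
        moreover have "\<bar>(J y - J z) \<bullet> \<nu>\<bar> \<le> (5 * r) / real m"
        proof -
          have "(J y - J z) \<bullet> \<nu> = (J y - J z - D (y - z)) \<bullet> \<nu>" using \<nu>(2) by (simp add: inner_diff_left)
          also have "\<bar>\<dots>\<bar> \<le> norm (J y - J z - D (y - z))"
            using Cauchy_Schwarz_ineq2[of "J y - J z - D (y - z)" \<nu>] \<nu>(1) by simp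
          also have "\<dots> \<le> 1 / real m * norm (y - z)" using d(2) y r(3) by auto
          also have "\<dots> \<le> 1 / real m * (5 * r)" using y by (intro mult_left_mono) auto
          finally show ?thesis by simp
        qed
        ultimately show "J y \<in> A" by (simp add: A_def dist_norm norm_minus_commute)
      qed
      moreover have "ball z r \<subseteq> U"
      proof
        fix y assume "y \<in> ball z r"
        then have "norm (y - z) < r" by (simp add: dist_norm norm_minus_commute)
        then show "y \<in> U" using norm_triangle_ineq[of z "y - z"] r(4) by (simp add: U_def)
      qed
      moreover have "measure lebesgue A \<le> K / real m * measure lebesgue (ball z r)"
      proof -
        have "measure lebesgue (ball (J z) ((5 * (L + 4)) * r)) = K * measure lebesgue (ball z r)"
          unfolding K_def using L(2) r(1) by (intro measure_ball_scale) auto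
        moreover have "(L + 4) * (5 * r) = (5 * (L + 4)) * r" by simp
        ultimately have "real m * measure lebesgue A \<le> K * measure lebesgue (ball z r)" using A(2) by (simp only:)
        then show ?thesis using m(1) by (simp only: times_divide_eq_left pos_le_divide_eq of_nat_0_less_iff mult.commute)
      qed
      ultimately show ?thesis unfolding P_def using A(1) r(1,2) by blast
    qed
    then obtain r A where rA: "\<And>z. z \<in> S \<inter> ball 0 R \<Longrightarrow> P z (r z) (A z)" by metis
    have r: "0 < r z \<and> r z \<le> 1 \<and> ball z (r z) \<subseteq> U" if "z \<in> S \<inter> ball 0 R" for z
      using rA[OF that] unfolding P_def by blast
    have UL: "U \<in> lmeasurable" by (simp add: U_def)
    obtain C where C: "countable C" "C \<subseteq> S \<inter> ball 0 R" "disjoint_family_on (\<lambda>x. ball x (r x)) C"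
      "S \<inter> ball 0 R \<subseteq> (\<Union>x\<in>C. ball x (5 * r x))"
      "\<forall>F. finite F \<longrightarrow> F \<subseteq> C \<longrightarrow> (\<Sum>x\<in>F. measure lebesgue (ball x (r x))) \<le> measure lebesgue U"
      by (rule Vitali_disjoint_balls[OF r UL])
    have AC: "J ` ball z (5 * r z) \<subseteq> A z" "A z \<in> lmeasurable"
      "measure lebesgue (A z) \<le> K / real m * measure lebesgue (ball z (r z))" if "z \<in> C" for z
      using rA[of z] that C(2) unfolding P_def by blast+
    have b: "measure lebesgue (\<Union>z\<in>F. A z) \<le> e" if F: "F \<subseteq> C" "finite F" for F
    proof -
      have "measure lebesgue (\<Union>z\<in>F. A z) \<le> (\<Sum>z\<in>F. measure lebesgue (A z))"
        using F AC(2) by (intro measure_UNION_le fmeasurableD) auto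
      also have "\<dots> \<le> (\<Sum>z\<in>F. K / real m * measure lebesgue (ball z (r z)))"
        using F AC(3) by (intro sum_mono) auto
      also have "\<dots> = K / real m * (\<Sum>z\<in>F. measure lebesgue (ball z (r z)))" by (simp add: sum_distrib_left)
      also have "\<dots> \<le> K / real m * measure lebesgue U" using F C(5) K by (intro mult_left_mono) auto
      finally show ?thesis using m(2) by linarith
    qed
    show "\<exists>T. J ` (S \<inter> ball 0 R) \<subseteq> T \<and> T \<in> lmeasurable \<and> measure lebesgue T \<le> e"
    proof (intro exI conjI)
      show "J ` (S \<inter> ball 0 R) \<subseteq> (\<Union>z\<in>C. A z)"
      proof (rule image_subsetI)
        fix y assume "y \<in> S \<inter> ball 0 R"
        then obtain z where "z \<in> C" "y \<in> ball z (5 * r z)" using C(4) by blast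
        then show "J y \<in> (\<Union>z\<in>C. A z)" using AC(1) by blast
      qed
      show "(\<Union>z\<in>C. A z) \<in> lmeasurable" by (rule fmeasurable_UN_bound[OF C(1) AC(2) b])
      show "measure lebesgue (\<Union>z\<in>C. A z) \<le> e" by (rule measure_UN_bound[OF C(1) AC(2) b])
    qed
  qed
  then have "negligible (\<Union>n. J ` (S \<inter> ball 0 (real (Suc n))))"
    by (intro negligible_countable_Union) (auto simp del: of_nat_Suc)
  moreover have "J ` S \<subseteq> (\<Union>n. J ` (S \<inter> ball 0 (real (Suc n))))"
  proof (rule image_subsetI)
    fix z assume z: "z \<in> S"
    obtain n where "norm z < real n" using reals_Archimedean2 by blast
    then have "z \<in> S \<inter> ball 0 (real (Suc n))" using z by simp
    then show "J z \<in> (\<Union>n. J ` (S \<inter> ball 0 (real (Suc n))))" by blast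
  qed
  ultimately show ?thesis unfolding S_def by (rule negligible_subset)
qed

text \<open>A nearby point \<open>y\<close> with a different value would violate monotonicity against the many points
  \<open>q\<close> in the direction of \<open>M y - M x\<close> at which \<open>M\<close> is close to \<open>M x\<close>.\<close>

lemma monotone_continuous_at_approximate_continuity:
  fixes M :: "'a::euclidean_space \<Rightarrow> 'a"
  assumes mono: "\<And>x y. x \<in> E \<Longrightarrow> y \<in> E \<Longrightarrow> 0 \<le> (M y - M x) \<bullet> (y - x)"
    and null: "negligible (ball a R - E)" and x: "x \<in> E" "x \<in> ball a R"
    and ac: "\<forall>\<eta>>0. \<forall>c>0. \<exists>d>0. \<forall>r. 0 < r \<longrightarrow> r < d \<longrightarrow>
      measure lebesgue {y\<in>ball x r. \<eta> \<le> norm (M y - M x)} \<le> c * measure lebesgue (ball x r)"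
    and Mm: "M \<in> borel_measurable lebesgue"
    and \<eta>: "0 < \<eta>"
  shows "\<exists>d>0. \<forall>y\<in>E. norm (y - x) < d \<longrightarrow> norm (M y - M x) \<le> 3 * \<eta>"
proof -
  \<comment> \<open>\<open>ball q0 (\<rho> / 4)\<close> has \<open>(1/8) ^ DIM('a)\<close> times the
    volume of \<open>ball x (2 * \<rho>)\<close>; with half of this fraction the bad points cannot
    fill it.\<close>
  define c :: real where "c = (1/8) ^ DIM('a) / 2"
  have c: "c > 0" by (simp add: c_def)
  obtain d where d: "d > 0" "\<forall>r. 0 < r \<longrightarrow> r < d \<longrightarrow>
      measure lebesgue {y\<in>ball x r. \<eta> \<le> norm (M y - M x)} \<le> c * measure lebesgue (ball x r)"
    using ac \<eta> c by blast
  obtain d' where d': "d' > 0" "ball x d' \<subseteq> ball a R" using x(2) openE open_ball by blast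
  define \<rho> where "\<rho> = min d d' / 3"
  have \<rho>: "\<rho> > 0" "2 * \<rho> < d" "2 * \<rho> < d'" using d(1) d'(1) by (auto simp: \<rho>_def min_def)
  have "norm (M y - M x) \<le> 3 * \<eta>" if y: "y \<in> E" "norm (y - x) < \<rho> / 4" for y
  proof (cases "M y = M x")
    case False
    define w where "w = M y - M x"
    define u where "u = w /\<^sub>R norm w"
    have w0: "norm w > 0" using False by (simp add: w_def)
    have u: "norm u = 1" "w \<bullet> u = norm w"
      using w0 by (auto simp: u_def power2_norm_eq_inner[symmetric] power2_eq_square)
    \<comment> \<open>Seen from a point \<open>q\<close> near \<open>q0\<close>, the point
      \<open>y\<close> lies roughly in the direction \<open>- u\<close>, so a large \<open>w\<close>
      would make the monotonicity product of \<open>q\<close> and \<open>y\<close> negative.\<close>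
    define q0 where "q0 = x + \<rho> *\<^sub>R u"
    have sub: "ball q0 (\<rho> / 4) \<subseteq> ball x (2 * \<rho>)"
    proof
      fix q assume "q \<in> ball q0 (\<rho> / 4)"
      then have "norm (q - q0) < \<rho> / 4" by (simp add: dist_norm norm_minus_commute)
      moreover have "norm (q - x) \<le> norm (q - q0) + norm (\<rho> *\<^sub>R u)"
        using norm_triangle_ineq[of "q - q0" "\<rho> *\<^sub>R u"] by (simp add: q0_def)
      ultimately show "q \<in> ball x (2 * \<rho>)" using \<rho>(1) u(1) by (simp add: dist_norm norm_minus_commute)
    qed
    define Bad where "Bad = {y\<in>ball x (2 * \<rho>). \<eta> \<le> norm (M y - M x)}"
    have Bad: "Bad \<in> lmeasurable"
    proof -
      have "(\<lambda>y. norm (M y - M x)) \<in> borel_measurable lebesgue" using Mm by measurable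
      then show ?thesis unfolding Bad_def by (rule lmeasurable_ball_Collect)
    qed
    have "\<not> ball q0 (\<rho> / 4) \<subseteq> Bad \<union> (ball a R - E)"
    proof
      assume *: "ball q0 (\<rho> / 4) \<subseteq> Bad \<union> (ball a R - E)"
      have N: "ball a R - E \<in> null_sets lebesgue" using null by (simp add: negligible_iff_null_sets)
      have "measure lebesgue (ball q0 (\<rho> / 4)) \<le> measure lebesgue (Bad \<union> (ball a R - E))"
        using * Bad negligible_imp_measurable[OF null]
        by (intro measure_mono_fmeasurable[OF *] fmeasurable.Un) auto
      also have "\<dots> = measure lebesgue Bad" by (intro measure_Un_null_set fmeasurableD Bad N)
      also have "\<dots> \<le> c * measure lebesgue (ball x (2 * \<rho>))" unfolding Bad_def using d(2) \<rho> by simp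
      also have "\<dots> = (1/8) ^ DIM('a) * measure lebesgue (ball x (2 * \<rho>)) / 2" by (simp add: c_def)
      also have "(1/8) ^ DIM('a) * measure lebesgue (ball x (2 * \<rho>)) = measure lebesgue (ball q0 ((1/8) * (2 * \<rho>)))"
        using \<rho>(1) by (intro measure_ball_scale[symmetric]) auto
      also have "(1/8) * (2 * \<rho>) = \<rho> / 4" by simp
      finally have "measure lebesgue (ball q0 (\<rho> / 4)) \<le> 0" by simp
      then show False using \<rho>(1) by (simp add: measure_le_0_iff)
    qed
    then obtain q where q: "q \<in> ball q0 (\<rho> / 4)" "q \<notin> Bad" "q \<notin> ball a R - E" by blast
    have "q \<in> ball a R" using q(1) sub d'(2) subset_ball[of "2 * \<rho>" d' x] \<rho>(3) by (meson less_imp_le subsetD)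
    then have qE: "q \<in> E" using q(3) by blast
    have Mq: "norm (M q - M x) < \<eta>" using q(1,2) sub unfolding Bad_def by (auto simp: not_le)
    \<comment> \<open>\<open>q - y\<close> is \<open>\<rho> *\<^sub>R u\<close> up to an error of
      norm at most \<open>\<rho> / 2\<close>, so half of \<open>\<rho> * norm w\<close> survives;
      this produces the factor 3 in the conclusion.\<close>
    define err where "err = (q - q0) - (y - x)"
    have "norm (q - q0) < \<rho> / 4" using q(1) by (simp add: dist_norm norm_minus_commute)
    then have err: "norm err \<le> \<rho> / 2"
      using y(2) norm_triangle_ineq4[of "q - q0" "y - x"] by (simp add: err_def)
    have qy: "q - y = \<rho> *\<^sub>R u + err" by (simp add: err_def q0_def)
    have "0 \<le> (M q - M y) \<bullet> (q - y)" by (rule mono[OF y(1) qE])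
    also have "M q - M y = (M q - M x) - w" by (simp add: w_def)
    also have "((M q - M x) - w) \<bullet> (q - y) = (M q - M x) \<bullet> (q - y) - \<rho> * norm w - w \<bullet> err"
      unfolding inner_diff_left by (simp add: qy inner_add_right u(2))
    finally have 1: "\<rho> * norm w \<le> (M q - M x) \<bullet> (q - y) - w \<bullet> err" by simp
    have 2: "(M q - M x) \<bullet> (q - y) \<le> \<eta> * (3/2 * \<rho>)"
    proof -
      have "norm (q - y) \<le> 3/2 * \<rho>"
        unfolding qy using norm_triangle_ineq[of "\<rho> *\<^sub>R u" err] err u(1) \<rho>(1) by simp
      then have "norm (M q - M x) * norm (q - y) \<le> \<eta> * (3/2 * \<rho>)"
        using Mq \<eta> by (intro mult_mono) auto
      then show ?thesis using Cauchy_Schwarz_ineq2[of "M q - M x" "q - y"] by linarith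
    qed
    have 3: "- (w \<bullet> err) \<le> norm w * (\<rho> / 2)"
      using Cauchy_Schwarz_ineq2[of w err] mult_left_mono[OF err norm_ge_zero[of w]] by linarith
    from 1 2 3 have "\<rho> * norm w \<le> \<rho> * (3 * \<eta>)" by (simp add: algebra_simps)
    then show ?thesis using \<rho>(1) by (simp add: w_def)
  qed (use \<eta> in simp)
  then show ?thesis using \<rho>(1) by (intro exI[of _ "\<rho> / 4"]) auto
qed

section \<open>Almost everywhere differentiability of monotone maps\<close>

text \<open>The resolvent \<open>J\<close>, \<open>J (x + M x) = x\<close>, of a monotone map is Lipschitz (Minty's trick). Extending it to
  the whole space, almost every \<open>x\<close> is the image of a point at which \<open>J\<close> has an invertible derivative.\<close>

lemma resolvent_extension:
  fixes M :: "'a::euclidean_space \<Rightarrow> 'a"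
  assumes mono: "\<And>x y. x \<in> E \<Longrightarrow> y \<in> E \<Longrightarrow> 0 \<le> (M y - M x) \<bullet> (y - x)"
    and E: "bounded E" "E \<noteq> {}"
  obtains J where "\<forall>v w. norm (J v - J w) \<le> real DIM('a) * norm (v - w)" "\<forall>x\<in>E. J (x + M x) = x"
    "AE w in lebesgue. J differentiable (at w)"
proof -
  define W where "W = (\<lambda>x. x + M x)"
  have contr: "norm (x - y) \<le> norm (W x - W y)" if "x \<in> E" "y \<in> E" for x y
  proof (cases "x = y")
    case False
    have "(norm (x - y))\<^sup>2 \<le> (W x - W y) \<bullet> (x - y)"
      using mono[OF that(2,1)] by (simp add: W_def power2_norm_eq_inner inner_diff_left inner_add_left)
    also have "\<dots> \<le> norm (W x - W y) * norm (x - y)" by (rule norm_cauchy_schwarz)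
    finally show ?thesis using False by (simp add: power2_eq_square)
  qed simp
  \<comment> \<open>McShane's extension of the \<open>b\<close>-th coordinate of the inverse of
    \<open>W\<close>, with Lipschitz constant 1. Extending coordinate by coordinate accounts for the
    factor \<open>DIM('a)\<close>.\<close>
  define F where "F = (\<lambda>b w. INF x\<in>E. x \<bullet> b + norm (w - W x))"
  obtain R where R: "\<forall>x\<in>E. norm x \<le> R" using E(1) bounded_iff by blast
  have bdd: "bdd_below ((\<lambda>x. x \<bullet> b + norm (w - W x)) ` E)" if b: "b \<in> Basis" for b w
  proof (rule bdd_belowI2)
    fix x assume "x \<in> E"
    then have "\<bar>x \<bullet> b\<bar> \<le> R" using Basis_le_norm[OF b, of x] R by force
    then show "- R \<le> x \<bullet> b + norm (w - W x)" using norm_ge_zero[of "w - W x"] by linarith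
  qed
  have F_le: "F b v \<le> F b w + norm (v - w)" if b: "b \<in> Basis" for b v w
  proof -
    have "F b v - norm (v - w) \<le> F b w"
      unfolding F_def
    proof (rule cINF_greatest[OF E(2)])
      fix x assume x: "x \<in> E"
      have "(INF x\<in>E. x \<bullet> b + norm (v - W x)) \<le> x \<bullet> b + norm (v - W x)"
        by (rule cINF_lower[OF bdd[OF b] x])
      also have "norm (v - W x) \<le> norm (v - w) + norm (w - W x)"
        using norm_triangle_ineq[of "v - w" "w - W x"] by simp
      finally show "(INF x\<in>E. x \<bullet> b + norm (v - W x)) - norm (v - w) \<le> x \<bullet> b + norm (w - W x)" by simp
    qed
    then show ?thesis by simp
  qed
  have F_lip: "\<bar>F b v - F b w\<bar> \<le> 1 * norm (v - w)" if b: "b \<in> Basis" for b v w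
    using F_le[OF b, of v w] F_le[OF b, of w v] norm_minus_commute[of v w] by linarith
  have F_W: "F b (W x) = x \<bullet> b" if b: "b \<in> Basis" and x: "x \<in> E" for b x
  proof (rule antisym)
    show "F b (W x) \<le> x \<bullet> b" using cINF_lower[OF bdd[OF b, of "W x"] x] by (simp add: F_def)
    show "x \<bullet> b \<le> F b (W x)"
      unfolding F_def
    proof (rule cINF_greatest[OF E(2)])
      fix y assume y: "y \<in> E"
      have "x \<bullet> b - y \<bullet> b \<le> norm (x - y)" using Basis_le_norm[OF b, of "x - y"] by (simp add: inner_diff_left)
      also have "\<dots> \<le> norm (W x - W y)" by (rule contr[OF x y])
      finally show "x \<bullet> b \<le> y \<bullet> b + norm (W x - W y)" by simp
    qed
  qed
  define J where "J = (\<lambda>w. \<Sum>b\<in>Basis. F b w *\<^sub>R b)"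
  have Jb: "J w \<bullet> b = F b w" if "b \<in> Basis" for w b
    using that by (simp add: J_def)
  show ?thesis
  proof (rule that[of J])
    show "\<forall>v w. norm (J v - J w) \<le> real DIM('a) * norm (v - w)"
    proof (intro allI)
      fix v w
      have "norm (J v - J w) \<le> (\<Sum>b\<in>Basis. \<bar>(J v - J w) \<bullet> b\<bar>)" by (rule norm_le_l1)
      also have "\<dots> \<le> (\<Sum>b\<in>(Basis::'a set). norm (v - w))"
        using F_lip by (intro sum_mono) (simp add: inner_diff_left Jb)
      finally show "norm (J v - J w) \<le> real DIM('a) * norm (v - w)" by simp
    qed
    show "\<forall>x\<in>E. J (x + M x) = x"
    proof
      fix x assume x: "x \<in> E"
      show "J (x + M x) = x"
        by (rule euclidean_eqI) (use F_W[OF _ x] in \<open>simp add: Jb W_def\<close>)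
    qed
    have "AE w in lebesgue. \<forall>b\<in>Basis. F b differentiable (at w)"
      by (intro AE_finite_allI finite_Basis Rademacher_real[OF F_lip])
    then show "AE w in lebesgue. J differentiable (at w)"
    proof eventually_elim
      case (elim w)
      have "(\<lambda>w. F b w *\<^sub>R b) differentiable (at w)" if "b \<in> Basis" for b
        using elim that by (intro differentiable_scaleR) auto
      then show ?case unfolding J_def by (intro differentiable_sum) auto
    qed
  qed
qed

text \<open>For almost every \<open>x\<close> in the ball, \<open>J\<close> has an injective
  derivative \<open>D'\<close> at \<open>z = x + M x\<close>: a Lipschitz map sends the null set of
  bad \<open>z\<close> to a null set, and singular points have a negligible image. If
  \<open>B\<close> inverts \<open>D'\<close> and \<open>w = y + M y\<close>, then
  \<open>w - z\<close> is \<open>B (y - x)\<close> to first order, so the derivative of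
  \<open>M\<close> is \<open>B v - v\<close>. Continuity of \<open>M\<close> at \<open>x\<close>
  brings \<open>w\<close> into the range of the expansion.\<close>

theorem monotone_differentiable_AE:
  fixes M :: "'a::euclidean_space \<Rightarrow> 'a"
  assumes mono: "\<And>x y. x \<in> D \<Longrightarrow> y \<in> D \<Longrightarrow> norm x < R \<Longrightarrow> norm y < R \<Longrightarrow> 0 \<le> (M y - M x) \<bullet> (y - x)"
    and D: "AE x in lebesgue. x \<in> D" and Mm: "M \<in> borel_measurable lebesgue"
  shows "AE x in lebesgue. norm x < R \<longrightarrow> (\<exists>A. linear A \<and> (\<forall>e>0. \<exists>d>0. \<forall>y\<in>D. norm (y - x) < d \<longrightarrow>
      norm (M y - M x - A (y - x)) \<le> e * norm (y - x)))"
proof (cases "D \<inter> ball 0 R = {}")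
  case True
  show ?thesis using D by eventually_elim (use True in auto)
next
  case False
  define E where "E = D \<inter> ball 0 R"
  have E: "bounded E" "E \<noteq> {}" using False by (auto simp: E_def)
  have monoE: "0 \<le> (M y - M x) \<bullet> (y - x)" if "x \<in> E" "y \<in> E" for x y
    using that by (intro mono) (auto simp: E_def)
  obtain J where J: "\<forall>v w. norm (J v - J w) \<le> real DIM('a) * norm (v - w)" "\<forall>x\<in>E. J (x + M x) = x"
    "AE w in lebesgue. J differentiable (at w)"
    by (rule resolvent_extension[OF monoE E])
  obtain N0 where N0: "negligible N0" "{w. \<not> J differentiable (at w)} \<subseteq> N0"
    using J(3) unfolding eventually_ae_filter_negligible by blast
  have n1: "negligible (J ` N0)"
  proof (rule negligible_locally_Lipschitz_image[OF order_refl N0(1)])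
    fix x show "\<exists>T B. open T \<and> x \<in> T \<and> (\<forall>y\<in>N0 \<inter> T. norm (J y - J x) \<le> B * norm (y - x))"
      using J(1) by (intro exI[of _ UNIV] exI[of _ "real DIM('a)"]) auto
  qed
  have n2: "negligible (J ` {z. \<exists>D. (J has_derivative D) (at z) \<and> \<not> inj D})"
    by (rule negligible_singular_image[of J "real DIM('a)"]) (use J(1) in auto)
  have "negligible (J ` N0 \<union> J ` {z. \<exists>D. (J has_derivative D) (at z) \<and> \<not> inj D})"
    using n1 n2 by simp
  then have AE1: "AE x in lebesgue. x \<notin> J ` N0 \<union> J ` {z. \<exists>D. (J has_derivative D) (at z) \<and> \<not> inj D}"
    unfolding eventually_ae_filter_negligible by blast
  have null: "negligible (ball 0 R - E)"
  proof -
    obtain N where "negligible N" "{x. x \<notin> D} \<subseteq> N" using D unfolding eventually_ae_filter_negligible by blast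
    then show ?thesis by (elim negligible_subset) (auto simp: E_def)
  qed
  show ?thesis
    using D AE1 approximately_continuous_AE[OF Mm]
  proof eventually_elim
    case (elim x)
    show ?case
    proof
      assume xR: "norm x < R"
      have x: "x \<in> E" "x \<in> ball 0 R" using xR elim(1) by (auto simp: E_def)
      define z where "z = x + M x"
      have Jz: "J z = x" using J(2) x(1) by (simp add: z_def)
      then have "z \<notin> N0" using elim(2) by blast
      then have "J differentiable (at z)" using N0(2) by blast
      then obtain D' where D': "(J has_derivative D') (at z)" unfolding differentiable_def by blast
      have "inj D'" using elim(2) Jz D' by blast
      moreover have "linear D'" using D' has_derivative_linear by blast
      ultimately obtain B where B: "linear B" "B \<circ> D' = id" using linear_injective_left_inverse by blast
      obtain K where K: "K > 0" "\<And>v. norm (B v) \<le> K * norm v" using linear_bounded_pos[OF B(1)] by blast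
      have cont: "\<exists>d>0. \<forall>y\<in>E. norm (y - x) < d \<longrightarrow> norm (M y - M x) \<le> 3 * \<eta>" if "\<eta> > 0" for \<eta>
        by (rule monotone_continuous_at_approximate_continuity[OF monoE null x elim(3) Mm that])
      have "\<exists>d>0. \<forall>y\<in>D. norm (y - x) < d \<longrightarrow> norm (M y - M x - (B (y - x) - (y - x))) \<le> e * norm (y - x)"
        if e: "e > 0" for e
      proof -
        \<comment> \<open>The first bound lets half of \<open>norm (w - z)\<close> absorb the
          remainder, whence \<open>norm (w - z) \<le> 2 * (K * norm (y - x))\<close>; the second
          turns the remainder into \<open>e * norm (y - x)\<close>.\<close>
        define \<epsilon> where "\<epsilon> = min (1 / (2 * K)) (e / (2 * K\<^sup>2))"
        have \<epsilon>: "\<epsilon> > 0" using e K(1) by (simp add: \<epsilon>_def)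
        have \<epsilon>1: "K * \<epsilon> \<le> 1 / 2"
        proof -
          have "\<epsilon> \<le> 1 / (2 * K)" by (simp add: \<epsilon>_def)
          then have "K * \<epsilon> \<le> K * (1 / (2 * K))" using K(1) by (intro mult_left_mono) auto
          then show ?thesis using K(1) by simp
        qed
        have \<epsilon>2: "2 * K\<^sup>2 * \<epsilon> \<le> e"
        proof -
          have "\<epsilon> \<le> e / (2 * K\<^sup>2)" by (simp add: \<epsilon>_def)
          then have "2 * K\<^sup>2 * \<epsilon> \<le> 2 * K\<^sup>2 * (e / (2 * K\<^sup>2))" using K(1) by (intro mult_left_mono) auto
          then show ?thesis using K(1) by simp
        qed
        obtain d1 where d1: "d1 > 0" "\<forall>w. norm (w - z) < d1 \<longrightarrow> norm (J w - J z - D' (w - z)) \<le> \<epsilon> * norm (w - z)"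
          using D' \<epsilon> unfolding has_derivative_at_alt by blast
        \<comment> \<open>Here \<open>3 * (d1 / 12) = d1 / 4\<close>, which together with
          \<open>norm (y - x) < d1 / 2\<close> keeps \<open>w\<close> within \<open>d1\<close> of
          \<open>z\<close>.\<close>
        obtain d2 where d2: "d2 > 0" "\<forall>y\<in>E. norm (y - x) < d2 \<longrightarrow> norm (M y - M x) \<le> 3 * (d1 / 12)"
          using cont[of "d1 / 12"] d1(1) by auto
        define d where "d = min d2 (min (d1 / 2) (R - norm x))"
        have d: "d > 0" using d1(1) d2(1) xR by (simp add: d_def)
        have "norm (M y - M x - (B (y - x) - (y - x))) \<le> e * norm (y - x)"
          if y: "y \<in> D" "norm (y - x) < d" for y
        proof -
          have "norm y < R" using y(2) norm_triangle_ineq[of x "y - x"] by (simp add: d_def)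
          then have yE: "y \<in> E" using y(1) by (simp add: E_def)
          define w where "w = y + M y"
          have wz: "w - z = (y - x) + (M y - M x)" by (simp add: w_def z_def)
          have "norm (M y - M x) \<le> d1 / 4" using d2(2) yE y(2) by (auto simp: d_def)
          then have "norm (w - z) < d1"
            using y(2) norm_triangle_ineq[of "y - x" "M y - M x"] d1(1) by (simp add: wz d_def)
          moreover have "J w = y" using J(2) yE by (simp add: w_def)
          ultimately have rem: "norm (y - x - D' (w - z)) \<le> \<epsilon> * norm (w - z)" using d1(2) Jz by auto
          have "B (D' (w - z)) = w - z" using B(2) by (simp add: fun_eq_iff)
          then have "B (y - x) - (w - z) = B (y - x - D' (w - z))" by (simp add: linear_diff[OF B(1)])
          then have 1: "norm (B (y - x) - (w - z)) \<le> K * (\<epsilon> * norm (w - z))"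
            using K(2)[of "y - x - D' (w - z)"] mult_left_mono[OF rem less_imp_le[OF K(1)]] by simp
          have "K * (\<epsilon> * norm (w - z)) \<le> 1/2 * norm (w - z)"
            using mult_right_mono[OF \<epsilon>1 norm_ge_zero[of "w - z"]] by (simp add: mult.assoc)
          then have "norm (w - z) \<le> norm (B (y - x)) + 1/2 * norm (w - z)"
            using 1 norm_triangle_ineq4[of "B (y - x)" "B (y - x) - (w - z)"] by simp
          then have 2: "norm (w - z) \<le> 2 * (K * norm (y - x))" using K(2)[of "y - x"] by linarith
          have "M y - M x - (B (y - x) - (y - x)) = - (B (y - x) - (w - z))" by (simp add: wz)
          then have "norm (M y - M x - (B (y - x) - (y - x))) \<le> K * (\<epsilon> * norm (w - z))" using 1 by (simp only: norm_minus_cancel)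
          also have "\<dots> \<le> K * (\<epsilon> * (2 * (K * norm (y - x))))" using 2 K(1) \<epsilon> by (intro mult_left_mono) auto
          also have "\<dots> = (2 * K\<^sup>2 * \<epsilon>) * norm (y - x)" by (simp add: power2_eq_square mult_ac)
          also have "\<dots> \<le> e * norm (y - x)" by (intro mult_right_mono \<epsilon>2) auto
          finally show ?thesis .
        qed
        then show ?thesis using d by blast
      qed
      moreover have "linear (\<lambda>v. B v - v)" using B(1) by (intro linear_compose_sub linear_id[unfolded id_def])
      ultimately show "\<exists>A. linear A \<and> (\<forall>e>0. \<exists>d>0. \<forall>y\<in>D. norm (y - x) < d \<longrightarrow>
          norm (M y - M x - A (y - x)) \<le> e * norm (y - x))"
        by (intro exI[of _ "\<lambda>v. B v - v"]) auto
    qed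
  qed
qed

section \<open>h-monotone maps\<close>

lemma C1_lipschitz_cball:
  assumes "C1 f"
  obtains L where "0 \<le> L" "\<forall>x y. norm x \<le> R \<longrightarrow> norm y \<le> R \<longrightarrow> \<bar>f x - f y\<bar> \<le> L * norm (x - y)"
proof -
  have "locally_bounded (grad f)" by (intro continuous_locally_bounded C1_continuous_grad assms)
  then obtain B where B: "B > 0" "\<forall>x. norm x \<le> R \<longrightarrow> norm (grad f x) \<le> B" by (rule locally_boundedD)
  have "norm (f x - f y) \<le> B * norm (x - y)" if "norm x \<le> R" "norm y \<le> R" for x y
  proof (rule differentiable_bound[of "cball 0 R"])
    fix z assume z: "z \<in> cball (0::'a) R"
    show "(f has_derivative (\<lambda>v. grad f z \<bullet> v)) (at z within cball 0 R)"
      by (rule has_derivative_at_withinI[OF C1_has_derivative[OF assms]])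
    show "onorm (\<lambda>v. grad f z \<bullet> v) \<le> B"
    proof (rule onorm_bound)
      have "norm (grad f z) \<le> B" using B(2) z by simp
      then show "norm (grad f z \<bullet> v) \<le> B * norm v" for v
        using Cauchy_Schwarz_ineq2[of "grad f z" v] mult_right_mono[of "norm (grad f z)" B "norm v"] by simp
    qed (use B in simp)
  qed (use that in auto)
  then show ?thesis using B(1) by (intro that[of B]) auto
qed

lemma Ck_2_C1:
  assumes "Ck 2 h" shows "C1 h" and "C1 (\<lambda>x. frechet_derivative h (at x) v)"
proof -
  have "Ck (Suc (Suc 0)) h" using assms by (simp only: numeral_2_eq_2)
  then have d: "\<And>x. h differentiable (at x)"
    and d2: "\<And>v x. (\<lambda>x. frechet_derivative h (at x) v) differentiable (at x)"
    and c: "\<And>v w. continuous_on UNIV (\<lambda>x. frechet_derivative (\<lambda>x. frechet_derivative h (at x) v) (at x) w)"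
    by auto
  show 2: "C1 (\<lambda>x. frechet_derivative h (at x) v)" for v
  proof -
    have "continuous_on UNIV (grad (\<lambda>x. frechet_derivative h (at x) v))"
      unfolding grad_def by (intro continuous_intros c)
    then show ?thesis by (simp add: C1_def has_derivative_grad d2)
  qed
  have "continuous_on UNIV (grad h)"
    unfolding grad_def by (intro continuous_intros C1_continuous 2)
  then show "C1 h" by (simp add: C1_def has_derivative_grad d)
qed

lemma Ck_2_grad_lipschitz:
  fixes h :: "'a::euclidean_space \<Rightarrow> real"
  assumes "Ck 2 h"
  obtains L where "0 \<le> L" "\<forall>x y. norm x \<le> R \<longrightarrow> norm y \<le> R \<longrightarrow> norm (grad h x - grad h y) \<le> L * norm (x - y)"
proof -
  have "\<exists>L\<ge>0. \<forall>x y. norm x \<le> R \<longrightarrow> norm y \<le> R \<longrightarrow>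
      \<bar>frechet_derivative h (at x) b - frechet_derivative h (at y) b\<bar> \<le> L * norm (x - y)" for b
    by (rule C1_lipschitz_cball[OF Ck_2_C1(2)[OF assms], where R=R]) blast
  then obtain L where L: "\<And>b. 0 \<le> L b" "\<And>b x y. norm x \<le> R \<Longrightarrow> norm y \<le> R \<Longrightarrow>
      \<bar>frechet_derivative h (at x) b - frechet_derivative h (at y) b\<bar> \<le> L b * norm (x - y)" by metis
  have "norm (grad h x - grad h y) \<le> (\<Sum>b\<in>Basis. L b) * norm (x - y)" if "norm x \<le> R" "norm y \<le> R" for x y
  proof -
    have "norm (grad h x - grad h y) = norm (\<Sum>b\<in>Basis. (frechet_derivative h (at x) b - frechet_derivative h (at y) b) *\<^sub>R b)"
      by (simp add: grad_def sum_subtractf scaleR_left_diff_distrib)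
    also have "\<dots> \<le> (\<Sum>b\<in>Basis. norm ((frechet_derivative h (at x) b - frechet_derivative h (at y) b) *\<^sub>R b))"
      by (rule norm_sum)
    also have "\<dots> \<le> (\<Sum>b\<in>Basis. L b * norm (x - y))"
      using L(2)[OF that] by (intro sum_mono) simp
    finally show ?thesis by (simp add: sum_distrib_right)
  qed
  then show ?thesis by (intro that[of "\<Sum>b\<in>Basis. L b"]) (auto intro: sum_nonneg L(1))
qed

text \<open>The mean value inequality on the segment for \<open>h z - grad h x \<bullet> z\<close>,
  whose gradient there is at most \<open>L * norm w\<close>.\<close>

lemma Ck_2_quadratic_upper_bound:
  fixes h :: "'a::euclidean_space \<Rightarrow> real"
  assumes h: "Ck 2 h"
  obtains L where "0 \<le> L" "\<forall>x w. norm x \<le> R \<longrightarrow> norm (x + w) \<le> R \<longrightarrow> h (x + w) \<le> h x + grad h x \<bullet> w + L * (norm w)\<^sup>2"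
proof -
  obtain L where L: "0 \<le> L" "\<forall>x y. norm x \<le> R \<longrightarrow> norm y \<le> R \<longrightarrow> norm (grad h x - grad h y) \<le> L * norm (x - y)"
    by (rule Ck_2_grad_lipschitz[OF h])
  have "h (x + w) \<le> h x + grad h x \<bullet> w + L * (norm w)\<^sup>2" if x: "norm x \<le> R" "norm (x + w) \<le> R" for x w
  proof -
    let ?S = "closed_segment x (x + w)"
    have "norm ((h (x + w) - grad h x \<bullet> (x + w)) - (h x - grad h x \<bullet> x)) \<le> (L * norm w) * norm (x + w - x)"
    proof (rule differentiable_bound[of ?S])
      fix z assume z: "z \<in> ?S"
      have "((\<lambda>z. h z - grad h x \<bullet> z) has_derivative (\<lambda>v. grad h z \<bullet> v - grad h x \<bullet> v)) (at z)"
        by (intro has_derivative_diff C1_has_derivative Ck_2_C1 h has_derivative_inner_right has_derivative_ident)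
      then show "((\<lambda>z. h z - grad h x \<bullet> z) has_derivative (\<lambda>v. (grad h z - grad h x) \<bullet> v)) (at z within ?S)"
        unfolding inner_diff_left by (rule has_derivative_at_withinI)
      have "?S \<subseteq> cball 0 R" using x by (intro closed_segment_subset) auto
      then have "norm z \<le> R" using z by auto
      moreover have "norm (z - x) \<le> norm w" using segment_bound(1)[OF z] by simp
      ultimately have "norm (grad h z - grad h x) \<le> L * norm w"
        using L x(1) mult_left_mono[of "norm (z - x)" "norm w" L] by (meson order_trans)
      then show "onorm (\<lambda>v. (grad h z - grad h x) \<bullet> v) \<le> L * norm w"
      proof (intro onorm_bound)
        fix v assume *: "norm (grad h z - grad h x) \<le> L * norm w"
        show "norm ((grad h z - grad h x) \<bullet> v) \<le> L * norm w * norm v"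
          using Cauchy_Schwarz_ineq2[of "grad h z - grad h x" v] mult_right_mono[OF * norm_ge_zero[of v]] by simp
      qed (use L in simp)
    qed auto
    then show ?thesis by (simp add: inner_add_right power2_eq_square)
  qed
  then show ?thesis by (intro that[OF L(1)]) auto
qed

locale elliptic_homogeneous =
  fixes h :: "'a::euclidean_space \<Rightarrow> real" and p lam :: real
  assumes p: "p \<ge> 2"
    and C2: "Ck 2 h"
    and nonneg: "h x \<ge> 0"
    and hom: "s > 0 \<Longrightarrow> h (s *\<^sub>R x) = s powr p * h x"
    and lam: "0 < lam"
    and ellip: "norm x = 1 \<Longrightarrow> lam * (norm v)\<^sup>2 \<le> hess_form h x v"
begin

text \<open>If \<open>h\<close> vanished at a unit vector \<open>x\<close>, it would vanish on the whole ray through \<open>x\<close>, contradicting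
  the ellipticity in the direction of \<open>x\<close>.\<close>

lemma pos_on_sphere:
  assumes x: "norm x = 1" shows "h x > 0"
proof (rule ccontr)
  assume "\<not> h x > 0"
  then have hx: "h x = 0" using nonneg[of x] by simp
  define k where "k = (\<lambda>y. frechet_derivative h (at y) x)"
  have line: "((\<lambda>t. f (t *\<^sub>R x)) has_real_derivative grad f (s *\<^sub>R x) \<bullet> x) (at s)" if "C1 f" for f s
  proof -
    have "((\<lambda>t. t *\<^sub>R x) has_derivative (\<lambda>t. t *\<^sub>R x)) (at s)" by (auto intro!: derivative_eq_intros)
    from has_derivative_compose[OF this C1_has_derivative[OF that]]
    have "((\<lambda>t. f (t *\<^sub>R x)) has_derivative (\<lambda>t. grad f (s *\<^sub>R x) \<bullet> (t *\<^sub>R x))) (at s)" .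
    moreover have "(\<lambda>t. grad f (s *\<^sub>R x) \<bullet> (t *\<^sub>R x)) = (*) (grad f (s *\<^sub>R x) \<bullet> x)" by auto
    ultimately show ?thesis unfolding has_field_derivative_def by simp
  qed
  have zero: "grad f (s *\<^sub>R x) \<bullet> x = 0" if "C1 f" "\<And>t. t > 0 \<Longrightarrow> f (t *\<^sub>R x) = 0" "s > 0" for f s
  proof -
    have "((\<lambda>t. 0) has_real_derivative 0) (at s)" by simp
    then have "((\<lambda>t. f (t *\<^sub>R x)) has_real_derivative 0) (at s)"
      by (rule has_field_derivative_transform_within_open[where S="{0<..}"]) (use that in auto)
    then show ?thesis using line[OF that(1), of s] DERIV_unique by blast
  qed
  have "k (s *\<^sub>R x) = 0" if "s > 0" for s
  proof -
    have "k (s *\<^sub>R x) = grad h (s *\<^sub>R x) \<bullet> x"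
      unfolding k_def by (intro frechet_derivative_grad C1_differentiable Ck_2_C1 C2)
    also have "\<dots> = 0" using that by (intro zero Ck_2_C1 C2) (simp_all add: hom hx)
    finally show ?thesis .
  qed
  then have "grad k (1 *\<^sub>R x) \<bullet> x = 0"
    unfolding k_def by (intro zero Ck_2_C1 C2) auto
  moreover have "hess_form h x x = grad k x \<bullet> x"
    unfolding hess_form_def k_def by (intro frechet_derivative_grad C1_differentiable Ck_2_C1 C2)
  ultimately have "hess_form h x x = 0" by simp
  then show False using ellip[OF x, of x] x lam by simp
qed

lemma continuous: "continuous_on S h"
  by (intro C1_continuous Ck_2_C1 C2)

text \<open>The minimum of \<open>h\<close> on the unit sphere is positive by
  \<open>pos_on_sphere\<close>, and homogeneity spreads it along rays.\<close>

lemma lower_bound: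
  obtains c where "c > 0" "\<forall>x. x \<noteq> 0 \<longrightarrow> c * norm x powr p \<le> h x"
proof -
  have "sphere (0::'a) 1 \<noteq> {}" by simp
  then obtain x0 where x0: "x0 \<in> sphere 0 1" "\<forall>x\<in>sphere 0 1. h x0 \<le> h x"
    using continuous_attains_inf[OF compact_sphere _ continuous] by blast
  have "h x0 * norm x powr p \<le> h x" if "x \<noteq> 0" for x
  proof -
    have "h (norm x *\<^sub>R (x /\<^sub>R norm x)) = norm x powr p * h (x /\<^sub>R norm x)"
      using that by (intro hom) simp
    then have "h x = norm x powr p * h (x /\<^sub>R norm x)" using that by simp
    moreover have "h x0 \<le> h (x /\<^sub>R norm x)" using x0(2) that by simp
    then have "norm x powr p * h x0 \<le> norm x powr p * h (x /\<^sub>R norm x)" by (intro mult_left_mono) auto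
    ultimately show ?thesis by (simp only: mult.commute)
  qed
  moreover have "h x0 > 0" using x0(1) by (intro pos_on_sphere) simp
  ultimately show ?thesis using that by blast
qed

end

text \<open>The sets decrease to the empty set inside a ball of finite measure. They are used to
  find, near any prescribed position, a point at which \<open>t\<close> obeys a fixed bound.\<close>

lemma measurable_tail_small:
  fixes t :: "'a::euclidean_space \<Rightarrow> 'b::euclidean_space"
  assumes t: "t \<in> borel_measurable lebesgue" and e: "0 < e"
  obtains n :: nat where "measure lebesgue {y \<in> ball a R. real n < norm (t y)} < e"
    "{y \<in> ball a R. real n < norm (t y)} \<in> lmeasurable"
proof -
  define A where "A = (\<lambda>n::nat. {y \<in> ball a R. real n < norm (t y)})"
  have A: "A n \<in> lmeasurable" for n
  proof -
    have "(\<lambda>y. norm (t y)) \<in> borel_measurable lebesgue" using t by measurable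
    then show ?thesis unfolding A_def by (rule lmeasurable_ball_Collect)
  qed
  have "(\<lambda>n. measure lebesgue (A n)) \<longlonglongrightarrow> measure lebesgue (\<Inter>n. A n)"
  proof (rule Lim_measure_decseq)
    show "range A \<subseteq> sets lebesgue" using A fmeasurableD by blast
    show "decseq A" by (auto simp: decseq_def A_def)
    show "emeasure lebesgue (A n) \<noteq> \<infinity>" for n using fmeasurableD2[OF A] by simp
  qed
  moreover have "(\<Inter>n. A n) = {}"
  proof -
    have "\<exists>n::nat. \<not> real n < norm (t y)" for y using reals_Archimedean2[of "norm (t y)"] by (meson less_asym)
    then show ?thesis by (auto simp: A_def)
  qed
  ultimately have "(\<lambda>n. measure lebesgue (A n)) \<longlonglongrightarrow> 0" by simp
  then have "\<forall>\<^sub>F n in sequentially. measure lebesgue (A n) < e" using e by (rule order_tendstoD)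
  then obtain n where "measure lebesgue (A n) < e" by (auto simp: eventually_sequentially)
  then show ?thesis using that A unfolding A_def by blast
qed

context elliptic_homogeneous
begin

text \<open>Testing \<open>h\<close>-monotonicity of \<open>\<xi> \<in> T x\<close>, \<open>V = x - \<xi>\<close>, against some \<open>y\<close> near \<open>x - V / |V|\<close> at which a
  bound for \<open>t\<close> is known, the increment \<open>h V - h (V - (x - y))\<close> is at least of order \<open>|V|\<close> to the power
  \<open>p - 1\<close>, whereas the other side stays bounded.\<close>

lemma h_monotone_locally_bounded:
  assumes mono: "h_monotone h T" and sel: "AE x in lebesgue. t x \<in> T x"
    and tm: "t \<in> borel_measurable lebesgue"
  obtains B where "\<forall>x \<xi>. norm x \<le> R \<longrightarrow> \<xi> \<in> T x \<longrightarrow> norm \<xi> \<le> B"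
proof -
  obtain c where c: "c > 0" "\<forall>x. x \<noteq> 0 \<longrightarrow> c * norm x powr p \<le> h x" by (rule lower_bound)
  obtain G where G: "0 \<le> G" "\<forall>x y. norm x \<le> 2 \<longrightarrow> norm y \<le> 2 \<longrightarrow> \<bar>h x - h y\<bar> \<le> G * norm (x - y)"
    by (rule C1_lipschitz_cball[OF Ck_2_C1(1)[OF C2]])
  \<comment> \<open>A deviation of \<open>y\<close> from its ideal position by less than
    \<open>\<delta>\<close> costs at most \<open>G * \<delta> \<le> c / 2\<close>, half of the gain
    \<open>c\<close>, both measured in units of \<open>norm V powr (p - 1)\<close>.\<close>
  define \<delta> where "\<delta> = min (1/2) (c / (2 * (G + 1)))"
  have \<delta>: "\<delta> > 0" "\<delta> \<le> 1/2"
  proof -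
    show "\<delta> > 0" using c(1) G(1) by (simp add: \<delta>_def)
    show "\<delta> \<le> 1/2" unfolding \<delta>_def by (rule min.cobounded1)
  qed
  have G\<delta>: "G * \<delta> \<le> c / 2"
  proof -
    have "G * \<delta> \<le> (G + 1) * (c / (2 * (G + 1)))"
      using G(1) \<delta>(1) by (intro mult_mono) (auto simp: \<delta>_def)
    also have "\<dots> = c / 2"
    proof -
      have "G + 1 \<noteq> 0" using G(1) by linarith
      then show ?thesis by (simp add: divide_simps)
    qed
    finally show ?thesis .
  qed
  have m0: "measure lebesgue (ball (0::'a) \<delta>) > 0" using \<delta>(1) content_ball_pos[of \<delta> "0::'a"] by simp
  obtain n :: nat where n: "measure lebesgue {y \<in> ball 0 (R + 2). real n < norm (t y)} < measure lebesgue (ball (0::'a) \<delta>)"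
    "{y \<in> ball 0 (R + 2). real n < norm (t y)} \<in> lmeasurable"
    by (rule measurable_tail_small[OF tm m0])
  \<comment> \<open>This set has less measure than a ball of radius \<open>\<delta>\<close>, so even
    together with a null set it cannot contain one.\<close>
  define Z where "Z = {y \<in> ball 0 (R + 2). real n < norm (t y)}"
  obtain N where N: "negligible N" "{x. t x \<notin> T x} \<subseteq> N"
    using sel unfolding eventually_ae_filter_negligible by blast
  have "locally_bounded h" by (intro continuous_locally_bounded continuous)
  then obtain H where H: "H > 0" "\<forall>x. norm x \<le> R + real n \<longrightarrow> norm (h x) \<le> H" by (rule locally_boundedD)
  have "norm \<xi> \<le> R + max 2 (2 * H / c)" if x: "norm x \<le> R" and \<xi>: "\<xi> \<in> T x" for x \<xi>
  proof -
    define V where "V = x - \<xi>"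
    have "norm V \<le> max 2 (2 * H / c)"
    proof (cases "norm V \<le> 2")
      case False
      then have V: "norm V > 2" by simp
      define e where "e = V /\<^sub>R norm V"
      have V0: "V \<noteq> 0" using V by auto
      then have e: "norm e = 1" "V = norm V *\<^sub>R e" by (auto simp: e_def)
      have sub: "ball (x - e) \<delta> \<subseteq> ball 0 (R + 2)"
      proof
        fix y assume "y \<in> ball (x - e) \<delta>"
        then have "norm (y - (x - e)) < \<delta>" by (simp add: dist_norm norm_minus_commute)
        then show "y \<in> ball 0 (R + 2)"
          using norm_triangle_ineq[of "y - (x - e)" "x - e"] norm_triangle_ineq4[of x e] e(1) x \<delta>(2) by simp
      qed
      have "\<not> ball (x - e) \<delta> \<subseteq> Z \<union> N"
      proof
        assume *: "ball (x - e) \<delta> \<subseteq> Z \<union> N"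
        have "measure lebesgue (ball (x - e) \<delta>) \<le> measure lebesgue (Z \<union> N)"
          using n(2) negligible_imp_measurable[OF N(1)] unfolding Z_def[symmetric]
          by (intro measure_mono_fmeasurable[OF *] fmeasurable.Un) auto
        also have "\<dots> = measure lebesgue Z"
          using n(2) N(1) unfolding Z_def[symmetric]
          by (intro measure_Un_null_set fmeasurableD) (auto simp: negligible_iff_null_sets)
        also have "\<dots> < measure lebesgue (ball (0::'a) \<delta>)" using n(1) by (simp add: Z_def)
        also have "\<dots> = measure lebesgue (ball (x - e) \<delta>)"
          using measure_ball_scale[of 1 \<delta> "0::'a" "x - e"] \<delta>(1) by simp
        finally show False by simp
      qed
      then obtain y where y: "y \<in> ball (x - e) \<delta>" "y \<notin> Z" "y \<notin> N" by blast
      have yT: "t y \<in> T y" using y(3) N(2) by blast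
      have ty: "norm (t y) \<le> real n"
      proof -
        have "y \<in> ball 0 (R + 2)" using y(1) sub by blast
        then show ?thesis using y(2) by (simp add: Z_def not_less)
      qed
      define \<eta> where "\<eta> = y - (x - e)"
      have \<eta>: "norm \<eta> < \<delta>" using y(1) by (simp add: \<eta>_def dist_norm norm_minus_commute)
      have "h (x - \<xi>) + h (y - t y) \<le> h (x - t y) + h (y - \<xi>)"
        using mono \<xi> yT unfolding h_monotone_def by blast
      moreover have "y - \<xi> = V - e + \<eta>" by (simp add: V_def \<eta>_def)
      moreover have "h (x - t y) \<le> H"
      proof -
        have "norm (x - t y) \<le> R + real n" using norm_triangle_ineq4[of x "t y"] x ty by linarith
        then have "norm (h (x - t y)) \<le> H" using H(2) by blast
        then show ?thesis by simp
      qed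
      ultimately have 1: "h V \<le> H + h (V - e + \<eta>)" using nonneg[of "y - t y"] by (simp add: V_def)
      let ?s = "1 - 1 / norm V"
      have V1: "0 < norm V" "1 < norm V" using V V0 by linarith+
      then have "1 / norm V < 1" "0 \<le> 1 / norm V" by (simp_all only: divide_less_eq_1_pos zero_le_divide_1_iff less_imp_le)
      then have s: "0 < ?s" "?s \<le> 1" by linarith+
      have "V - e = ?s *\<^sub>R V" using V V0 by (simp add: e_def scaleR_left_diff_distrib inverse_eq_divide)
      then have "h (V - e) = ?s powr p * h V" using hom[OF s(1), of V] by simp
      \<comment> \<open>Since \<open>?s \<le> 1\<close> and \<open>p \<ge> 1\<close>, one unit step
        from \<open>V\<close> towards the origin lowers \<open>h\<close> by at least
        \<open>h V / norm V\<close>.\<close>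
      also have "\<dots> \<le> ?s * h V"
      proof (intro mult_right_mono nonneg)
        show "?s powr p \<le> ?s" using powr_mono'[of 1 p ?s] s p by simp
      qed
      finally have 2: "h (V - e) \<le> h V - h V / norm V" by (simp add: left_diff_distrib)
      have Vp: "norm V powr p = norm V * norm V powr (p - 1)" using V V0 by (simp add: powr_diff)
      \<comment> \<open>Homogeneity rescales both points into the ball of radius 2, where
        \<open>h\<close> is Lipschitz with the fixed constant \<open>G\<close>.\<close>
      have 3: "h (V - e + \<eta>) \<le> h (V - e) + c / 2 * norm V powr (p - 1)"
      proof -
        let ?a = "(V - e + \<eta>) /\<^sub>R norm V" and ?b = "(V - e) /\<^sub>R norm V"
        have sc: "h z = norm V powr p * h (z /\<^sub>R norm V)" for z
          using hom[of "norm V" "z /\<^sub>R norm V"] V0 by simp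
        have "norm (V - e + \<eta>) \<le> norm V + 2"
          using norm_triangle_ineq[of "V - e" \<eta>] norm_triangle_ineq4[of V e] e(1) \<eta> \<delta>(2) by simp
        then have a: "norm ?a \<le> 2" using V V0 by (simp add: divide_le_eq inverse_eq_divide)
        have "norm (V - e) \<le> norm V + 1" using norm_triangle_ineq4[of V e] e(1) by simp
        then have b: "norm ?b \<le> 2" using V V0 by (simp add: divide_le_eq inverse_eq_divide)
        have ab: "?a - ?b = \<eta> /\<^sub>R norm V" by (simp add: scaleR_right_distrib scaleR_right_diff_distrib)
        have "h ?a - h ?b \<le> G * norm (?a - ?b)" using G(2) a b abs_le_D1 by blast
        also have "\<dots> = G * norm \<eta> / norm V" unfolding ab by (simp add: divide_inverse mult_ac)
        also have "\<dots> \<le> G * \<delta> / norm V" using \<eta> G(1) by (intro divide_right_mono mult_left_mono) auto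
        also have "\<dots> \<le> (c / 2) / norm V" using G\<delta> by (intro divide_right_mono) auto
        finally have "norm V powr p * (h ?a - h ?b) \<le> norm V powr p * ((c / 2) / norm V)"
          by (intro mult_left_mono) auto
        also have "\<dots> = c / 2 * norm V powr (p - 1)" using V V0 by (simp add: Vp)
        finally show ?thesis using sc[of "V - e + \<eta>"] sc[of "V - e"] by (simp add: right_diff_distrib)
      qed
      have "c * norm V powr (p - 1) \<le> h V / norm V"
      proof -
        have "V \<noteq> 0" using V V0 by auto
        then have "c * norm V powr p \<le> h V" using c(2) by blast
        then show ?thesis using V V0 by (simp add: pos_le_divide_eq Vp mult_ac)
      qed
      then have "c / 2 * norm V powr (p - 1) \<le> H" using 1 2 3 by linarith
      \<comment> \<open>As \<open>norm V > 1\<close> and \<open>p - 1 \<ge> 1\<close>, the bound on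
        the power becomes a bound on \<open>norm V\<close> itself.\<close>
      moreover have "norm V powr 1 \<le> norm V powr (p - 1)" using V V0 p by (intro powr_mono) auto
      then have "c / 2 * norm V \<le> c / 2 * norm V powr (p - 1)" using V c(1) by (intro mult_left_mono) auto
      ultimately have "c / 2 * norm V \<le> H" by linarith
      then have "norm V * c \<le> 2 * H" by (simp add: mult.commute)
      then have "norm V \<le> 2 * H / c" using c(1) by (simp add: pos_le_divide_eq)
      then show ?thesis by simp
    qed simp
    moreover have "norm \<xi> \<le> norm x + norm V" using norm_triangle_ineq4[of x V] by (simp add: V_def)
    ultimately show ?thesis using x by linarith
  qed
  then show ?thesis by (intro that[of "R + max 2 (2 * H / c)"]) blast
qed

text \<open>\<open>h\<close> is expanded at \<open>x - t x\<close> with increment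
  \<open>y - x\<close> and at \<open>y - t y\<close> with increment \<open>x - y\<close>. The
  increments land exactly on the cross terms \<open>y - t x\<close> and \<open>x - t y\<close>, so
  in combination with \<open>h\<close>-monotonicity all values of \<open>h\<close> cancel. Local
  boundedness of \<open>T\<close> keeps the four points in one ball and the constant
  uniform.\<close>

lemma h_monotone_one_sided_lipschitz:
  assumes mono: "h_monotone h T" and sel: "AE x in lebesgue. t x \<in> T x"
    and tm: "t \<in> borel_measurable lebesgue"
  shows "\<exists>K. \<forall>x y. t x \<in> T x \<longrightarrow> t y \<in> T y \<longrightarrow> norm x \<le> R \<longrightarrow> norm y \<le> R \<longrightarrow>
    (grad h (y - t y) - grad h (x - t x)) \<bullet> (y - x) \<le> K * (norm (y - x))\<^sup>2"
proof -
  obtain B where B: "\<forall>x \<xi>. norm x \<le> R \<longrightarrow> \<xi> \<in> T x \<longrightarrow> norm \<xi> \<le> B"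
    by (rule h_monotone_locally_bounded[OF mono sel tm])
  obtain L where L: "0 \<le> L" "\<forall>x w. norm x \<le> R + B \<longrightarrow> norm (x + w) \<le> R + B \<longrightarrow>
      h (x + w) \<le> h x + grad h x \<bullet> w + L * (norm w)\<^sup>2"
    by (rule Ck_2_quadratic_upper_bound[OF C2])
  have "(grad h (y - t y) - grad h (x - t x)) \<bullet> (y - x) \<le> (2 * L) * (norm (y - x))\<^sup>2"
    if xT: "t x \<in> T x" "t y \<in> T y" and xR: "norm x \<le> R" "norm y \<le> R" for x y
  proof -
    have b: "norm (a - t z) \<le> R + B" if "norm a \<le> R" "z = x \<or> z = y" for a z
    proof -
      have "norm (t z) \<le> B" using that B xT xR by blast
      then show ?thesis using norm_triangle_ineq4[of a "t z"] that(1) by linarith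
    qed
    define w where "w = y - x"
    have "h (x - t x + w) \<le> h (x - t x) + grad h (x - t x) \<bullet> w + L * (norm w)\<^sup>2"
      using L(2)[rule_format, of "x - t x" w] b[OF xR(1), of x] b[OF xR(2), of x] by (simp add: w_def)
    moreover have "h (y - t y + (- w)) \<le> h (y - t y) + grad h (y - t y) \<bullet> (- w) + L * (norm w)\<^sup>2"
      using L(2)[rule_format, of "y - t y" "- w"] b[OF xR(1), of y] b[OF xR(2), of y] by (simp add: w_def norm_minus_commute)
    moreover have "h (x - t x) + h (y - t y) \<le> h (x - t y) + h (y - t x)"
      using mono xT unfolding h_monotone_def by blast
    moreover have "h (x - t x + w) = h (y - t x)" "h (y - t y + (- w)) = h (x - t y)" by (simp_all add: w_def)
    moreover have "grad h (y - t y) \<bullet> (- w) = - (grad h (y - t y) \<bullet> w)" by simp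
    ultimately have "grad h (y - t y) \<bullet> w - grad h (x - t x) \<bullet> w \<le> 2 * (L * (norm w)\<^sup>2)"
      by linarith
    then show ?thesis by (simp add: w_def inner_diff_left)
  qed
  then show ?thesis by blast
qed

end

text \<open>The estimates can thus be carried out for a version of the map that is bounded on every
  ball and then transferred to the map itself.\<close>

lemma bounded_deformation_cong_AE:
  assumes bd: "bounded_deformation u" and v: "v \<in> borel_measurable lebesgue"
    and eq: "AE x in lebesgue. u x = v x"
  shows "bounded_deformation v"
proof -
  have um: "u \<in> borel_measurable lebesgue" using bd by (simp add: bounded_deformation_def L1_loc_def)
  have "L1_loc v"
    unfolding L1_loc_def
  proof (intro conjI allI impI v)
    fix K :: "'a set" assume K: "compact K"
    have Ks: "K \<in> sets lebesgue" using K compact_imp_closed borel_closed by fastforce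
    have "integrable lebesgue (\<lambda>x. indicator K x *\<^sub>R u x)"
      using bd K by (simp add: bounded_deformation_def L1_loc_def set_integrable_def)
    moreover have "(\<lambda>x. indicator K x *\<^sub>R v x) \<in> borel_measurable lebesgue"
      using Ks v by (intro borel_measurable_scaleR borel_measurable_indicator)
    moreover have "AE x in lebesgue. indicator K x *\<^sub>R u x = indicator K x *\<^sub>R v x"
      using eq by eventually_elim simp
    ultimately show "set_integrable lebesgue K v"
      unfolding set_integrable_def using integrable_cong_AE_imp by metis
  qed
  moreover have "represented_by_signed_radon
        (\<lambda>\<phi>. - (1/2) * (\<integral>x. (v x \<bullet> i) * frechet_derivative \<phi> (at x) j
                              + (v x \<bullet> j) * frechet_derivative \<phi> (at x) i \<partial>lebesgue))"
    if ij: "i \<in> Basis" "j \<in> Basis" for i j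
  proof -
    have "(\<integral>x. (v x \<bullet> i) * frechet_derivative \<phi> (at x) j + (v x \<bullet> j) * frechet_derivative \<phi> (at x) i \<partial>lebesgue)
      = (\<integral>x. (u x \<bullet> i) * frechet_derivative \<phi> (at x) j + (u x \<bullet> j) * frechet_derivative \<phi> (at x) i \<partial>lebesgue)"
      if "test_fn \<phi>" for \<phi>
    proof (rule integral_cong_AE)
      have \<phi>: "C1 \<phi>" by (intro C1c_C1 test_fn_C1c that)
      have "continuous_on UNIV (\<lambda>x. grad \<phi> x \<bullet> w)" for w
        by (intro continuous_intros C1_continuous_grad \<phi>)
      then have "(\<lambda>x. grad \<phi> x \<bullet> w) \<in> borel_measurable borel" for w by (rule borel_measurable_continuous_onI)
      then have f: "(\<lambda>x. frechet_derivative \<phi> (at x) w) \<in> borel_measurable lebesgue" for w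
        by (simp add: frechet_derivative_grad[OF C1_differentiable[OF \<phi>]] measurable_completion)
      show "(\<lambda>x. (v x \<bullet> i) * frechet_derivative \<phi> (at x) j + (v x \<bullet> j) * frechet_derivative \<phi> (at x) i) \<in> borel_measurable lebesgue"
        "(\<lambda>x. (u x \<bullet> i) * frechet_derivative \<phi> (at x) j + (u x \<bullet> j) * frechet_derivative \<phi> (at x) i) \<in> borel_measurable lebesgue"
        using f um v by (auto intro!: borel_measurable_add borel_measurable_times borel_measurable_inner)
    qed (use eq in \<open>eventually_elim, simp\<close>)
    then show ?thesis
      using bd ij unfolding bounded_deformation_def represented_by_signed_radon_def by simp
  qed
  ultimately show ?thesis by (simp add: bounded_deformation_def)
qed

text \<open>Off a null set, the expansion at \<open>x0\<close> approximates \<open>u\<close> within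
  \<open>e / 2 * r\<close> on the whole ball of radius \<open>r\<close>, which bounds the mean of
  the deviation; values outside \<open>D\<close> do not affect integrals.\<close>

lemma t11_of_differentiable:
  fixes u :: "'a::euclidean_space \<Rightarrow> 'a"
  assumes u: "L1_loc u" and D: "AE x in lebesgue. x \<in> D" and A: "linear A"
    and diff: "\<And>e. e > 0 \<Longrightarrow> \<exists>d>0. \<forall>y\<in>D. norm (y - x0) < d \<longrightarrow> norm (u y - u x0 - A (y - x0)) \<le> e * norm (y - x0)"
  shows "t11 u x0"
  unfolding t11_def
proof
  fix i :: 'a assume i: "i \<in> Basis"
  define f where "f = (\<lambda>x. u x \<bullet> i)"
  \<comment> \<open>The row of \<open>A\<close> belonging to \<open>i\<close>; the constant
    \<open>c\<close> below makes the affine function agree with \<open>f\<close> at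
    \<open>x0\<close>.\<close>
  define a where "a = adjoint A i"
  define c where "c = u x0 \<bullet> i - a \<bullet> x0"
  have Aa: "A x \<bullet> i = a \<bullet> x" for x using adjoint_works[OF A, of x i] by (simp add: a_def inner_commute)
  have "set_integrable lebesgue (ball x0 1) f"
  proof -
    have "set_integrable lebesgue (cball x0 1) u" using u by (simp add: L1_loc_def)
    then have "set_integrable lebesgue (ball x0 1) u" by (rule set_integrable_subset) auto
    then have "integrable lebesgue (\<lambda>x. (indicator (ball x0 1) x *\<^sub>R u x) \<bullet> i)"
      unfolding set_integrable_def by (rule integrable_inner_left)
    then show ?thesis unfolding set_integrable_def f_def by simp
  qed
  moreover have "((\<lambda>r. ((LINT x:ball x0 r|lebesgue. \<bar>f x - (c + a \<bullet> x)\<bar>)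
                  / measure lebesgue (ball x0 r)) / r) \<longlongrightarrow> 0) (at_right 0)"
  proof (rule tendstoI)
    fix e :: real assume e: "0 < e"
    then obtain d where d: "d > 0" "\<forall>y\<in>D. norm (y - x0) < d \<longrightarrow> norm (u y - u x0 - A (y - x0)) \<le> e / 2 * norm (y - x0)"
      using diff[of "e / 2"] by auto
    have "dist (((LINT x:ball x0 r|lebesgue. \<bar>f x - (c + a \<bullet> x)\<bar>) / measure lebesgue (ball x0 r)) / r) 0 < e"
      if r: "0 < r" "r < d" for r
    proof -
      let ?I = "LINT x:ball x0 r|lebesgue. \<bar>f x - (c + a \<bullet> x)\<bar>"
      have m: "measure lebesgue (ball x0 r) > 0" using r(1) content_ball_pos[of r x0] by simp
      have "?I \<le> (\<integral>x. e / 2 * r * indicator (ball x0 r) x \<partial>lebesgue)"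
        unfolding set_lebesgue_integral_def
      proof (rule integral_mono_AE')
        show "integrable lebesgue (\<lambda>x. e / 2 * r * indicator (ball x0 r) x)"
          by (intro integrable_mult_right integrable_indicator_lmeasurable lmeasurable_ball)
        show "AE x in lebesgue. indicator (ball x0 r) x *\<^sub>R \<bar>f x - (c + a \<bullet> x)\<bar> \<le> e / 2 * r * indicator (ball x0 r) x"
          using D
        proof eventually_elim
          case (elim x)
          show ?case
          proof (cases "x \<in> ball x0 r")
            case True
            then have x: "norm (x - x0) < r" by (simp add: dist_norm norm_minus_commute)
            have "f x - (c + a \<bullet> x) = (u x - u x0 - A (x - x0)) \<bullet> i"
              by (simp add: f_def c_def inner_diff_left Aa inner_diff_right)
            then have "\<bar>f x - (c + a \<bullet> x)\<bar> \<le> norm (u x - u x0 - A (x - x0))"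
              using Basis_le_norm[OF i] by simp
            also have "\<dots> \<le> e / 2 * norm (x - x0)" using d(2) elim x r(2) by auto
            also have "\<dots> \<le> e / 2 * r" using x e by (intro mult_left_mono) auto
            finally show ?thesis using True by simp
          qed simp
        qed
      qed (use e r in \<open>auto intro!: AE_I2\<close>)
      also have "\<dots> = (e / 2 * r) * measure lebesgue (ball x0 r)" by simp
      finally have le: "?I \<le> (e / 2 * r) * measure lebesgue (ball x0 r)" .
      have "0 \<le> ?I" unfolding set_lebesgue_integral_def by (intro integral_nonneg_AE AE_I2) simp
      moreover have "?I / measure lebesgue (ball x0 r) \<le> e / 2 * r" using le m by (simp only: pos_divide_le_eq)
      then have "?I / measure lebesgue (ball x0 r) / r \<le> e / 2" using r(1) by (simp only: pos_divide_le_eq)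
      moreover have "0 \<le> ?I / measure lebesgue (ball x0 r) / r" using calculation(1) m r(1) by (intro divide_nonneg_nonneg) auto
      ultimately show ?thesis using e unfolding dist_real_def by linarith
    qed
    then show "\<forall>\<^sub>F r in at_right 0. dist (((LINT x:ball x0 r|lebesgue. \<bar>f x - (c + a \<bullet> x)\<bar>) / measure lebesgue (ball x0 r)) / r) 0 < e"
      unfolding eventually_at_right_field using d(1) by blast
  qed
  ultimately show "t11_real (\<lambda>x. u x \<bullet> i) x0"
    unfolding t11_real_def f_def using zero_less_one by blast
qed

theorem theorem5p2:
  fixes h :: "'a::euclidean_space \<Rightarrow> real"
    and p lam Lam :: real
    and T :: "'a \<Rightarrow> 'a set"
    and t :: "'a \<Rightarrow> 'a"
  assumes p: "p \<ge> 2"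
    and h_C2: "Ck 2 h"
    and h_nonneg: "\<forall>x. h x \<ge> 0"
    and h_hom: "\<forall>x. \<forall>s>0. h (s *\<^sub>R x) = s powr p * h x"
    and ellip_pos: "0 < lam" "lam \<le> Lam"
    and ellip: "\<forall>x v. norm x = 1 \<longrightarrow>
                  lam * (norm v)\<^sup>2 \<le> hess_form h x v \<and> hess_form h x v \<le> Lam * (norm v)\<^sup>2"
    and T_mono: "h_monotone h T"
    and t_sel: "AE x in lebesgue. t x \<in> T x"
    and t_int: "Lq_loc (p - 1) t"
  shows "bounded_deformation (\<lambda>x. grad h (x - t x))
         \<and> (AE x0 in lebesgue. t11 (\<lambda>x. grad h (x - t x)) x0)"
proof -
  interpret elliptic_homogeneous h p lam
    by unfold_locales (use p h_C2 h_nonneg h_hom ellip_pos ellip in auto)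
  have tm: "t \<in> borel_measurable lebesgue" using t_int by (simp add: Lq_loc_def)
  define D where "D = {x. t x \<in> T x}"
  have D: "AE x in lebesgue. x \<in> D" using t_sel by (simp add: D_def)
  define u where "u = (\<lambda>x. grad h (x - t x))"
  have cg: "continuous_on UNIV (grad h)" by (intro C1_continuous_grad Ck_2_C1 h_C2)
  have um: "u \<in> borel_measurable lebesgue"
  proof -
    have "(\<lambda>x. x - t x) \<in> borel_measurable lebesgue"
      using tm by (intro borel_measurable_diff) (auto simp: measurable_completion)
    then show ?thesis unfolding u_def
      by (rule measurable_compose[OF _ borel_measurable_continuous_onI[OF cg]])
  qed
  \<comment> \<open>Off \<open>D\<close> the values of \<open>t\<close> are not controlled by
    \<open>T\<close> and may be unbounded; setting the map to 0 there makes it locally bounded at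
    every point.\<close>
  define v where "v = (\<lambda>x. indicator D x *\<^sub>R u x)"
  have uv: "AE x in lebesgue. v x = u x" using D by eventually_elim (simp add: v_def)
  have Ds: "D \<in> sets lebesgue"
  proof -
    obtain N where "negligible N" "{x. x \<notin> D} \<subseteq> N" using D unfolding eventually_ae_filter_negligible by blast
    then have "negligible (- D)" by (elim negligible_subset) auto
    then have "space lebesgue - (- D) \<in> sets lebesgue" by (intro sets.compl_sets negligible_imp_sets)
    then show ?thesis by (simp add: Diff_Compl)
  qed
  have vm: "v \<in> borel_measurable lebesgue"
    unfolding v_def using Ds um by (intro borel_measurable_scaleR borel_measurable_indicator)
  have vb: "locally_bounded v"
    unfolding locally_bounded_def
  proof
    fix R
    obtain B where B: "\<forall>x \<xi>. norm x \<le> R \<longrightarrow> \<xi> \<in> T x \<longrightarrow> norm \<xi> \<le> B"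
      by (rule h_monotone_locally_bounded[OF T_mono t_sel tm])
    obtain C where C: "C > 0" "\<forall>x. norm x \<le> R + B \<longrightarrow> norm (grad h x) \<le> C"
      by (rule locally_boundedD[OF continuous_locally_bounded[OF cg]])
    have "norm (v x) \<le> C" if x: "norm x \<le> R" for x
    proof (cases "x \<in> D")
      case True
      then have "norm (t x) \<le> B" using B x by (simp add: D_def)
      then have "norm (x - t x) \<le> R + B" using norm_triangle_ineq4[of x "t x"] x by linarith
      then show ?thesis using C(2) True by (simp add: v_def u_def)
    qed (use C in \<open>simp add: v_def\<close>)
    then show "\<exists>B. \<forall>x. norm x \<le> R \<longrightarrow> norm (v x) \<le> B" by blast
  qed
  have os: "\<exists>K. \<forall>x\<in>D. \<forall>y\<in>D. norm x \<le> R \<longrightarrow> norm y \<le> R \<longrightarrow>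
      (v y - v x) \<bullet> (y - x) \<le> K * (norm (y - x))\<^sup>2" for R
  proof -
    obtain K where K: "\<forall>x y. t x \<in> T x \<longrightarrow> t y \<in> T y \<longrightarrow> norm x \<le> R \<longrightarrow> norm y \<le> R \<longrightarrow>
        (grad h (y - t y) - grad h (x - t x)) \<bullet> (y - x) \<le> K * (norm (y - x))\<^sup>2"
      using h_monotone_one_sided_lipschitz[OF T_mono t_sel tm] by blast
    show ?thesis by (intro exI[of _ K]) (use K in \<open>auto simp: v_def D_def u_def\<close>)
  qed
  have "bounded_deformation v"
    by (rule bounded_deformation_one_sided_lipschitz[OF vm vb D os])
  then have bd: "bounded_deformation u" by (rule bounded_deformation_cong_AE[OF _ um uv])
  then have L1: "L1_loc u" by (simp add: bounded_deformation_def)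
  obtain K where K: "\<And>R x y. x \<in> D \<Longrightarrow> y \<in> D \<Longrightarrow> norm x \<le> R \<Longrightarrow> norm y \<le> R \<Longrightarrow>
      (v y - v x) \<bullet> (y - x) \<le> K R * (norm (y - x))\<^sup>2"
    using os by metis
  \<comment> \<open>The one-sided constant depends on the ball, so a monotone map
    \<open>K (real n) *\<^sub>R y - v y\<close> is formed separately for each integer
    radius.\<close>
  have "AE x in lebesgue. norm x < real n \<longrightarrow> (\<exists>A. linear A \<and> (\<forall>e>0. \<exists>d>0. \<forall>y\<in>D. norm (y - x) < d \<longrightarrow>
      norm ((K (real n) *\<^sub>R y - v y) - (K (real n) *\<^sub>R x - v x) - A (y - x)) \<le> e * norm (y - x)))" for n
  proof (rule monotone_differentiable_AE[OF _ D])
    fix x y assume xy: "x \<in> D" "y \<in> D" "norm x < real n" "norm y < real n"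
    have "((K (real n) *\<^sub>R y - v y) - (K (real n) *\<^sub>R x - v x)) \<bullet> (y - x)
        = K (real n) * (norm (y - x))\<^sup>2 - (v y - v x) \<bullet> (y - x)"
      by (simp add: power2_norm_eq_inner inner_diff_left inner_diff_right algebra_simps)
    then show "0 \<le> ((K (real n) *\<^sub>R y - v y) - (K (real n) *\<^sub>R x - v x)) \<bullet> (y - x)"
      using K[of x y "real n"] xy by simp
  next
    show "(\<lambda>x. K (real n) *\<^sub>R x - v x) \<in> borel_measurable lebesgue"
      using vm by (intro borel_measurable_diff) (auto simp: measurable_completion)
  qed
  then have "AE x in lebesgue. \<forall>n. norm x < real n \<longrightarrow> (\<exists>A. linear A \<and> (\<forall>e>0. \<exists>d>0. \<forall>y\<in>D. norm (y - x) < d \<longrightarrow>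
      norm ((K (real n) *\<^sub>R y - v y) - (K (real n) *\<^sub>R x - v x) - A (y - x)) \<le> e * norm (y - x)))"
    unfolding AE_all_countable by blast
  then have "AE x in lebesgue. t11 u x"
    using D
  proof eventually_elim
    case (elim x)
    obtain n where n: "norm x < real n" using reals_Archimedean2 by blast
    then obtain A where A: "linear A" "\<forall>e>0. \<exists>d>0. \<forall>y\<in>D. norm (y - x) < d \<longrightarrow>
      norm ((K (real n) *\<^sub>R y - v y) - (K (real n) *\<^sub>R x - v x) - A (y - x)) \<le> e * norm (y - x)"
      using elim(1) by blast
    show ?case
    proof (rule t11_of_differentiable[OF L1 D])
      \<comment> \<open>On \<open>D\<close>, \<open>u\<close> is \<open>K (real n)\<close> times the
        identity minus the monotone map, and its derivative is obtained accordingly.\<close>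
      show "linear (\<lambda>w. K (real n) *\<^sub>R w - A w)"
        by (intro linear_compose_sub A(1) linear_scale_self)
      fix e :: real assume "e > 0"
      then obtain d where d: "d > 0" "\<forall>y\<in>D. norm (y - x) < d \<longrightarrow>
        norm ((K (real n) *\<^sub>R y - v y) - (K (real n) *\<^sub>R x - v x) - A (y - x)) \<le> e * norm (y - x)"
        using A(2) by blast
      have "norm (u y - u x - (K (real n) *\<^sub>R (y - x) - A (y - x))) \<le> e * norm (y - x)"
        if y: "y \<in> D" "norm (y - x) < d" for y
      proof -
        have "u y - u x - (K (real n) *\<^sub>R (y - x) - A (y - x))
            = - ((K (real n) *\<^sub>R y - v y) - (K (real n) *\<^sub>R x - v x) - A (y - x))"
          using y(1) elim(2) by (simp add: v_def scaleR_right_diff_distrib)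
        then show ?thesis using d(2) y by (simp only: norm_minus_cancel)
      qed
      then show "\<exists>d>0. \<forall>y\<in>D. norm (y - x) < d \<longrightarrow>
          norm (u y - u x - (K (real n) *\<^sub>R (y - x) - A (y - x))) \<le> e * norm (y - x)"
        using d(1) by blast
    qed
  qed
  then show ?thesis using bd unfolding u_def by blast
qed

end
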